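(* Let $n\ge 3$, $m\ge 2$, let $M$ be an oriented $n$-dimensional submanifold of $\mathbb{R}^{n+m}$ with parallel mean curvature, let $\gamma:M\to G_{n,m}$ be its Gauss map and let $B$ be its second fundamental form. Then for arbitrary $p\in M$ and $P_0\in G_{n,m}$: if $v(\gamma(p),P_0)\le 3$, then $$\Delta\big(v(\cdot,P_0)\circ\gamma\big)\ge 0\quad\text{at }p.$$ Moreover, for every $\beta_0<3$ there exists a positive constant $K_0$, depending only on $\beta_0$, such that if $v(\gamma(p),P_0)\le\beta_0$, then $$\Delta\big(v(\cdot,P_0)\circ\gamma\big)\ge K_0|B|^2\quad\text{at }p.$$
   Context: $G_{n,m}$ is the Grassmann manifold of oriented $n$-dimensional linear subspaces of $\mathbb{R}^{n+m}$. For $P,Q\in G_{n,m}$ with oriented orthonormal bases $e_1,\dots,e_n$ of $P$ and $f_1,\dots,f_n$ of $Q$, put $w(P,Q)=\langle e_1\wedge\cdots\wedge e_n,f_1\wedge\cdots\wedge f_n\rangle=\det(\langle e_i,f_j\rangle)$. When $w(P,Q)>0$, define $v(P,Q)=w(P,Q)^{-1}$ (so $v\ge 1$). A condition such as $v(P,Q)\le c$ includes the requirement $w(P,Q)>0$. The Gauss map is $\gamma(p)=T_pM\in G_{n,m}$ (parallel translated to the origin). $M$ carries the induced metric, $\Delta$ is its Laplace-Beltrami operator (with the sign for which $\Delta=\sum\partial_i^2$ on flat space), and $|B|^2$ is the squared norm of the second fundamental form, i.e. the sum of squares of its coefficients in orthonormal tangent and normal frames. $M$ has parallel mean curvature if its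 mean curvature vector $H$ satisfies $\nabla^\perp H=0$ for the normal connection $\nabla^\perp$. *)

theory Defs
  imports "HOL-Analysis.Analysis" "Jordan_Normal_Form.Determinant"
begin

text \<open>
  The dimensions n and m are natural numbers, not types, because the constant in the theorem
  must be chosen before n and m. Accordingly the space of dimension N is
  \<^term>\<open>Euclidean_space N\<close>: its points are the sequences that vanish from index N on, with the
  product topology. Indices run over 0, ..., N - 1.
\<close>

type_synonym vect = "nat \<Rightarrow> real"

hide_const (open) Determinants.det Finite_Cartesian_Product.mat


subsection \<open>Linear algebra\<close>

definition ip :: "nat \<Rightarrow> vect \<Rightarrow> vect \<Rightarrow> real" where
  "ip N x y = (\<Sum>k<N. x k * y k)"

definition lincomb :: "nat \<Rightarrow> (nat \<Rightarrow> real) \<Rightarrow> (nat \<Rightarrow> vect) \<Rightarrow> vect" where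
  "lincomb n c b = (\<lambda>k. \<Sum>i<n. c i * b i k)"

definition lin_indep :: "nat \<Rightarrow> (nat \<Rightarrow> vect) \<Rightarrow> bool" where
  "lin_indep n b \<longleftrightarrow> (\<forall>c. lincomb n c b = (\<lambda>k. 0) \<longrightarrow> (\<forall>i<n. c i = 0))"

definition orthonormal :: "nat \<Rightarrow> nat \<Rightarrow> (nat \<Rightarrow> vect) \<Rightarrow> bool" where
  "orthonormal N n e \<longleftrightarrow>
     (\<forall>i<n. e i \<in> topspace (Euclidean_space N)) \<and>
     (\<forall>i<n. \<forall>j<n. ip N (e i) (e j) = (if i = j then 1 else 0))"

definition ip_matrix :: "nat \<Rightarrow> nat \<Rightarrow> (nat \<Rightarrow> vect) \<Rightarrow> (nat \<Rightarrow> vect) \<Rightarrow> real mat" where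
  "ip_matrix N n e f = mat n n (\<lambda>(i, j). ip N (e i) (f j))"


subsection \<open>The Grassmann manifold of oriented subspaces\<close>

text \<open>
  An oriented n-dimensional subspace is encoded as the set of all its positively oriented
  orthonormal bases. For an ordered basis b, \<open>oriented_span N n b\<close> is its span, oriented by b:
  an orthonormal basis e of the span satisfies \<open>b j = (\<Sum>i<n. ip N (e i) (b j) * e i)\<close>, so the
  determinant below is that of the change of basis.
\<close>

definition oriented_span :: "nat \<Rightarrow> nat \<Rightarrow> (nat \<Rightarrow> vect) \<Rightarrow> (nat \<Rightarrow> vect) set" where
  "oriented_span N n b =
     {e. orthonormal N n e \<and> (\<forall>i<n. \<exists>c. e i = lincomb n c b) \<and> det (ip_matrix N n e b) > 0}"

definition grassmannian :: "nat \<Rightarrow> nat \<Rightarrow> (nat \<Rightarrow> vect) set set" where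
  "grassmannian n m =
     {oriented_span (n + m) n b | b.
        (\<forall>i<n. b i \<in> topspace (Euclidean_space (n + m))) \<and> lin_indep n b}"

definition w :: "nat \<Rightarrow> nat \<Rightarrow> (nat \<Rightarrow> vect) set \<Rightarrow> (nat \<Rightarrow> vect) set \<Rightarrow> real" where
  "w n m P Q = det (ip_matrix (n + m) n (SOME e. e \<in> P) (SOME f. f \<in> Q))"

text \<open>The value of \<open>v\<close> is meaningful only where \<open>w n m P Q > 0\<close>, which is an open condition.\<close>

definition v :: "nat \<Rightarrow> nat \<Rightarrow> (nat \<Rightarrow> vect) set \<Rightarrow> (nat \<Rightarrow> vect) set \<Rightarrow> real" where
  "v n m P Q = 1 / w n m P Q"


subsection \<open>Partial derivatives\<close>

definition pd :: "nat \<Rightarrow> (vect \<Rightarrow> real) \<Rightarrow> vect \<Rightarrow> real" where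
  "pd i f u = deriv (\<lambda>t. f (u(i := t))) (u i)"

definition pdv :: "nat \<Rightarrow> (vect \<Rightarrow> vect) \<Rightarrow> vect \<Rightarrow> vect" where
  "pdv i X u = (\<lambda>k. pd i (\<lambda>x. X x k) u)"

text \<open>Infinite differentiability: all iterated partial derivatives exist and are continuous.\<close>

definition C_infinity :: "nat \<Rightarrow> vect set \<Rightarrow> (vect \<Rightarrow> real) \<Rightarrow> bool" where
  "C_infinity n U f \<longleftrightarrow>
     (\<forall>js. set js \<subseteq> {..<n} \<longrightarrow>
        continuous_map (subtopology (Euclidean_space n) U) euclideanreal (foldr pd js f) \<and>
        (\<forall>u\<in>U. \<forall>i<n. (\<lambda>t. foldr pd js f (u(i := t))) differentiable (at (u i))))"


subsection \<open>Geometry of a parametrization\<close>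

text \<open>
  In this subsection X is an immersion of an open subset of n-dimensional space into
  N-dimensional space and u is a point of its domain.
\<close>

definition coord_frame :: "(vect \<Rightarrow> vect) \<Rightarrow> vect \<Rightarrow> nat \<Rightarrow> vect" where
  "coord_frame X u = (\<lambda>i. pdv i X u)"

definition metric :: "nat \<Rightarrow> nat \<Rightarrow> (vect \<Rightarrow> vect) \<Rightarrow> vect \<Rightarrow> real mat" where
  "metric N n X u = ip_matrix N n (coord_frame X u) (coord_frame X u)"

text \<open>The entries of the inverse matrix of the metric, by Cramer's rule.\<close>

definition metric_inv :: "nat \<Rightarrow> nat \<Rightarrow> (vect \<Rightarrow> vect) \<Rightarrow> vect \<Rightarrow> nat \<Rightarrow> nat \<Rightarrow> real" where
  "metric_inv N n X u i j = adj_mat (metric N n X u) $$ (i, j) / det (metric N n X u)"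

text \<open>The coordinates, in the coordinate frame, of the tangential part of a vector.\<close>

definition tangent_coord :: "nat \<Rightarrow> nat \<Rightarrow> (vect \<Rightarrow> vect) \<Rightarrow> vect \<Rightarrow> vect \<Rightarrow> nat \<Rightarrow> real" where
  "tangent_coord N n X u x i = (\<Sum>j<n. metric_inv N n X u i j * ip N x (coord_frame X u j))"

definition normal_part :: "nat \<Rightarrow> nat \<Rightarrow> (vect \<Rightarrow> vect) \<Rightarrow> vect \<Rightarrow> vect \<Rightarrow> vect" where
  "normal_part N n X u x =
     (\<lambda>k. x k - lincomb n (tangent_coord N n X u x) (coord_frame X u) k)"

definition sff_coord :: "nat \<Rightarrow> nat \<Rightarrow> (vect \<Rightarrow> vect) \<Rightarrow> vect \<Rightarrow> nat \<Rightarrow> nat \<Rightarrow> vect" where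
  "sff_coord N n X u i j = normal_part N n X u (pdv i (pdv j X) u)"

definition sff :: "nat \<Rightarrow> nat \<Rightarrow> (vect \<Rightarrow> vect) \<Rightarrow> vect \<Rightarrow> vect \<Rightarrow> vect \<Rightarrow> vect" where
  "sff N n X u x y =
     (\<lambda>k. \<Sum>i<n. \<Sum>j<n. tangent_coord N n X u x i * tangent_coord N n X u y j
                          * sff_coord N n X u i j k)"

definition tangent_frame :: "nat \<Rightarrow> nat \<Rightarrow> (vect \<Rightarrow> vect) \<Rightarrow> vect \<Rightarrow> (nat \<Rightarrow> vect) \<Rightarrow> bool" where
  "tangent_frame N n X u e \<longleftrightarrow>
     orthonormal N n e \<and> (\<forall>i<n. \<exists>c. e i = lincomb n c (coord_frame X u))"

definition normal_frame :: "nat \<Rightarrow> nat \<Rightarrow> (vect \<Rightarrow> vect) \<Rightarrow> vect \<Rightarrow> (nat \<Rightarrow> vect) \<Rightarrow> bool" where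
  "normal_frame N n X u \<nu> \<longleftrightarrow>
     orthonormal N (N - n) \<nu> \<and> (\<forall>\<alpha><N - n. \<forall>i<n. ip N (\<nu> \<alpha>) (coord_frame X u i) = 0)"

text \<open>The squared norm does not depend on the orthonormal frames that are chosen.\<close>

definition sff_norm_sq :: "nat \<Rightarrow> nat \<Rightarrow> (vect \<Rightarrow> vect) \<Rightarrow> vect \<Rightarrow> real" where
  "sff_norm_sq N n X u =
     (let e = (SOME e. tangent_frame N n X u e); \<nu> = (SOME \<nu>. normal_frame N n X u \<nu>)
      in \<Sum>\<alpha><N - n. \<Sum>i<n. \<Sum>j<n. (ip N (sff N n X u (e i) (e j)) (\<nu> \<alpha>))\<^sup>2)"

definition mean_curvature :: "nat \<Rightarrow> nat \<Rightarrow> (vect \<Rightarrow> vect) \<Rightarrow> vect \<Rightarrow> vect" where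
  "mean_curvature N n X u =
     (\<lambda>k. (\<Sum>i<n. \<Sum>j<n. metric_inv N n X u i j * sff_coord N n X u i j k) / real n)"

text \<open>
  The covariant derivative of the mean curvature vector in the normal bundle, in the direction
  of the i-th coordinate vector.
\<close>

definition normal_deriv_H :: "nat \<Rightarrow> nat \<Rightarrow> (vect \<Rightarrow> vect) \<Rightarrow> vect \<Rightarrow> nat \<Rightarrow> vect" where
  "normal_deriv_H N n X u i = normal_part N n X u (pdv i (mean_curvature N n X) u)"

definition laplacian_coord :: "nat \<Rightarrow> nat \<Rightarrow> (vect \<Rightarrow> vect) \<Rightarrow> (vect \<Rightarrow> real) \<Rightarrow> vect \<Rightarrow> real" where
  "laplacian_coord N n X f u =
     (\<Sum>i<n. pd i (\<lambda>x. sqrt (det (metric N n X x)) *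
                         (\<Sum>j<n. metric_inv N n X x i j * pd j f x)) u)
     / sqrt (det (metric N n X u))"


subsection \<open>Oriented submanifolds\<close>

text \<open>
  A submanifold is a topological space M whose points form a subset of Euclidean space and whose
  smooth structure makes the inclusion an immersion. Its topology may be finer than the subspace
  topology, so that injectively immersed submanifolds are included; for an embedded submanifold S
  take M to be \<open>subtopology (Euclidean_space (n + m)) S\<close>.

  The smooth structure and the orientation are given by an atlas A of local parametrizations
  (U, X), where U is the coordinate domain; X followed by the inclusion of M is X itself.
  Parametrizations of this kind are automatically smoothly compatible.
\<close>

type_synonym chart = "vect set \<times> (vect \<Rightarrow> vect)"

definition local_param :: "nat \<Rightarrow> nat \<Rightarrow> vect topology \<Rightarrow> chart \<Rightarrow> bool" where
  "local_param n m M = (\<lambda>(U, X).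
     openin (Euclidean_space n) U \<and>
     embedding_map (subtopology (Euclidean_space n) U) M X \<and> openin M (X ` U) \<and>
     (\<forall>k<n + m. C_infinity n U (\<lambda>u. X u k)) \<and>
     (\<forall>u\<in>U. lin_indep n (coord_frame X u)))"

definition oriented_submanifold :: "nat \<Rightarrow> nat \<Rightarrow> vect topology \<Rightarrow> chart set \<Rightarrow> bool" where
  "oriented_submanifold n m M A \<longleftrightarrow>
     topspace M \<subseteq> topspace (Euclidean_space (n + m)) \<and> second_countable M \<and>
     (\<forall>c\<in>A. local_param n m M c) \<and>
     (\<Union>(U, X)\<in>A. X ` U) = topspace M \<and>
     (\<forall>(U, X)\<in>A. \<forall>(V, Y)\<in>A. \<forall>u\<in>U. \<forall>u'\<in>V. X u = Y u' \<longrightarrow>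
        oriented_span (n + m) n (coord_frame X u) = oriented_span (n + m) n (coord_frame Y u'))"

text \<open>
  Geometric quantities at a point p of M are computed in some parametrization of the atlas around
  p; none of those below depends on which one is taken.
\<close>

definition in_chart :: "chart set \<Rightarrow> vect \<Rightarrow> ((vect \<Rightarrow> vect) \<Rightarrow> vect \<Rightarrow> 'b) \<Rightarrow> 'b" where
  "in_chart A p F = (case (SOME c. c \<in> A \<and> p \<in> snd c ` fst c) of (U, X) \<Rightarrow> F X (inv_into U X p))"

definition gauss_map :: "nat \<Rightarrow> nat \<Rightarrow> chart set \<Rightarrow> vect \<Rightarrow> (nat \<Rightarrow> vect) set" where
  "gauss_map n m A p = in_chart A p (\<lambda>X u. oriented_span (n + m) n (coord_frame X u))"

definition laplace_beltrami :: "nat \<Rightarrow> nat \<Rightarrow> chart set \<Rightarrow> (vect \<Rightarrow> real) \<Rightarrow> vect \<Rightarrow> real" where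
  "laplace_beltrami n m A f p = in_chart A p (\<lambda>X u. laplacian_coord (n + m) n X (f \<circ> X) u)"

definition B_norm_sq :: "nat \<Rightarrow> nat \<Rightarrow> chart set \<Rightarrow> vect \<Rightarrow> real" where
  "B_norm_sq n m A p = in_chart A p (sff_norm_sq (n + m) n)"

definition parallel_mean_curvature :: "nat \<Rightarrow> nat \<Rightarrow> chart set \<Rightarrow> bool" where
  "parallel_mean_curvature n m A \<longleftrightarrow>
     (\<forall>(U, X)\<in>A. \<forall>u\<in>U. \<forall>i<n. \<forall>k<n + m. normal_deriv_H (n + m) n X u i k = 0)"

end

theory Submission
  imports Defs
begin

text \<open>
  In a chart X let f be an orthonormal basis of the fixed subspace. Then \<open>v \<circ> \<gamma>\<close> is the quotient of
  \<open>sqrt (det \<langle>\<partial>\<^sub>i X, \<partial>\<^sub>j X\<rangle>)\<close> by \<open>det \<langle>\<partial>\<^sub>i X, f\<^sub>j\<rangle>\<close>. By Jacobi's formula its logarithmic derivative is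
  \<open>\<Sum>a. \<langle>\<partial>\<^sub>i \<partial>\<^sub>a X, \<xi>\<^sub>a\<rangle>\<close>, where \<open>\<xi>\<^sub>a\<close> is the difference of the bases dual to \<open>\<partial>\<^sub>a X\<close> inside the tangent space
  and inside the fixed subspace; it is normal to X. In the Laplacian the third derivatives of X are
  then eliminated with the parallel mean curvature, and the Christoffel symbols cancel. In orthonormal
  frames that diagonalise \<open>\<xi>\<close>, with diagonal entries \<open>\<theta>\<^sub>a\<close> (the tangents of the Jordan angles, up to
  sign), what remains is v times a quadratic form in the second fundamental form, and
  \<open>v\<^sup>2 = \<Prod>a. 1 + \<theta>\<^sub>a\<^sup>2\<close>.

  The form is nonnegative if \<open>v \<le> 3\<close>. Since it equals \<open>|B|\<^sup>2\<close> plus a term homogeneous of degree two in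
  \<open>\<theta>\<close>, replacing \<open>\<theta>\<close> by a larger multiple of it yields the strict bound if \<open>v \<le> \<beta>0 < 3\<close>.
\<close>

subsection \<open>The quadratic form\<close>

text \<open>All differentiation takes place in the coordinate frame and its dual bases. Orthonormal
  frames enter only afterwards and at a single point, as pure linear algebra, so the frames that
  diagonalise \<open>xi\<close> never have to be chosen smoothly. The number 3 is the threshold of
  the algebra: two angles with \<theta> squared equal to 2 and all others zero give v = 3, and the
  form in three distinct indices then degenerates. The obstacle is the terms with a repeated index,
  where a pair of large tangents can turn a diagonal coefficient negative. The trace term, the
  square of a sum that mixes all angles, has to pay for it, and this is what the numerical estimates
  are about. The constant \<open>K0\<close> has to be uniform in n and m. By Bernoulli's inequality,
  scaling \<theta> by the square root of s is controlled by v to the power s, which leaves the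
  explicit factor 1 - 1/s with s = ln 3 / ln \<beta>.\<close>

lemma mult_le_four_of_one_plus_mult_le_nine:
  fixes p q :: real
  assumes "0 \<le> p" "0 \<le> q" "(1 + p) * (1 + q) \<le> 9"
  shows "p * q \<le> 4"
proof (rule ccontr)
  assume "\<not> p * q \<le> 4"
  then have pq: "4 < p * q" by simp
  \<comment> \<open>AM-GM: \<open>p * q > 4\<close> forces p + q to be at least 4, and then the
    product exceeds 1 + 4 + 4. Equality holds at p = q = 2.\<close>
  have "4 * (p * q) \<le> (p + q)\<^sup>2"
    using zero_le_power2[of "p - q"] by (simp add: power2_eq_square algebra_simps)
  then have "4\<^sup>2 \<le> (p + q)\<^sup>2" using pq by simp
  then have "4 \<le> p + q" by (rule power2_le_imp_le) (simp add: assms)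
  then show False using pq assms(3) by (simp add: algebra_simps)
qed

text \<open>With p, q, r the squared tangents this says that the matrix of the form in
  \<open>ternary_form_nonneg\<close> has nonnegative determinant. If one number a is at least 1,
  then \<open>b * c \<le> a * b * c\<close>, and \<open>a * (b + c) \<le> 4\<close> is the
  two-variable bound for a and b + c; otherwise every product is at most 1.\<close>

lemma elementary_symmetric_two_le:
  fixes p q r :: real
  assumes nonneg: "0 \<le> p" "0 \<le> q" "0 \<le> r" and le: "(1 + p) * (1 + q) * (1 + r) \<le> 9"
  shows "p * q + q * r + r * p \<le> 4 + p * q * r"
proof -
  have large: "a * b + b * c + c * a \<le> 4 + a * b * c"
    if "0 \<le> b" "0 \<le> c" "1 \<le> a" "(1 + a) * (1 + b) * (1 + c) \<le> 9" for a b c :: real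
  proof -
    have bc: "0 \<le> b * c" using that by simp
    have "(1 + a) * (1 + (b + c)) \<le> (1 + a) * (1 + (b + c + b * c))"
      using that bc by (intro mult_left_mono) auto
    also have "\<dots> = (1 + a) * (1 + b) * (1 + c)" by (simp add: algebra_simps)
    finally have "(1 + a) * (1 + (b + c)) \<le> 9" using that(4) by (rule order_trans)
    then have "a * (b + c) \<le> 4"
      using that by (intro mult_le_four_of_one_plus_mult_le_nine) auto
    moreover have "b * c \<le> a * (b * c)" using mult_right_mono[OF that(3) bc] by simp
    ultimately show ?thesis by (simp add: algebra_simps)
  qed
  consider "1 \<le> p" | "1 \<le> q" | "1 \<le> r" | "p \<le> 1" "q \<le> 1" "r \<le> 1" by linarith
  then show ?thesis
  proof cases
    case 1 then show ?thesis using large[of q r p] nonneg le by simp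
  next
    case 2 then show ?thesis using large[of r p q] nonneg le by (simp add: ac_simps)
  next
    case 3 then show ?thesis using large[of p q r] nonneg le by (simp add: ac_simps)
  next
    case 4
    have "p * q \<le> 1" "q * r \<le> 1" "r * p \<le> 1" using 4 nonneg by (simp_all add: mult_le_one)
    moreover have "0 \<le> p * q * r" using nonneg by simp
    ultimately show ?thesis by linarith
  qed
qed

lemma binary_form_nonneg:
  fixes a b c y z :: real
  assumes "0 \<le> a" "0 \<le> b" "c\<^sup>2 \<le> 4 * a * b"
  shows "0 \<le> a * y\<^sup>2 + c * y * z + b * z\<^sup>2"
proof (cases "a = 0")
  case True
  then have "c = 0" using assms(3) by simp
  then show ?thesis using True assms(2) by simp
next
  case False
  have "4 * a * (a * y\<^sup>2 + c * y * z + b * z\<^sup>2) = (2 * a * y + c * z)\<^sup>2 + (4 * a * b - c\<^sup>2) * z\<^sup>2"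
    by (simp add: power2_eq_square algebra_simps)
  also have "\<dots> \<ge> 0" using assms(3) by simp
  finally show ?thesis using False assms(1) by (simp add: zero_le_mult_iff)
qed

lemma ternary_form_nonneg:
  fixes p q r x y z :: real
  assumes le: "(1 + p\<^sup>2) * (1 + q\<^sup>2) * (1 + r\<^sup>2) \<le> 9"
  shows "0 \<le> x\<^sup>2 + y\<^sup>2 + z\<^sup>2 + q * r * (y * z) + p * r * (x * z) + p * q * (x * y)"
proof -
  \<comment> \<open>Coefficients of the binary form in y and z that remains when four times the
    ternary form is completed to a square in x. Its discriminant condition is
    \<open>elementary_symmetric_two_le\<close>.\<close>
  define a where "a = 4 - p\<^sup>2 * q\<^sup>2"
  define b where "b = 4 - p\<^sup>2 * r\<^sup>2"
  define c where "c = 2 * q * r * (2 - p\<^sup>2)"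
  have "(1 + p\<^sup>2) * (1 + q\<^sup>2) * 1 \<le> (1 + p\<^sup>2) * (1 + q\<^sup>2) * (1 + r\<^sup>2)"
    by (intro mult_left_mono) auto
  then have "p\<^sup>2 * q\<^sup>2 \<le> 4"
    using le by (intro mult_le_four_of_one_plus_mult_le_nine) auto
  moreover have "(1 + p\<^sup>2) * 1 * (1 + r\<^sup>2) \<le> (1 + p\<^sup>2) * (1 + q\<^sup>2) * (1 + r\<^sup>2)"
    by (intro mult_left_mono mult_right_mono) auto
  then have "p\<^sup>2 * r\<^sup>2 \<le> 4"
    using le by (intro mult_le_four_of_one_plus_mult_le_nine) auto
  moreover have "p\<^sup>2 * q\<^sup>2 + q\<^sup>2 * r\<^sup>2 + r\<^sup>2 * p\<^sup>2 \<le> 4 + p\<^sup>2 * q\<^sup>2 * r\<^sup>2"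
    using le by (intro elementary_symmetric_two_le) auto
  then have "4 * a * b - c\<^sup>2 \<ge> 0"
  proof -
    have "4 * a * b - c\<^sup>2 = 16 * (4 + p\<^sup>2 * q\<^sup>2 * r\<^sup>2 - (p\<^sup>2 * q\<^sup>2 + q\<^sup>2 * r\<^sup>2 + r\<^sup>2 * p\<^sup>2))"
      unfolding a_def b_def c_def by (simp add: power2_eq_square algebra_simps)
    then show ?thesis using \<open>_ \<le> 4 + p\<^sup>2 * q\<^sup>2 * r\<^sup>2\<close> by simp
  qed
  then have "c\<^sup>2 \<le> 4 * a * b" by simp
  ultimately have "0 \<le> a * y\<^sup>2 + c * y * z + b * z\<^sup>2"
    by (intro binary_form_nonneg) (auto simp: a_def b_def)
  moreover have "4 * (x\<^sup>2 + y\<^sup>2 + z\<^sup>2 + q * r * (y * z) + p * r * (x * z) + p * q * (x * y))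
      = (2 * x + (p * r * z + p * q * y))\<^sup>2 + (a * y\<^sup>2 + c * y * z + b * z\<^sup>2)"
    unfolding a_def b_def c_def by (simp add: power2_eq_square algebra_simps)
  ultimately have "0 \<le> 4 * (x\<^sup>2 + y\<^sup>2 + z\<^sup>2 + q * r * (y * z) + p * r * (x * z) + p * q * (x * y))"
    by simp
  then show ?thesis by (simp only: zero_le_mult_iff) simp
qed

lemma sum_le_prod_one_plus:
  fixes a :: "'i \<Rightarrow> real"
  assumes "finite I" "\<And>i. i \<in> I \<Longrightarrow> 0 \<le> a i"
  shows "1 + sum a I \<le> (\<Prod>i\<in>I. 1 + a i)"
  using assms
proof (induction I rule: finite_induct)
  case (insert j I)
  have "0 \<le> a j * sum a I" using insert by (simp add: sum_nonneg)
  then have "1 + sum a (insert j I) \<le> (1 + a j) * (1 + sum a I)"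
    using insert by (simp add: algebra_simps)
  also have "\<dots> \<le> (1 + a j) * (\<Prod>i\<in>I. 1 + a i)"
    using insert by (intro mult_left_mono) auto
  finally show ?case using insert by simp
qed simp

text \<open>
  The worst case is the largest value of \<open>a\<close> that the hypothesis allows, \<open>(8 - b) / (1 + b)\<close>; it
  leads to a cubic in \<open>b\<close> that is positive with little room to spare.
\<close>

lemma exceptional_angle_bound:
  fixes a b :: real
  assumes a: "0 \<le> a" and b: "1 < b" and le: "(1 + b) * (1 + a) \<le> 9"
  shows "21 * (1 + 2 * b) * ((b - 1) * a - 2) \<le> 20 * (1 + b) * a"
proof -
  have cubic: "0 < 42 * b ^ 3 - 293 * b\<^sup>2 + 413 * b + 370"
  proof -
    \<comment> \<open>The number 379/100 is close to the local minimum of the cubic. The linear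
      remainder is the tangent at that point; its slope and its constant term are both
      positive.\<close>
    have "42 * b ^ 3 - 293 * b\<^sup>2 + 413 * b + 370
        = (b - 379 / 100)\<^sup>2 * (42 * b + 2536 / 100) + ((413 - 42 * (379 / 100)\<^sup>2 + 2 * 379 / 100 * (2536 / 100)) * b + (370 - (379 / 100)\<^sup>2 * (2536/100)))"
      by (simp add: power2_eq_square power3_eq_cube field_simps)
    moreover have "0 \<le> (b - 379 / 100)\<^sup>2 * (42 * b + 2536 / 100)" using b by simp
    moreover have "0 \<le> (1 + b) * a" using a b by simp
    then have "b \<le> 8" using le by (simp add: algebra_simps)
    then have "0 < (413 - 42 * (379 / 100)\<^sup>2 + 2 * 379 / 100 * (2536 / 100)) * b + (370 - (379 / 100)\<^sup>2 * (2536/100))"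
      using b by (simp add: power2_eq_square)
    ultimately show ?thesis by linarith
  qed
  \<comment> \<open>The claim, with the terms in a collected, reads
    \<open>a * k \<le> 42 * (1 + 2 * b)\<close>.\<close>
  define k where "k = 21 * (1 + 2 * b) * (b - 1) - 20 * (1 + b)"
  have "a * k \<le> 42 * (1 + 2 * b)"
  proof (cases "0 \<le> k")
    case False
    then have "a * k \<le> 0" using a by (simp add: mult_nonneg_nonpos)
    then show ?thesis using b by (simp add: order_trans[of _ 0])
  next
    case True
    have "a * (1 + b) \<le> 8 - b" using le by (simp add: algebra_simps)
    then have "a * (1 + b) * k \<le> (8 - b) * k" using True by (rule mult_right_mono)
    also have "\<dots> \<le> 42 * (1 + 2 * b) * (1 + b)"
      using cubic unfolding k_def by (simp add: power2_eq_square power3_eq_cube algebra_simps)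
    finally have "(a * k) * (1 + b) \<le> (42 * (1 + 2 * b)) * (1 + b)" by (simp add: ac_simps)
    then show ?thesis using b by (simp add: mult_le_cancel_right)
  qed
  then show ?thesis unfolding k_def by (simp add: algebra_simps)
qed

text \<open>
  At most one coefficient \<open>2 + (\<theta> i)\<^sup>2 * (1 - b)\<close> is negative; the product bound makes the others
  so large that the square of the sum compensates for it.
\<close>

lemma rank_one_perturbation_nonneg:
  fixes \<theta> y :: "'i \<Rightarrow> real" and b :: real
  assumes fin: "finite I" and b: "0 \<le> b" and le: "(1 + b) * (\<Prod>i\<in>I. 1 + (\<theta> i)\<^sup>2) \<le> 9"
  shows "0 \<le> (1 + b) / (1 + 2 * b) * (\<Sum>i\<in>I. \<theta> i * y i)\<^sup>2
              + (\<Sum>i\<in>I. (2 + (\<theta> i)\<^sup>2 - (\<theta> i)\<^sup>2 * b) * (y i)\<^sup>2)"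
proof (cases "\<forall>i\<in>I. 0 \<le> 2 + (\<theta> i)\<^sup>2 - (\<theta> i)\<^sup>2 * b")
  case True
  then show ?thesis using b by (intro add_nonneg_nonneg sum_nonneg mult_nonneg_nonneg) auto
next
  case False
  then obtain j where j: "j \<in> I" and neg: "2 + (\<theta> j)\<^sup>2 - (\<theta> j)\<^sup>2 * b < 0" by force
  define J where "J = I - {j}"
  have I: "I = insert j J" "j \<notin> J" and finJ: "finite J" using j fin by (auto simp: J_def)
  define a where "a = (\<theta> j)\<^sup>2"
  define \<rho> where "\<rho> = (\<Sum>i\<in>J. (\<theta> i)\<^sup>2)"
  define c where "c = (1 + b) / (1 + 2 * b)"
  define T where "T = (\<Sum>i\<in>J. \<theta> i * y i)"
  define s where "s = \<theta> j * y j"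
  have a: "0 \<le> a" and \<rho>: "0 \<le> \<rho>" by (auto simp: a_def \<rho>_def sum_nonneg)
  have neg': "2 < a * (b - 1)" using neg by (simp add: a_def algebra_simps)
  then have b1: "1 < b" using a zero_less_mult_pos[of a "b - 1"] by (cases "a = 0") auto
  have prod: "(1 + b) * (1 + a) * (1 + \<rho>) \<le> 9"
  proof -
    have "(1 + b) * (1 + a) * (1 + \<rho>) \<le> (1 + b) * (1 + a) * (\<Prod>i\<in>J. 1 + (\<theta> i)\<^sup>2)"
      unfolding \<rho>_def using finJ a b by (intro mult_left_mono sum_le_prod_one_plus) auto
    then show ?thesis using le I finJ by (simp add: a_def ac_simps)
  qed
  have "(1 + b) * (1 + a) * 1 \<le> (1 + b) * (1 + a) * (1 + \<rho>)"
    using a b \<rho> by (intro mult_left_mono) auto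
  then have ba: "(1 + b) * (1 + a) \<le> 9" using prod by simp
  \<comment> \<open>Combining \<open>a * (b - 1) > 2\<close> with
    \<open>(1 + b) * (1 + a) \<le> 9\<close> eliminates a and leaves a quadratic inequality in b
    with roots 2 and 5.\<close>
  have b2: "2 < b" and b5: "b < 5"
  proof -
    have "(1 + b) * (b + 1) < (1 + b) * ((1 + a) * (b - 1))"
      using neg' b1 by (intro mult_strict_left_mono) (auto simp: algebra_simps)
    also have "\<dots> \<le> 9 * (b - 1)" using mult_right_mono[OF ba, of "b - 1"] b1 by (simp add: ac_simps)
    finally have "(b - 2) * (b - 5) < 0" by (simp add: algebra_simps)
    then show "2 < b" "b < 5" by (auto simp: mult_less_0_iff)
  qed
  \<comment> \<open>The same elimination with the factor \<open>1 + \<rho>\<close> kept. The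
    quotient of \<open>9 * (b - 1)\<close> by the square of \<open>1 + b\<close> is largest at b =
    3, where it equals 9/8.\<close>
  have \<rho>8: "\<rho> \<le> 1 / 8"
  proof -
    have "(1 + b)\<^sup>2 * (1 + \<rho>) \<le> (1 + b) * ((1 + a) * (b - 1)) * (1 + \<rho>)"
      using neg' b1 \<rho> unfolding power2_eq_square
      by (intro mult_right_mono mult_left_mono) (auto simp: algebra_simps)
    also have "\<dots> \<le> 9 * (b - 1)" using mult_right_mono[OF prod, of "b - 1"] b1 by (simp add: ac_simps)
    also have "\<dots> \<le> 9 / 8 * (1 + b)\<^sup>2"
      using zero_le_power2[of "b - 3"] by (simp add: power2_eq_square algebra_simps)
    finally have "(1 + b)\<^sup>2 * (1 + \<rho>) \<le> (1 + b)\<^sup>2 * (9 / 8)" by (simp add: ac_simps)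
    then show ?thesis using b by (simp add: mult_le_cancel_left)
  qed
  \<comment> \<open>Here \<open>\<rho> * (b - 1) + 12 * \<rho> = \<rho> * (11 + b)\<close> is at
    most 16/8 = 2, because b < 5.\<close>
  have d: "12 * \<rho> \<le> 2 + (\<theta> i)\<^sup>2 - (\<theta> i)\<^sup>2 * b" if "i \<in> J" for i
  proof -
    have "(\<theta> i)\<^sup>2 \<le> \<rho>" unfolding \<rho>_def using that finJ by (intro member_le_sum) auto
    then have "(\<theta> i)\<^sup>2 * (b - 1) \<le> \<rho> * (b - 1)" using b1 by (intro mult_right_mono) auto
    moreover have "\<rho> * (11 + b) \<le> 1 / 8 * 16" using \<rho>8 \<rho> b b5 by (intro mult_mono) auto
    ultimately show ?thesis by (simp add: algebra_simps)
  qed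
  have "T\<^sup>2 \<le> \<rho> * (\<Sum>i\<in>J. (y i)\<^sup>2)"
    unfolding T_def \<rho>_def by (rule Cauchy_Schwarz_ineq_sum)
  then have "12 * T\<^sup>2 \<le> (\<Sum>i\<in>J. 12 * \<rho> * (y i)\<^sup>2)" by (simp add: sum_distrib_left[symmetric] ac_simps)
  also have "\<dots> \<le> (\<Sum>i\<in>J. (2 + (\<theta> i)\<^sup>2 - (\<theta> i)\<^sup>2 * b) * (y i)\<^sup>2)"
    using d by (intro sum_mono mult_right_mono) auto
  finally have rest: "12 * T\<^sup>2 \<le> (\<Sum>i\<in>J. (2 + (\<theta> i)\<^sup>2 - (\<theta> i)\<^sup>2 * b) * (y i)\<^sup>2)" .
  have c: "0 \<le> c" "c \<le> 3 / 5" using b2 by (auto simp: c_def field_simps)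
  \<comment> \<open>Giving up 1/21 of the square of s leaves \<open>20 * c * T\<^sup>2\<close> to be
    covered, and 12 = 20 * 3/5 is just enough for c at most 3/5. The same fraction 20/21 is built
    into \<open>exceptional_angle_bound\<close>.\<close>
  have "20 / 21 * c * s\<^sup>2 \<le> c * (s + T)\<^sup>2 + 12 * T\<^sup>2"
  proof -
    have "c * (s + T)\<^sup>2 + 12 * T\<^sup>2 - 20 / 21 * c * s\<^sup>2 = c / 21 * (s + 21 * T)\<^sup>2 + (12 - 20 * c) * T\<^sup>2"
      by (simp add: power2_eq_square field_simps)
    moreover have "\<dots> \<ge> 0" using c by (intro add_nonneg_nonneg mult_nonneg_nonneg) auto
    ultimately show ?thesis by linarith
  qed
  moreover have "((b - 1) * a - 2) * (y j)\<^sup>2 \<le> 20 / 21 * c * s\<^sup>2"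
  proof -
    have "(b - 1) * a - 2 \<le> 20 / 21 * c * a"
      using exceptional_angle_bound[OF a b1 ba] b by (simp add: c_def field_simps)
    then have "((b - 1) * a - 2) * (y j)\<^sup>2 \<le> 20 / 21 * c * a * (y j)\<^sup>2"
      by (rule mult_right_mono) simp
    then show ?thesis by (simp add: s_def a_def power_mult_distrib ac_simps)
  qed
  moreover have "(2 + (\<theta> j)\<^sup>2 - (\<theta> j)\<^sup>2 * b) * (y j)\<^sup>2 = - (((b - 1) * a - 2) * (y j)\<^sup>2)"
    by (simp add: a_def algebra_simps)
  moreover have "(\<Sum>i\<in>I. \<theta> i * y i) = s + T" using I finJ by (simp add: s_def T_def)
  ultimately show ?thesis using rest I finJ by (simp add: c_def)
qed

text \<open>Eliminates z and x. The minimum over z of the first two terms is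
  \<open>(1 + l\<^sup>2) / (1 + 2 * l\<^sup>2)\<close> times the square of the remaining sum, and
  completing the square in \<open>x i\<close> costs
  \<open>(\<theta> i)\<^sup>2 * l\<^sup>2 * (y i)\<^sup>2\<close>. What is left is
  \<open>rank_one_perturbation_nonneg\<close> with b the square of l.\<close>

lemma angle_group_nonneg:
  fixes \<theta> x y :: "'i \<Rightarrow> real" and l z :: real
  assumes fin: "finite I" and le: "(1 + l\<^sup>2) * (\<Prod>i\<in>I. 1 + (\<theta> i)\<^sup>2) \<le> 9"
  shows "0 \<le> (1 + l\<^sup>2) * z\<^sup>2 + (l * z + (\<Sum>i\<in>I. \<theta> i * y i))\<^sup>2
     + (\<Sum>i\<in>I. (x i)\<^sup>2 + 2 * \<theta> i * l * x i * y i + (2 + (\<theta> i)\<^sup>2) * (y i)\<^sup>2)"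
proof -
  define S where "S = (\<Sum>i\<in>I. \<theta> i * y i)"
  have "(1 + l\<^sup>2) / (1 + 2 * l\<^sup>2) * S\<^sup>2 \<le> (1 + l\<^sup>2) * z\<^sup>2 + (l * z + S)\<^sup>2"
  proof -
    have pos: "0 < 1 + 2 * l\<^sup>2" by (simp add: add_pos_nonneg)
    have "(1 + 2 * l\<^sup>2) * ((1 + l\<^sup>2) * z\<^sup>2 + (l * z + S)\<^sup>2)
        = (1 + l\<^sup>2) * S\<^sup>2 + ((1 + 2 * l\<^sup>2) * z + l * S)\<^sup>2"
      by (simp add: power2_eq_square algebra_simps)
    then have "(1 + l\<^sup>2) * S\<^sup>2 \<le> ((1 + l\<^sup>2) * z\<^sup>2 + (l * z + S)\<^sup>2) * (1 + 2 * l\<^sup>2)"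
      by (simp add: mult.commute)
    then show ?thesis using pos by (simp add: pos_divide_le_eq)
  qed
  moreover have "(\<Sum>i\<in>I. (2 + (\<theta> i)\<^sup>2 - (\<theta> i)\<^sup>2 * l\<^sup>2) * (y i)\<^sup>2)
      \<le> (\<Sum>i\<in>I. (x i)\<^sup>2 + 2 * \<theta> i * l * x i * y i + (2 + (\<theta> i)\<^sup>2) * (y i)\<^sup>2)"
  proof (rule sum_mono)
    fix i
    show "(2 + (\<theta> i)\<^sup>2 - (\<theta> i)\<^sup>2 * l\<^sup>2) * (y i)\<^sup>2
        \<le> (x i)\<^sup>2 + 2 * \<theta> i * l * x i * y i + (2 + (\<theta> i)\<^sup>2) * (y i)\<^sup>2"
      using zero_le_power2[of "x i + \<theta> i * l * y i"] by (simp add: power2_eq_square algebra_simps)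
  qed
  ultimately show ?thesis
    using rank_one_perturbation_nonneg[OF fin zero_le_power2 le, of y] unfolding S_def by linarith
qed

text \<open>The triples are sorted by coincidence pattern. In the second sum e is the index of odd
  multiplicity, three or one, and c the doubled index.\<close>

lemma sum_triple_split:
  fixes f :: "nat \<Rightarrow> nat \<Rightarrow> nat \<Rightarrow> real"
  shows "(\<Sum>c<n. \<Sum>d<n. \<Sum>e<n. f c d e)
    = (\<Sum>c<n. \<Sum>d<n. \<Sum>e<n. if c \<noteq> d \<and> d \<noteq> e \<and> c \<noteq> e then f c d e else 0)
      + (\<Sum>e<n. f e e e + (\<Sum>c\<in>{..<n} - {e}. f c c e + f c e c + f e c c))"
proof -
  have eq: "f c d e = (if c \<noteq> d \<and> d \<noteq> e \<and> c \<noteq> e then f c d e else 0)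
      + ((if c = d then if d = e then f c d e else 0 else 0)
        + (if c = d then if e \<noteq> d then f c d e else 0 else 0)
        + (if c = e then if d \<noteq> c then f c d e else 0 else 0)
        + (if d = e then if c \<noteq> e then f c d e else 0 else 0))" for c d e
    by auto
  have del: "(\<Sum>c\<in>{..<n} - {e}. g c) = (\<Sum>c<n. if c \<noteq> e then g c else 0)" for g :: "nat \<Rightarrow> real" and e
  proof -
    have "{..<n} - {e} = {c\<in>{..<n}. c \<noteq> e}" by auto
    then show ?thesis by (simp only: sum.inter_filter[OF finite_lessThan])
  qed
  have d1: "(\<Sum>c<n. \<Sum>d<n. \<Sum>e<n. if c = d then if d = e then f c d e else 0 else 0) = (\<Sum>e<n. f e e e)"
  proof -
    have "(\<Sum>d<n. \<Sum>e<n. if c = d then if d = e then f c d e else 0 else 0) = f c c c" if "c < n" for c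
    proof -
      have "(\<Sum>d<n. \<Sum>e<n. if c = d then if d = e then f c d e else 0 else 0)
        = (\<Sum>d<n. if c = d then f c d d else 0)"
        by (intro sum.cong) (auto simp: sum.delta)
      then show ?thesis using that by simp
    qed
    then show ?thesis by simp
  qed
  have d2: "(\<Sum>c<n. \<Sum>d<n. \<Sum>e<n. if c = d then if e \<noteq> d then f c d e else 0 else 0)
      = (\<Sum>e<n. \<Sum>c<n. if c \<noteq> e then f c c e else 0)"
  proof -
    have "(\<Sum>d<n. \<Sum>e<n. if c = d then if e \<noteq> d then f c d e else 0 else 0)
        = (\<Sum>e<n. if c \<noteq> e then f c c e else 0)" if "c < n" for c
      using that by (subst sum.swap) (auto intro!: sum.cong)
    then show ?thesis by (subst sum.swap) simp
  qed
  have d3: "(\<Sum>c<n. \<Sum>d<n. \<Sum>e<n. if c = e then if d \<noteq> c then f c d e else 0 else 0)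
      = (\<Sum>e<n. \<Sum>c<n. if c \<noteq> e then f c e c else 0)"
    by (subst sum.swap) (auto intro!: sum.cong)
  have d4: "(\<Sum>c<n. \<Sum>d<n. \<Sum>e<n. if d = e then if c \<noteq> e then f c d e else 0 else 0)
      = (\<Sum>e<n. \<Sum>c<n. if c \<noteq> e then f e c c else 0)"
    by (auto intro!: sum.cong)
  have add_if: "(if c \<noteq> e then (a::real) + b + d else 0)
      = (if c \<noteq> e then a else 0) + (if c \<noteq> e then b else 0) + (if c \<noteq> e then d else 0)" for c e :: nat and a b d
    by simp
  have "(\<Sum>c<n. \<Sum>d<n. \<Sum>e<n. f c d e)
    = (\<Sum>c<n. \<Sum>d<n. \<Sum>e<n. (if c \<noteq> d \<and> d \<noteq> e \<and> c \<noteq> e then f c d e else 0)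
      + ((if c = d then if d = e then f c d e else 0 else 0)
        + (if c = d then if e \<noteq> d then f c d e else 0 else 0)
        + (if c = e then if d \<noteq> c then f c d e else 0 else 0)
        + (if d = e then if c \<noteq> e then f c d e else 0 else 0)))"
    by (intro sum.cong refl eq)
  then show ?thesis
    by (simp only: sum.distrib d1 d2 d3 d4 del add_if add.assoc)
qed

text \<open>
  The sum over triples of distinct indices is nonnegative for each cyclic class of triples, and the
  remaining terms are grouped by the index that occurs an odd number of times.
\<close>

lemma curvature_form_nonneg:
  fixes \<theta> :: "nat \<Rightarrow> real" and k :: "nat \<Rightarrow> nat \<Rightarrow> nat \<Rightarrow> real"
  assumes sym: "\<And>i j l. i < n \<Longrightarrow> j < n \<Longrightarrow> l < n \<Longrightarrow> k i j l = k i l j"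
    and le: "(\<Prod>i<n. 1 + (\<theta> i)\<^sup>2) \<le> 9"
  shows "0 \<le> (\<Sum>c<n. \<Sum>d<n. \<Sum>e<n. (k c d e)\<^sup>2) + (\<Sum>c<n. (\<Sum>d<n. \<theta> d * k d c d)\<^sup>2)
            + (\<Sum>c<n. \<Sum>d<n. \<Sum>e<n. \<theta> e * \<theta> d * (k e c d * k d c e))"
proof -
  define f where "f c d e = (k c d e)\<^sup>2 + \<theta> e * \<theta> d * (k e c d * k d c e)" for c d e
  define g where "g c d e = (if c \<noteq> d \<and> d \<noteq> e \<and> c \<noteq> e then f c d e else 0)" for c d e
  have subprod: "(\<Prod>i\<in>J. 1 + (\<theta> i)\<^sup>2) \<le> 9" if "J \<subseteq> {..<n}" for J
  proof -
    have "(\<Prod>i\<in>J. 1 + (\<theta> i)\<^sup>2) \<le> (\<Prod>i<n. 1 + (\<theta> i)\<^sup>2)"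
      using that by (intro prod_mono2) (auto simp: add_nonneg_nonneg)
    then show ?thesis using le by simp
  qed
  have distinct: "0 \<le> (\<Sum>c<n. \<Sum>d<n. \<Sum>e<n. g c d e)"
  proof -
    have s1: "(\<Sum>c<n. \<Sum>d<n. \<Sum>e<n. g c d e) = (\<Sum>c<n. \<Sum>d<n. \<Sum>e<n. g e c d)"
      by (subst sum.swap, subst (2) sum.swap) simp
    have s2: "(\<Sum>c<n. \<Sum>d<n. \<Sum>e<n. g c d e) = (\<Sum>c<n. \<Sum>d<n. \<Sum>e<n. g d e c)"
      by (subst (2) sum.swap, subst sum.swap) simp
    have pos: "0 \<le> g c d e + g e c d + g d e c" if "c < n" "d < n" "e < n" for c d e
    proof (cases "c \<noteq> d \<and> d \<noteq> e \<and> c \<noteq> e")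
      case True
      have "(1 + (\<theta> c)\<^sup>2) * (1 + (\<theta> d)\<^sup>2) * (1 + (\<theta> e)\<^sup>2) \<le> 9"
        using subprod[of "{c, d, e}"] True that by (simp add: ac_simps)
      \<comment> \<open>By symmetry in the last two indices the mixed terms of the three rotations
        are products of these same three variables.\<close>
      from ternary_form_nonneg[OF this, of "k c d e" "k d e c" "k e c d"] show ?thesis
        using True that sym[of c e d] sym[of d c e] sym[of e d c]
        by (simp add: g_def f_def algebra_simps)
    next
      case False
      then show ?thesis by (auto simp: g_def)
    qed
    have "0 \<le> (\<Sum>c<n. \<Sum>d<n. \<Sum>e<n. g c d e + g e c d + g d e c)"
      using pos by (intro sum_nonneg) auto
    also have "\<dots> = 3 * (\<Sum>c<n. \<Sum>d<n. \<Sum>e<n. g c d e)"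
      using s1 s2 by (simp add: sum.distrib)
    finally show ?thesis by simp
  qed
  have group: "0 \<le> (\<Sum>d<n. \<theta> d * k d e d)\<^sup>2
      + (f e e e + (\<Sum>c\<in>{..<n} - {e}. f c c e + f c e c + f e c c))" if "e < n" for e
  proof -
    have "(1 + (\<theta> e)\<^sup>2) * (\<Prod>i\<in>{..<n} - {e}. 1 + (\<theta> i)\<^sup>2) \<le> 9"
      using le that by (simp add: prod.remove[of "{..<n}" e])
    \<comment> \<open>The variables are \<open>z = k e e e\<close>, \<open>y i = k i i e\<close> and
      \<open>x i = k e i i\<close>. Since \<open>k i e i = k i i e\<close>, the square of
      \<open>y i\<close> occurs twice, and a third time with factor
      \<open>(\<theta> i)\<^sup>2\<close>; this is the coefficient
      \<open>2 + (\<theta> i)\<^sup>2\<close>.\<close>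
    from angle_group_nonneg[OF _ this, of "k e e e" "\<lambda>i. k i i e" "\<lambda>i. k e i i"]
    have "0 \<le> (1 + (\<theta> e)\<^sup>2) * (k e e e)\<^sup>2 + (\<theta> e * k e e e + (\<Sum>i\<in>{..<n} - {e}. \<theta> i * k i i e))\<^sup>2
       + (\<Sum>i\<in>{..<n} - {e}. (k e i i)\<^sup>2 + 2 * \<theta> i * \<theta> e * k e i i * k i i e + (2 + (\<theta> i)\<^sup>2) * (k i i e)\<^sup>2)"
      by simp
    moreover have "(\<Sum>d<n. \<theta> d * k d e d) = \<theta> e * k e e e + (\<Sum>i\<in>{..<n} - {e}. \<theta> i * k i i e)"
    proof -
      have "(\<Sum>d<n. \<theta> d * k d e d) = (\<Sum>d<n. \<theta> d * k d d e)"
        using sym that by (intro sum.cong) auto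
      also have "\<dots> = \<theta> e * k e e e + (\<Sum>i\<in>{..<n} - {e}. \<theta> i * k i i e)"
        using that by (intro sum.remove) auto
      finally show ?thesis .
    qed
    moreover have "(\<Sum>c\<in>{..<n} - {e}. f c c e + f c e c + f e c c)
        = (\<Sum>i\<in>{..<n} - {e}. (k e i i)\<^sup>2 + 2 * \<theta> i * \<theta> e * k e i i * k i i e + (2 + (\<theta> i)\<^sup>2) * (k i i e)\<^sup>2)"
    proof (rule sum.cong[OF refl])
      fix i assume "i \<in> {..<n} - {e}"
      then have "k i e i = k i i e" using sym that by auto
      then show "f i i e + f i e i + f e i i
          = (k e i i)\<^sup>2 + 2 * \<theta> i * \<theta> e * k e i i * k i i e + (2 + (\<theta> i)\<^sup>2) * (k i i e)\<^sup>2"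
        by (simp add: f_def power2_eq_square algebra_simps)
    qed
    moreover have "f e e e = (1 + (\<theta> e)\<^sup>2) * (k e e e)\<^sup>2"
      by (simp add: f_def power2_eq_square algebra_simps)
    ultimately show ?thesis by simp
  qed
  have "(\<Sum>c<n. \<Sum>d<n. \<Sum>e<n. (k c d e)\<^sup>2) + (\<Sum>c<n. (\<Sum>d<n. \<theta> d * k d c d)\<^sup>2)
            + (\<Sum>c<n. \<Sum>d<n. \<Sum>e<n. \<theta> e * \<theta> d * (k e c d * k d c e))
      = (\<Sum>e<n. (\<Sum>d<n. \<theta> d * k d e d)\<^sup>2) + (\<Sum>c<n. \<Sum>d<n. \<Sum>e<n. f c d e)"
    by (simp add: f_def sum.distrib)
  also have "\<dots> = (\<Sum>c<n. \<Sum>d<n. \<Sum>e<n. g c d e) + (\<Sum>e<n. (\<Sum>d<n. \<theta> d * k d e d)\<^sup>2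
      + (f e e e + (\<Sum>c\<in>{..<n} - {e}. f c c e + f c e c + f e c c)))"
    unfolding sum_triple_split[where f = f and n = n] g_def[symmetric] by (simp add: sum.distrib)
  also have "\<dots> \<ge> 0"
    by (rule add_nonneg_nonneg[OF distinct sum_nonneg]) (use group in simp)
  finally show ?thesis .
qed

text \<open>Bernoulli's inequality for real exponents: weighted AM-GM for \<open>1 + s * x\<close>
  and 1 with weights 1/s and 1 - 1/s.\<close>

lemma one_plus_mult_le_powr:
  fixes x s :: real
  assumes "0 \<le> x" "1 \<le> s"
  shows "1 + s * x \<le> (1 + x) powr s"
proof -
  have "(1 + s * x) powr (1 / s) * 1 powr (1 - 1 / s) \<le> 1 / s * (1 + s * x) + (1 - 1 / s) * 1"
    using assms by (intro Youngs_inequality_0) (auto simp: add_pos_nonneg)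
  also have "\<dots> = 1 + x" using assms by (simp add: field_simps)
  finally have "((1 + s * x) powr (1 / s)) powr s \<le> (1 + x) powr s"
    using assms by (intro powr_mono2) auto
  then show ?thesis using assms by (simp add: powr_powr)
qed

text \<open>
  Apart from its first sum the form is homogeneous of degree two in \<open>\<theta>\<close>, so nonnegativity for
  \<open>sqrt s * \<theta>\<close> is a strict bound for \<open>\<theta>\<close>.
\<close>

lemma curvature_form_lower_bound:
  fixes \<theta> :: "nat \<Rightarrow> real" and k :: "nat \<Rightarrow> nat \<Rightarrow> nat \<Rightarrow> real"
  assumes sym: "\<And>i j l. i < n \<Longrightarrow> j < n \<Longrightarrow> l < n \<Longrightarrow> k i j l = k i l j"
    and s: "1 \<le> s" and le: "(\<Prod>i<n. 1 + (\<theta> i)\<^sup>2) powr s \<le> 9"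
  shows "(1 - 1 / s) * (\<Sum>c<n. \<Sum>d<n. \<Sum>e<n. (k c d e)\<^sup>2)
      \<le> (\<Sum>c<n. \<Sum>d<n. \<Sum>e<n. (k c d e)\<^sup>2) + (\<Sum>c<n. (\<Sum>d<n. \<theta> d * k d c d)\<^sup>2)
            + (\<Sum>c<n. \<Sum>d<n. \<Sum>e<n. \<theta> e * \<theta> d * (k e c d * k d c e))"
proof -
  define \<eta> where "\<eta> i = sqrt s * \<theta> i" for i
  define S where "S = (\<Sum>c<n. \<Sum>d<n. \<Sum>e<n. (k c d e)\<^sup>2)"
  define A where "A = (\<Sum>c<n. (\<Sum>d<n. \<theta> d * k d c d)\<^sup>2)"
  define R where "R = (\<Sum>c<n. \<Sum>d<n. \<Sum>e<n. \<theta> e * \<theta> d * (k e c d * k d c e))"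
  have "(\<Prod>i<n. 1 + (\<eta> i)\<^sup>2) \<le> (\<Prod>i<n. (1 + (\<theta> i)\<^sup>2) powr s)"
    using s by (intro prod_mono) (auto simp: \<eta>_def power_mult_distrib one_plus_mult_le_powr)
  also have "\<dots> = (\<Prod>i<n. 1 + (\<theta> i)\<^sup>2) powr s" by (simp add: prod_powr_distrib)
  finally have "(\<Prod>i<n. 1 + (\<eta> i)\<^sup>2) \<le> 9" using le by simp
  from curvature_form_nonneg[OF sym this]
  have "0 \<le> S + (\<Sum>c<n. (\<Sum>d<n. \<eta> d * k d c d)\<^sup>2)
            + (\<Sum>c<n. \<Sum>d<n. \<Sum>e<n. \<eta> e * \<eta> d * (k e c d * k d c e))"
    unfolding S_def by simp
  also have "(\<Sum>c<n. (\<Sum>d<n. \<eta> d * k d c d)\<^sup>2) = s * A"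
  proof -
    have "(\<Sum>d<n. \<eta> d * k d c d) = sqrt s * (\<Sum>d<n. \<theta> d * k d c d)" for c
      by (simp add: \<eta>_def sum_distrib_left ac_simps)
    then show ?thesis
      using s by (simp only: A_def power_mult_distrib sum_distrib_left[symmetric]) simp
  qed
  also have "(\<Sum>c<n. \<Sum>d<n. \<Sum>e<n. \<eta> e * \<eta> d * (k e c d * k d c e)) = s * R"
  proof -
    have "\<eta> e * \<eta> d * x = s * (\<theta> e * \<theta> d * x)" for d e x
      using s real_sqrt_mult_self[of s] by (simp add: \<eta>_def ac_simps)
    then show ?thesis by (simp only: R_def sum_distrib_left)
  qed
  finally have "0 \<le> S + s * A + s * R" .
  then have "(1 - 1 / s) * S \<le> S + A + R" using s by (simp add: field_simps)
  then show ?thesis unfolding S_def A_def R_def .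
qed


subsection \<open>Singular values\<close>

text \<open>Matrices are functions on all index pairs; the entries outside the block are fixed to 0
  because the set would otherwise not be compact in the product topology.\<close>

definition orthogonal_matrices :: "nat \<Rightarrow> (nat \<Rightarrow> nat \<Rightarrow> real) set" where
  "orthogonal_matrices n =
     {U. (\<forall>i<n. \<forall>j<n. (\<Sum>l<n. U i l * U j l) = (if i = j then 1 else 0)) \<and>
         (\<forall>i j. n \<le> i \<or> n \<le> j \<longrightarrow> U i j = 0)}"

lemma compact_orthogonal_matrices: "compact (orthogonal_matrices n)"
proof -
  define S :: "nat \<Rightarrow> nat \<Rightarrow> real set" where "S i j = {-1..1}" for i j
  define B where "B = (\<Pi>\<^sub>E i\<in>UNIV. \<Pi>\<^sub>E j\<in>UNIV. S i j)"
  have "compact (\<Pi>\<^sub>E j\<in>UNIV. S i j)" for i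
    using compactin_PiE[of "\<lambda>_. euclideanreal" UNIV "S i"]
    by (simp add: euclidean_product_topology compactin_euclidean_iff) (simp add: S_def)
  then have "compact B"
    using compactin_PiE[of "\<lambda>_. euclidean :: (nat \<Rightarrow> real) topology" UNIV "\<lambda>i. \<Pi>\<^sub>E j\<in>UNIV. S i j"]
    by (simp add: euclidean_product_topology B_def compactin_euclidean_iff)
  moreover have "closed (orthogonal_matrices n)"
  proof -
    have entry: "continuous_on UNIV (\<lambda>U :: nat \<Rightarrow> nat \<Rightarrow> real. U i j)" for i j
      by (rule continuous_on_product_then_coordinatewise[OF continuous_on_product_coordinates])
    \<comment> \<open>The vanishing conditions become one equation for every pair of indices,
      trivial inside the block, so that the set is an intersection of closed sets defined by
      equations.\<close>
    have "orthogonal_matrices n =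
       (\<Inter>i\<in>{..<n}. \<Inter>j\<in>{..<n}. {U. (\<Sum>l<n. U i l * U j l) = (if i = j then 1 else 0)})
       \<inter> (\<Inter>i. \<Inter>j. {U. U i j = (if n \<le> i \<or> n \<le> j then 0 else U i j)})"
      by (auto simp: orthogonal_matrices_def split: if_splits)
    also have "closed \<dots>"
    proof (intro closed_Int closed_INT ballI)
      fix i j
      show "closed {U :: nat \<Rightarrow> nat \<Rightarrow> real. U i j = (if n \<le> i \<or> n \<le> j then 0 else U i j)}"
        by (cases "n \<le> i \<or> n \<le> j") (auto intro!: closed_Collect_eq entry continuous_intros)
    qed (intro closed_Collect_eq continuous_intros entry)+
    finally show ?thesis .
  qed
  moreover have "orthogonal_matrices n \<subseteq> B"
  proof
    fix U assume U: "U \<in> orthogonal_matrices n"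
    have "U i j \<in> {-1..1}" for i j
    proof (cases "n \<le> i \<or> n \<le> j")
      case True
      then show ?thesis using U by (auto simp: orthogonal_matrices_def)
    next
      case False
      have "(U i j)\<^sup>2 \<le> (\<Sum>l<n. (U i l)\<^sup>2)" using False by (intro member_le_sum) auto
      also have "\<dots> = 1" using U False by (simp add: orthogonal_matrices_def power2_eq_square)
      finally show ?thesis by (simp add: abs_square_le_1 abs_le_iff)
    qed
    then show "U \<in> B" by (auto simp: B_def S_def)
  qed
  ultimately show ?thesis by (metis closed_Int_compact inf.absorb_iff1)
qed

lemma identity_orthogonal_matrix:
  "(\<lambda>i j. if i = j \<and> i < n then 1 else 0) \<in> orthogonal_matrices n"
proof -
  have "(\<Sum>l<n. (if i = l \<and> i < n then 1 else 0) * (if j = l \<and> j < n then 1 else 0))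
      = (if i = j then 1 else 0 :: real)" if "i < n" "j < n" for i j
  proof -
    have "(\<Sum>l<n. (if i = l \<and> i < n then 1 else 0) * (if j = l \<and> j < n then 1 else 0))
        = (\<Sum>l<n. if i = l then if j = l then 1 else 0 else 0 :: real)"
      using that by (intro sum.cong) auto
    then show ?thesis using that by simp
  qed
  then show ?thesis by (auto simp: orthogonal_matrices_def)
qed

lemma sum_mult_two_term:
  fixes a b c d :: real
  shows "(\<Sum>l\<in>A. (a * x l + b * y l) * (c * z l + d * u l))
    = a * c * (\<Sum>l\<in>A. x l * z l) + a * d * (\<Sum>l\<in>A. x l * u l)
      + b * c * (\<Sum>l\<in>A. y l * z l) + b * d * (\<Sum>l\<in>A. y l * u l)"
  by (simp add: sum_distrib_left algebra_simps sum.distrib)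

definition rotate_rows :: "nat \<Rightarrow> nat \<Rightarrow> real \<Rightarrow> (nat \<Rightarrow> nat \<Rightarrow> real) \<Rightarrow> nat \<Rightarrow> nat \<Rightarrow> real" where
  "rotate_rows i j t U =
     U(i := (\<lambda>l. cos t * U i l + sin t * U j l), j := (\<lambda>l. (- sin t) * U i l + cos t * U j l))"

lemma rotate_rows_orthogonal:
  assumes U: "U \<in> orthogonal_matrices n" and ij: "i < n" "j < n" "i \<noteq> j"
  shows "rotate_rows i j t U \<in> orthogonal_matrices n"
proof -
  let ?V = "rotate_rows i j t U"
  define x where "x k = (if k = i then cos t else if k = j then - sin t else 1)" for k
  define y where "y k = (if k = i then sin t else if k = j then cos t else 0)" for k
  define p where "p k = (if k = j then i else k)" for k
  have V: "?V k l = x k * U (p k) l + y k * U j l" for k l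
    using ij by (auto simp: rotate_rows_def x_def y_def p_def)
  have p: "p k < n" if "k < n" for k using that ij by (auto simp: p_def)
  have orth: "(\<Sum>l<n. U a l * U b l) = (if a = b then 1 else 0)" if "a < n" "b < n" for a b
    using U that by (simp add: orthogonal_matrices_def)
  have "(\<Sum>l<n. ?V a l * ?V b l) = (if a = b then 1 else 0)" if "a < n" "b < n" for a b
    unfolding V sum_mult_two_term using that ij p[OF that(1)] p[OF that(2)]
    by (auto simp: orth x_def y_def p_def sin_cos_squared_add3 add.commute[of "sin t * sin t"])
  moreover have "?V a b = 0" if "n \<le> a \<or> n \<le> b" for a b
    using that U ij by (auto simp: rotate_rows_def orthogonal_matrices_def)
  ultimately show ?thesis by (simp add: orthogonal_matrices_def)
qed

lemma cos_sin_max_at_zero: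
  fixes A B :: real
  assumes "\<And>t. cos t * A + sin t * B \<le> A"
  shows "B = 0"
proof -
  have "((\<lambda>t. cos t * A + sin t * B) has_real_derivative B) (at 0)"
    by (auto intro!: derivative_eq_intros)
  then show ?thesis by (rule DERIV_local_max[where d = 1]) (use assms in auto)
qed

text \<open>Rotating rows i and j of U by an angle t gives a trigonometric function of t that is
  maximal at 0; the claim is that its derivative vanishes there. Since Y is arbitrary, the lemma
  serves both factors of a singular value decomposition.\<close>

lemma maximal_orthogonal_stationary:
  fixes c :: "nat \<Rightarrow> real" and Y :: "nat \<Rightarrow> nat \<Rightarrow> real"
  assumes U: "U \<in> orthogonal_matrices m"
    and max: "\<And>V. V \<in> orthogonal_matrices m \<Longrightarrow>
      (\<Sum>k<m. c k * (\<Sum>l<m. V k l * Y k l)) \<le> (\<Sum>k<m. c k * (\<Sum>l<m. U k l * Y k l))"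
    and ij: "i < m" "j < m" "i \<noteq> j"
  shows "c i * (\<Sum>l<m. U j l * Y i l) = c j * (\<Sum>l<m. U i l * Y j l)"
proof -
  define L where "L V k a = (\<Sum>l<m. V k l * Y a l)" for V :: "nat \<Rightarrow> nat \<Rightarrow> real" and k a
  define C where "C = (\<Sum>k\<in>{..<m} - {i} - {j}. c k * L U k k)"
  have split: "(\<Sum>k<m. c k * L V k k)
      = c i * L V i i + (c j * L V j j + (\<Sum>k\<in>{..<m} - {i} - {j}. c k * L V k k))" for V
    using ij by (simp add: sum.remove[of "{..<m}" i] sum.remove[of "{..<m} - {i}" j])
  have "cos t * (c i * L U i i + c j * L U j j) + sin t * (c i * L U j i - c j * L U i j)
      \<le> c i * L U i i + c j * L U j j" for t
  proof -
    let ?V = "rotate_rows i j t U"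
    have e: "L ?V i i = cos t * L U i i + sin t * L U j i" "L ?V j j = - sin t * L U i j + cos t * L U j j"
      using ij by (simp_all add: L_def rotate_rows_def sum_distrib_left sum_subtractf sum_negf sum.distrib algebra_simps)
    have f: "(\<Sum>k\<in>{..<m} - {i} - {j}. c k * L ?V k k) = C"
      unfolding C_def by (intro sum.cong) (auto simp: L_def rotate_rows_def)
    have "(\<Sum>k<m. c k * L ?V k k) \<le> (\<Sum>k<m. c k * L U k k)"
      unfolding L_def by (intro max rotate_rows_orthogonal U ij)
    then show ?thesis unfolding split e f C_def[symmetric] by (simp add: algebra_simps)
  qed
  then have "c i * L U j i - c j * L U i j = 0" by (rule cos_sin_max_at_zero)
  then show ?thesis by (simp add: L_def)
qed

text \<open>
  The weights \<open>i + 1\<close> are positive and distinct, so that a pair of orthogonal matrices maximising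
  the weighted trace of \<open>U Z V\<^sup>T\<close> is stationary only if that matrix is diagonal.
\<close>

theorem singular_value_decomposition:
  fixes Z :: "nat \<Rightarrow> nat \<Rightarrow> real"
  obtains U V where "U \<in> orthogonal_matrices m" "V \<in> orthogonal_matrices n"
    "\<And>i j. i < m \<Longrightarrow> j < n \<Longrightarrow> i \<noteq> j \<Longrightarrow> (\<Sum>k<m. \<Sum>l<n. U i k * Z k l * V j l) = 0"
proof -
  define M where "M U V i j = (\<Sum>k<m. \<Sum>l<n. U i k * Z k l * V j l)" for U V :: "nat \<Rightarrow> nat \<Rightarrow> real" and i j
  define r where "r = min m n"
  \<comment> \<open>Beyond r the weights are 0. The same functional is therefore a sum over all m
    rows of U and also over all n rows of V, and stationarity holds for indices in the full
    ranges.\<close>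
  define c where "c i = (if i < r then real (i + 1) else 0)" for i
  define K where "K = orthogonal_matrices m \<times> orthogonal_matrices n"
  define \<Phi> where "\<Phi> = (\<lambda>(U, V). \<Sum>i<r. c i * M U V i i)"
  have "compact K" unfolding K_def by (intro compact_Times compact_orthogonal_matrices)
  moreover have "K \<noteq> {}" unfolding K_def Times_empty using identity_orthogonal_matrix by blast
  moreover have "continuous_on K \<Phi>"
  proof -
    have f: "continuous_on K (\<lambda>x. fst x i j)" for i j
      by (rule continuous_on_product_then_coordinatewise[OF continuous_on_product_then_coordinatewise[OF
            continuous_on_fst[OF continuous_on_id]]])
    have s: "continuous_on K (\<lambda>x. snd x i j)" for i j
      by (rule continuous_on_product_then_coordinatewise[OF continuous_on_product_then_coordinatewise[OF
            continuous_on_snd[OF continuous_on_id]]])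
    show ?thesis unfolding \<Phi>_def M_def case_prod_beta by (intro continuous_intros f s)
  qed
  ultimately obtain x where x: "x \<in> K" "\<And>y. y \<in> K \<Longrightarrow> \<Phi> y \<le> \<Phi> x"
    using continuous_attains_sup[of K \<Phi>] by blast
  obtain U V where UV: "x = (U, V)" by fastforce
  have U: "U \<in> orthogonal_matrices m" and V: "V \<in> orthogonal_matrices n"
    using x(1) by (auto simp: UV K_def)
  have ext: "(\<Sum>i<r. c i * f i) = (\<Sum>i<N. c i * f i)" if "r \<le> N" for f :: "nat \<Rightarrow> real" and N
    using that by (intro sum.mono_neutral_left) (auto simp: c_def)
  have rm: "r \<le> m" and rn: "r \<le> n" by (simp_all add: r_def)
  have rows: "c i * M U V j i = c j * M U V i j" if "i < m" "j < m" "i \<noteq> j" for i j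
  proof -
    have M: "M W V a b = (\<Sum>k<m. W a k * (\<Sum>l<n. Z k l * V b l))" for W a b
      by (simp add: M_def sum_distrib_left mult.assoc)
    show ?thesis unfolding M
    proof (rule maximal_orthogonal_stationary[OF U _ that])
      fix W assume "W \<in> orthogonal_matrices m"
      then have "\<Phi> (W, V) \<le> \<Phi> (U, V)" using x(2)[of "(W, V)"] V by (simp add: UV K_def)
      then show "(\<Sum>k<m. c k * (\<Sum>l<m. W k l * (\<Sum>la<n. Z l la * V k la)))
          \<le> (\<Sum>k<m. c k * (\<Sum>l<m. U k l * (\<Sum>la<n. Z l la * V k la)))"
        by (simp add: \<Phi>_def ext[OF rm] M)
    qed
  qed
  have cols: "c i * M U V i j = c j * M U V j i" if "i < n" "j < n" "i \<noteq> j" for i j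
  proof -
    have M: "M U W a b = (\<Sum>l<n. W b l * (\<Sum>k<m. U a k * Z k l))" for W a b
      unfolding M_def by (subst sum.swap) (simp add: sum_distrib_left mult.assoc mult.left_commute mult.commute)
    show ?thesis unfolding M
    proof (rule maximal_orthogonal_stationary[OF V _ that])
      fix W assume "W \<in> orthogonal_matrices n"
      then have "\<Phi> (U, W) \<le> \<Phi> (U, V)" using x(2)[of "(U, W)"] U by (simp add: UV K_def)
      then show "(\<Sum>k<n. c k * (\<Sum>l<n. W k l * (\<Sum>ka<m. U k ka * Z ka l)))
          \<le> (\<Sum>k<n. c k * (\<Sum>l<n. V k l * (\<Sum>ka<m. U k ka * Z ka l)))"
        by (simp add: \<Phi>_def ext[OF rn] M)
    qed
  qed
  \<comment> \<open>For two indices below r, row and column stationarity combine to the same entry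
    multiplied by the squares of two different weights. If one index is r or more, its weight is 0
    and the other weight is not, so a single relation suffices.\<close>
  have "M U V i j = 0" if ij: "i < m" "j < n" "i \<noteq> j" for i j
  proof -
    have "i < r \<or> j < r" using ij by (auto simp: r_def min_def)
    then consider "i < r" "j < r" | "r \<le> i" "j < r" | "i < r" "r \<le> j"
      by linarith
    then show ?thesis
    proof cases
      case 1
      then have "i < m" "j < m" "i < n" "j < n" by (auto simp: r_def)
      then have "c j * M U V i j = c i * M U V j i" "c i * M U V i j = c j * M U V j i"
        using rows[of i j] cols[of i j] ij by auto
      then have "c i * (c i * M U V i j) = c j * (c j * M U V i j)" by (simp add: ac_simps)
      then have "((c i)\<^sup>2 - (c j)\<^sup>2) * M U V i j = 0" by (simp add: power2_eq_square algebra_simps)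
      moreover have "(c i)\<^sup>2 \<noteq> (c j)\<^sup>2" using 1 ij by (auto simp: c_def power2_eq_iff_nonneg)
      ultimately show ?thesis by simp
    next
      case 2
      then have "c i = 0" "c j \<noteq> 0" "j < m" using rm by (auto simp: c_def)
      then show ?thesis using rows[of i j] ij by auto
    next
      case 3
      then have "c j = 0" "c i \<noteq> 0" "i < n" using rn by (auto simp: c_def)
      then show ?thesis using cols[of i j] ij by auto
    qed
  qed
  then show thesis using that[OF U V] by (simp add: M_def)
qed


subsection \<open>Inverse matrices\<close>

text \<open>Cramer's rule as in \<open>metric_inv\<close>, but for entries given by a function,
  which can then be differentiated in a parameter.\<close>

definition minv :: "nat \<Rightarrow> (nat \<Rightarrow> nat \<Rightarrow> real) \<Rightarrow> nat \<Rightarrow> nat \<Rightarrow> real" where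
  "minv n a i j = adj_mat (mat n n (\<lambda>(i, j). a i j)) $$ (i, j) / det (mat n n (\<lambda>(i, j). a i j))"

lemma mat_mult_entries:
  "mat n n (\<lambda>(i, j). a i j) * mat n n (\<lambda>(i, j). b i j) = mat n n (\<lambda>(i, j). \<Sum>l<n. a i l * b l j)"
  for a b :: "nat \<Rightarrow> nat \<Rightarrow> real"
  by (intro eq_matI) (auto simp: scalar_prod_def atLeast0LessThan)

lemma det_mult_entries:
  fixes a b :: "nat \<Rightarrow> nat \<Rightarrow> real"
  shows "det (mat n n (\<lambda>(i, j). \<Sum>l<n. a i l * b l j))
    = det (mat n n (\<lambda>(i, j). a i j)) * det (mat n n (\<lambda>(i, j). b i j))"
  unfolding mat_mult_entries[symmetric] by (rule det_mult[of _ n]) auto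

lemma mat_cong:
  assumes "\<And>i j. i < n \<Longrightarrow> j < n \<Longrightarrow> a i j = b i j"
  shows "mat n n (\<lambda>(i, j). a i j) = mat n n (\<lambda>(i, j). b i j)"
  using assms by (intro eq_matI) auto

lemma one_mat_entries: "1\<^sub>m n = mat n n (\<lambda>(i, j). if i = j then 1 else 0)"
  by (intro eq_matI) auto

lemma det_nonzero_if_left_inverse:
  fixes a b :: "nat \<Rightarrow> nat \<Rightarrow> real"
  assumes "\<And>i j. i < n \<Longrightarrow> j < n \<Longrightarrow> (\<Sum>l<n. a i l * b l j) = (if i = j then 1 else 0)"
  shows "det (mat n n (\<lambda>(i, j). a i j)) * det (mat n n (\<lambda>(i, j). b i j)) = 1"
proof -
  have "mat n n (\<lambda>(i, j). \<Sum>l<n. a i l * b l j) = 1\<^sub>m n"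
    unfolding one_mat_entries by (rule mat_cong) (rule assms)
  then have "det (mat n n (\<lambda>(i, j). \<Sum>l<n. a i l * b l j)) = 1" by simp
  then show ?thesis by (simp add: det_mult_entries)
qed

lemma left_inverse_imp_right_inverse:
  fixes a b :: "nat \<Rightarrow> nat \<Rightarrow> real"
  assumes "\<And>i j. i < n \<Longrightarrow> j < n \<Longrightarrow> (\<Sum>l<n. a i l * b l j) = (if i = j then 1 else 0)"
    and ij: "i < n" "j < n"
  shows "(\<Sum>l<n. b i l * a l j) = (if i = j then 1 else 0)"
proof -
  let ?A = "mat n n (\<lambda>(i, j). a i j)" and ?B = "mat n n (\<lambda>(i, j). b i j)"
  have "?A * ?B = 1\<^sub>m n"
    unfolding mat_mult_entries one_mat_entries by (rule mat_cong) (rule assms)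
  then have "?B * ?A = 1\<^sub>m n" by (intro mat_mult_left_right_inverse[of ?A n ?B]) auto
  then have "(?B * ?A) $$ (i, j) = 1\<^sub>m n $$ (i, j)" by simp
  then show ?thesis using ij unfolding mat_mult_entries one_mat_entries by simp
qed

lemma minv_right:
  assumes "det (mat n n (\<lambda>(i, j). a i j)) \<noteq> 0" "i < n" "j < n"
  shows "(\<Sum>l<n. a i l * minv n a l j) = (if i = j then 1 else 0)"
proof -
  let ?A = "mat n n (\<lambda>(i, j). a i j)"
  have A: "?A \<in> carrier_mat n n" by simp
  have "?A * adj_mat ?A = det ?A \<cdot>\<^sub>m 1\<^sub>m n" by (rule adj_mat(2)[OF A])
  then have "(?A * adj_mat ?A) $$ (i, j) = (det ?A \<cdot>\<^sub>m 1\<^sub>m n) $$ (i, j)" by simp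
  also have "(?A * adj_mat ?A) $$ (i, j) = (\<Sum>l<n. a i l * adj_mat ?A $$ (l, j))"
    using adj_mat(1)[OF A] assms(2,3) by (simp add: scalar_prod_def atLeast0LessThan)
  finally have "(\<Sum>l<n. a i l * adj_mat ?A $$ (l, j)) / det ?A = (if i = j then 1 else 0)"
    using assms by simp
  then show ?thesis by (simp add: minv_def sum_divide_distrib)
qed

lemma minv_left:
  assumes "det (mat n n (\<lambda>(i, j). a i j)) \<noteq> 0" "i < n" "j < n"
  shows "(\<Sum>l<n. minv n a i l * a l j) = (if i = j then 1 else 0)"
  by (rule left_inverse_imp_right_inverse[OF minv_right]) (use assms in auto)

lemma inverse_unique:
  fixes a b c :: "nat \<Rightarrow> nat \<Rightarrow> real"
  assumes "\<And>i j. i < n \<Longrightarrow> j < n \<Longrightarrow> (\<Sum>l<n. a i l * b l j) = (if i = j then 1 else 0)"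
    and "\<And>i j. i < n \<Longrightarrow> j < n \<Longrightarrow> (\<Sum>l<n. c i l * a l j) = (if i = j then 1 else 0)"
    and ij: "i < n" "j < n"
  shows "c i j = b i j"
proof -
  have "c i j = (\<Sum>l<n. c i l * (if l = j then 1 else 0))" using ij by (simp add: if_distrib sum.delta cong: if_cong)
  also have "\<dots> = (\<Sum>l<n. c i l * (\<Sum>k<n. a l k * b k j))" using assms(1) ij by (intro sum.cong) auto
  also have "\<dots> = (\<Sum>k<n. (\<Sum>l<n. c i l * a l k) * b k j)"
    unfolding sum_distrib_left sum_distrib_right by (subst sum.swap) (simp add: mult.assoc)
  also have "\<dots> = (\<Sum>k<n. (if i = k then 1 else 0) * b k j)" using assms(2) ij by (intro sum.cong) auto
  also have "\<dots> = (\<Sum>k<n. if i = k then b k j else 0)" by (intro sum.cong) auto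
  also have "\<dots> = b i j" using ij by simp
  finally show ?thesis .
qed


lemma det_transpose_entries:
  fixes a :: "nat \<Rightarrow> nat \<Rightarrow> real"
  shows "det (mat n n (\<lambda>(i, j). a j i)) = det (mat n n (\<lambda>(i, j). a i j))"
proof -
  have "mat n n (\<lambda>(i, j). a j i) = transpose_mat (mat n n (\<lambda>(i, j). a i j))"
    by (rule eq_matI) auto
  then show ?thesis by (simp add: det_transpose[of _ n])
qed

lemma det_diagonal_entries:
  fixes d :: "nat \<Rightarrow> real"
  shows "det (mat n n (\<lambda>(i, j). if i = j then d i else 0)) = (\<Prod>i<n. d i)"
  by (subst det_upper_triangular[of _ n])
    (auto simp: upper_triangular_def prod_list_diag_prod atLeast0LessThan intro!: prod.cong)

subsection \<open>Orthonormal frames\<close>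

lemma ip_commute: "ip N x y = ip N y x"
  by (simp add: ip_def mult.commute)

lemma ip_lincomb_left: "ip N (lincomb n c b) y = (\<Sum>i<n. c i * ip N (b i) y)"
  unfolding ip_def lincomb_def sum_distrib_left sum_distrib_right
  by (subst sum.swap) (simp add: mult.assoc)

lemma ip_lincomb_right: "ip N y (lincomb n c b) = (\<Sum>i<n. c i * ip N y (b i))"
  by (simp add: ip_commute[of N y] ip_lincomb_left)

lemma ip_diff_left: "ip N (\<lambda>k. x k - y k) z = ip N x z - ip N y z"
  by (simp add: ip_def left_diff_distrib sum_subtractf)

lemma ip_diff_right: "ip N z (\<lambda>k. x k - y k) = ip N z x - ip N z y"
  by (simp add: ip_def right_diff_distrib sum_subtractf)

lemma ip_add_right: "ip N z (\<lambda>k. x k + y k) = ip N z x + ip N z y"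
  by (simp add: ip_def distrib_left sum.distrib)

lemma ip_minus_right: "ip N z (\<lambda>k. - x k) = - ip N z x"
  by (simp add: ip_def sum_negf)

lemma ip_scale_right: "ip N z (\<lambda>k. c * x k) = c * ip N z x"
  by (simp add: ip_def sum_distrib_left ac_simps)

lemma ip_divide_right: "ip N z (\<lambda>k. x k / c) = ip N z x / c"
  by (simp add: ip_def sum_divide_distrib)

lemma ip_sum_right: "ip N z (\<lambda>k. \<Sum>i\<in>A. x i k) = (\<Sum>i\<in>A. ip N z (x i))"
  unfolding ip_def sum_distrib_left by (rule sum.swap)

lemmas ip_linear_right = ip_add_right ip_diff_right ip_minus_right ip_scale_right ip_sum_right

lemma ip_cong: "(\<And>k. k < N \<Longrightarrow> x k = x' k) \<Longrightarrow> (\<And>k. k < N \<Longrightarrow> y k = y' k) \<Longrightarrow> ip N x y = ip N x' y'"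
  by (simp add: ip_def)

lemma ip_self_nonneg: "0 \<le> ip N x x"
  by (simp add: ip_def sum_nonneg)

lemma ip_self_eq_zero:
  assumes "ip N x x = 0" "x \<in> topspace (Euclidean_space N)"
  shows "x = (\<lambda>k. 0)"
proof
  fix k
  have "\<forall>k\<in>{..<N}. x k * x k = 0"
    using assms(1) unfolding ip_def by (subst (asm) sum_nonneg_eq_0_iff) auto
  then show "x k = 0" using assms(2) by (cases "k < N") (auto simp: topspace_Euclidean_space)
qed

lemma orthonormal_ip:
  "orthonormal N n e \<Longrightarrow> i < n \<Longrightarrow> j < n \<Longrightarrow> ip N (e i) (e j) = (if i = j then 1 else 0)"
  by (simp add: orthonormal_def)

lemma orthonormal_space:
  "orthonormal N n e \<Longrightarrow> i < n \<Longrightarrow> e i \<in> topspace (Euclidean_space N)"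
  by (simp add: orthonormal_def)

lemma lincomb_space:
  "(\<And>i. i < n \<Longrightarrow> b i \<in> topspace (Euclidean_space N)) \<Longrightarrow> lincomb n c b \<in> topspace (Euclidean_space N)"
  by (simp add: topspace_Euclidean_space lincomb_def)

lemma sum_if_eq_mult:
  fixes f :: "nat \<Rightarrow> real"
  assumes "i < n"
  shows "(\<Sum>j<n. f j * (if j = i then 1 else 0)) = f i" "(\<Sum>j<n. f j * (if i = j then 1 else 0)) = f i"
    "(\<Sum>j<n. (if j = i then 1 else 0) * f j) = f i" "(\<Sum>j<n. (if i = j then 1 else 0) * f j) = f i"
proof -
  have "(\<Sum>j<n. f j * (if j = i then 1 else 0)) = (\<Sum>j<n. if j = i then f j else 0)"
    by (intro sum.cong) auto
  then show 1: "(\<Sum>j<n. f j * (if j = i then 1 else 0)) = f i" using assms by simp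
  have eq: "(if i = j then 1 else 0 :: real) = (if j = i then 1 else 0)" for j by simp
  show 2: "(\<Sum>j<n. f j * (if i = j then 1 else 0)) = f i" unfolding eq by (rule 1)
  show "(\<Sum>j<n. (if j = i then 1 else 0) * f j) = f i" "(\<Sum>j<n. (if i = j then 1 else 0) * f j) = f i"
    using 1 2 by (simp_all only: mult.commute)
qed

definition residual :: "nat \<Rightarrow> nat \<Rightarrow> (nat \<Rightarrow> vect) \<Rightarrow> vect \<Rightarrow> vect" where
  "residual N n e x = (\<lambda>k. x k - lincomb n (\<lambda>i. ip N x (e i)) e k)"

lemma residual_orthogonal:
  assumes "orthonormal N n e" "i < n"
  shows "ip N (residual N n e x) (e i) = 0"
proof -
  have "ip N (lincomb n (\<lambda>i. ip N x (e i)) e) (e i) = (\<Sum>j<n. ip N x (e j) * (if j = i then 1 else 0))"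
    unfolding ip_lincomb_left using assms by (intro sum.cong) (auto simp: orthonormal_ip)
  then show ?thesis unfolding residual_def ip_diff_left using assms(2) by (simp add: sum_if_eq_mult)
qed

lemma residual_norm_sq:
  assumes "orthonormal N n e"
  shows "ip N (residual N n e x) (residual N n e x) = ip N x x - (\<Sum>i<n. (ip N x (e i))\<^sup>2)"
proof -
  have "ip N (residual N n e x) (residual N n e x)
      = ip N (residual N n e x) x - ip N (residual N n e x) (lincomb n (\<lambda>i. ip N x (e i)) e)"
    by (subst (2) residual_def) (rule ip_diff_right)
  also have "ip N (residual N n e x) (lincomb n (\<lambda>i. ip N x (e i)) e) = 0"
    unfolding ip_lincomb_right using assms by (intro sum.neutral) (auto simp: residual_orthogonal)
  also have "ip N (residual N n e x) x = ip N x x - (\<Sum>i<n. (ip N x (e i))\<^sup>2)"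
    unfolding residual_def ip_diff_left ip_lincomb_left by (simp add: ip_commute[of N "e i" x for i] power2_eq_square)
  finally show ?thesis by simp
qed

lemma residual_space:
  "orthonormal N n e \<Longrightarrow> x \<in> topspace (Euclidean_space N) \<Longrightarrow> residual N n e x \<in> topspace (Euclidean_space N)"
  by (auto simp: residual_def topspace_Euclidean_space lincomb_def orthonormal_def)

lemma normalized_vector:
  assumes "0 < ip N x x" "x \<in> topspace (Euclidean_space N)"
  defines "y \<equiv> (\<lambda>k. x k / sqrt (ip N x x))"
  shows "ip N y y = 1" "y \<in> topspace (Euclidean_space N)" "ip N y z = ip N x z / sqrt (ip N x x)"
proof -
  show eq: "ip N y z = ip N x z / sqrt (ip N x x)" for z
    by (simp add: ip_def y_def sum_divide_distrib)
  have "ip N y y = ip N x x / (sqrt (ip N x x) * sqrt (ip N x x))"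
    by (simp add: eq ip_commute[of N x y])
  then show "ip N y y = 1" using assms(1) by simp
  show "y \<in> topspace (Euclidean_space N)" using assms(2) by (simp add: topspace_Euclidean_space y_def)
qed

lemma orthonormal_Suc:
  assumes e: "orthonormal N n e" and x: "0 < ip N x x" "x \<in> topspace (Euclidean_space N)"
    and orth: "\<And>i. i < n \<Longrightarrow> ip N x (e i) = 0"
  shows "orthonormal N (Suc n) (e(n := (\<lambda>k. x k / sqrt (ip N x x))))"
proof -
  let ?y = "\<lambda>k. x k / sqrt (ip N x x)"
  have "ip N ?y (e i) = 0" "ip N (e i) ?y = 0" if "i < n" for i
    using normalized_vector(3)[OF x, of "e i"] orth[OF that] by (simp_all add: ip_commute[of N "e i"])
  then show ?thesis
    using e normalized_vector(1,2)[OF x] by (auto simp: orthonormal_def less_Suc_eq)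
qed

text \<open>The squared norms of the residuals of the standard basis vectors add up to \<open>N - n\<close>.\<close>

lemma exists_orthogonal_vector:
  assumes e: "orthonormal N n e" and "n < N"
  obtains x where "0 < ip N x x" "x \<in> topspace (Euclidean_space N)" "\<And>i. i < n \<Longrightarrow> ip N x (e i) = 0"
proof -
  define \<delta> :: "nat \<Rightarrow> vect" where "\<delta> l = (\<lambda>k. if k = l then 1 else 0)" for l
  define r where "r l = residual N n e (\<delta> l)" for l
  have \<delta>: "ip N (\<delta> l) x = x l" if "l < N" for l x
    using that unfolding ip_def \<delta>_def by (rule sum_if_eq_mult(3))
  have norm: "ip N (r l) (r l) = 1 - (\<Sum>i<n. (e i l)\<^sup>2)" if "l < N" for l
    unfolding r_def residual_norm_sq[OF e] using that by (simp add: \<delta>) (simp add: \<delta>_def)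
  have "(\<Sum>l<N. ip N (r l) (r l)) = real N - (\<Sum>l<N. \<Sum>i<n. (e i l)\<^sup>2)"
    by (simp add: norm sum_subtractf)
  also have "(\<Sum>l<N. \<Sum>i<n. (e i l)\<^sup>2) = (\<Sum>i<n. ip N (e i) (e i))"
    by (subst sum.swap) (simp add: ip_def power2_eq_square)
  also have "\<dots> = real n" using e by (simp add: orthonormal_ip)
  finally have "0 < (\<Sum>l<N. ip N (r l) (r l))" using assms(2) by simp
  then have "(\<Sum>l<N. ip N (r l) (r l)) \<noteq> 0" by simp
  then obtain l where "l \<in> {..<N}" "ip N (r l) (r l) \<noteq> 0" by (rule sum.not_neutral_contains_not_neutral)
  then have l: "l < N" "0 < ip N (r l) (r l)" using ip_self_nonneg[of N "r l"] by simp_all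
  show thesis
  proof (rule that[OF l(2)])
    have "\<delta> l \<in> topspace (Euclidean_space N)" using l(1) by (simp add: \<delta>_def topspace_Euclidean_space)
    then show "r l \<in> topspace (Euclidean_space N)" unfolding r_def by (rule residual_space[OF e])
    show "\<And>i. i < n \<Longrightarrow> ip N (r l) (e i) = 0" unfolding r_def by (rule residual_orthogonal[OF e])
  qed
qed

lemma orthonormal_completion:
  assumes "orthonormal N n e" "n \<le> N"
  obtains e' where "orthonormal N N e'" "\<And>i. i < n \<Longrightarrow> e' i = e i"
proof -
  have "\<exists>e'. orthonormal N (n + k) e' \<and> (\<forall>i<n. e' i = e i)" if "n + k \<le> N" for k
    using that
  proof (induction k)
    case 0
    then show ?case using assms by auto
  next
    case (Suc k)
    then obtain e' where e': "orthonormal N (n + k) e'" "\<forall>i<n. e' i = e i" by auto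
    obtain x where x: "0 < ip N x x" "x \<in> topspace (Euclidean_space N)"
        "\<And>i. i < n + k \<Longrightarrow> ip N x (e' i) = 0"
      using exists_orthogonal_vector[OF e'(1)] Suc.prems by auto
    define e'' where "e'' = e'(n + k := (\<lambda>l. x l / sqrt (ip N x x)))"
    have "orthonormal N (n + Suc k) e''"
      unfolding e''_def add_Suc_right by (rule orthonormal_Suc[OF e'(1) x])
    moreover have "\<forall>i<n. e'' i = e i" using e'(2) by (simp add: e''_def)
    ultimately show ?case by blast
  qed
  from this[of "N - n"] show thesis using that assms(2) by auto
qed

text \<open>The components of N orthonormal vectors form a square matrix with orthonormal rows,
  which therefore has orthonormal columns as well.\<close>

lemma orthonormal_basis_expansion:
  assumes e: "orthonormal N N e" and x: "x \<in> topspace (Euclidean_space N)"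
  shows "x = lincomb N (\<lambda>i. ip N x (e i)) e"
proof
  fix k
  show "x k = lincomb N (\<lambda>i. ip N x (e i)) e k"
  proof (cases "k < N")
    case False
    then show ?thesis
      using lincomb_space[of N e N] orthonormal_space[OF e] x by (auto simp: topspace_Euclidean_space)
  next
    case True
    have "(\<Sum>l<N. e i l * e j l) = (if i = j then 1 else 0)" if "i < N" "j < N" for i j
      using orthonormal_ip[OF e that] by (simp add: ip_def)
    from left_inverse_imp_right_inverse[OF this]
    have delta: "(\<Sum>l<N. e l i * e l j) = (if i = j then 1 else 0)" if "i < N" "j < N" for i j
      using that by simp
    have "lincomb N (\<lambda>i. ip N x (e i)) e k = (\<Sum>j<N. x j * (\<Sum>i<N. e i j * e i k))"
      unfolding lincomb_def ip_def sum_distrib_left sum_distrib_right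
      by (subst sum.swap) (simp add: mult.assoc)
    also have "\<dots> = (\<Sum>j<N. x j * (if j = k then 1 else 0))" using True by (intro sum.cong) (auto simp: delta)
    also have "\<dots> = x k" using True by (rule sum_if_eq_mult)
    finally show ?thesis by simp
  qed
qed

lemma Parseval:
  assumes e: "orthonormal N N e" and x: "x \<in> topspace (Euclidean_space N)"
  shows "ip N x y = (\<Sum>i<N. ip N x (e i) * ip N (e i) y)"
  by (subst orthonormal_basis_expansion[OF assms]) (rule ip_lincomb_left)

lemma lincomb_lincomb:
  "lincomb n c (\<lambda>i. lincomb m (d i) b) = lincomb m (\<lambda>j. \<Sum>i<n. c i * d i j) b"
  unfolding lincomb_def sum_distrib_left sum_distrib_right
  by (rule ext, subst sum.swap) (simp add: mult.assoc)

lemma Gram_Schmidt: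
  assumes b: "\<And>i. i < n \<Longrightarrow> b i \<in> topspace (Euclidean_space N)" and indep: "lin_indep n b"
  obtains e where "orthonormal N n e" "\<And>i. i < n \<Longrightarrow> \<exists>c. e i = lincomb n c b"
proof -
  \<comment> \<open>The induction also records that only the first k vectors of b have been used.
    The next residual then contains \<open>b k\<close> with coefficient 1 and is nonzero by
    independence.\<close>
  have "\<exists>e. orthonormal N k e \<and> (\<forall>i<k. \<exists>c. (\<forall>j\<ge>k. c j = 0) \<and> e i = lincomb n c b)" if "k \<le> n" for k
    using that
  proof (induction k)
    case 0
    then show ?case by (intro exI) (simp add: orthonormal_def)
  next
    case (Suc k)
    then obtain e where e: "orthonormal N k e" "\<forall>i<k. \<exists>c. (\<forall>j\<ge>k. c j = 0) \<and> e i = lincomb n c b"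
      by auto
    then obtain c where c: "\<And>i j. i < k \<Longrightarrow> k \<le> j \<Longrightarrow> c i j = 0" "\<And>i. i < k \<Longrightarrow> e i = lincomb n (c i) b"
      by metis
    define d where "d j = (if j = k then 1 else 0) - (\<Sum>i<k. ip N (b k) (e i) * c i j)" for j
    define x where "x = residual N k e (b k)"
    have "b k = lincomb n (\<lambda>j. if j = k then 1 else 0) b"
      using Suc.prems sum_if_eq_mult(3)[of k n] by (simp add: lincomb_def fun_eq_iff)
    moreover have "lincomb k (\<lambda>i. ip N (b k) (e i)) e = lincomb n (\<lambda>j. \<Sum>i<k. ip N (b k) (e i) * c i j) b"
      unfolding lincomb_lincomb[symmetric] by (simp add: lincomb_def[of k] c(2))
    ultimately have x: "x = lincomb n d b"
      unfolding x_def residual_def d_def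
      by (simp add: lincomb_def left_diff_distrib sum_subtractf fun_eq_iff)
    have dk: "d k = 1" "\<And>j. Suc k \<le> j \<Longrightarrow> d j = 0" by (simp_all add: d_def c(1))
    have xspace: "x \<in> topspace (Euclidean_space N)"
      unfolding x by (rule lincomb_space) (rule b)
    have "ip N x x \<noteq> 0"
    proof
      assume "ip N x x = 0"
      then have "lincomb n d b = (\<lambda>k. 0)" using ip_self_eq_zero xspace x by simp
      then have "d k = 0" using indep Suc.prems by (auto simp: lin_indep_def)
      then show False using dk by simp
    qed
    then have pos: "0 < ip N x x" using ip_self_nonneg[of N x] by simp
    define e' where "e' = e(k := (\<lambda>l. x l / sqrt (ip N x x)))"
    have "orthonormal N (Suc k) e'"
      unfolding e'_def x_def
      by (rule orthonormal_Suc[OF e(1)])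
        (use pos xspace residual_orthogonal[OF e(1)] in \<open>simp_all add: x_def\<close>)
    moreover have "\<exists>c. (\<forall>j\<ge>Suc k. c j = 0) \<and> e' i = lincomb n c b" if "i < Suc k" for i
    proof (cases "i = k")
      case True
      have "e' i = lincomb n (\<lambda>j. d j / sqrt (ip N x x)) b"
        unfolding e'_def True by (simp add: x lincomb_def sum_divide_distrib fun_eq_iff)
      moreover have "\<forall>j\<ge>Suc k. d j / sqrt (ip N x x) = 0" using dk(2) by simp
      ultimately show ?thesis by (intro exI[of _ "\<lambda>j. d j / sqrt (ip N x x)"] conjI)
    next
      case False
      then have "\<forall>j\<ge>Suc k. c i j = 0" "e' i = lincomb n (c i) b" using that c by (simp_all add: e'_def)
      then show ?thesis by (intro exI[of _ "c i"] conjI)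
    qed
    ultimately show ?case by (intro exI[of _ e'] conjI) simp_all
  qed
  from this[of n] obtain e where "orthonormal N n e" "\<And>i. i < n \<Longrightarrow> \<exists>c. (\<forall>j\<ge>n. c j = 0) \<and> e i = lincomb n c b"
    by auto
  then show thesis by (intro that[of e]) auto
qed

section \<open>Change of frame and Gram determinants\<close>

lemma frame_change:
  assumes e: "orthonormal N n e" and span: "\<And>a. a < n \<Longrightarrow> e a = lincomb n (P a) b"
  shows "\<And>a c. a < n \<Longrightarrow> c < n \<Longrightarrow> (\<Sum>i<n. P a i * ip N (b i) (e c)) = (if a = c then 1 else 0)"
    and "\<And>i j. i < n \<Longrightarrow> j < n \<Longrightarrow> (\<Sum>c<n. ip N (b i) (e c) * P c j) = (if i = j then 1 else 0)"
    and "\<And>i. i < n \<Longrightarrow> b i = lincomb n (\<lambda>c. ip N (b i) (e c)) e"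
    and "det (mat n n (\<lambda>(i, c). ip N (b i) (e c))) \<noteq> 0"
proof -
  show 1: "(\<Sum>i<n. P a i * ip N (b i) (e c)) = (if a = c then 1 else 0)" if "a < n" "c < n" for a c
    using orthonormal_ip[OF e that] span[OF that(1)] by (simp add: ip_lincomb_left)
  \<comment> \<open>The hypothesis puts e into the span of b. The converse starts here: a left
    inverse of a square matrix is also a right inverse.\<close>
  show 2: "(\<Sum>c<n. ip N (b i) (e c) * P c j) = (if i = j then 1 else 0)" if "i < n" "j < n" for i j
    by (rule left_inverse_imp_right_inverse[OF 1 that])
  show "b i = lincomb n (\<lambda>c. ip N (b i) (e c)) e" if "i < n" for i
  proof -
    have "lincomb n (\<lambda>c. ip N (b i) (e c)) e = lincomb n (\<lambda>c. ip N (b i) (e c)) (\<lambda>c. lincomb n (P c) b)"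
      unfolding lincomb_def[of n _ e] lincomb_def[of n _ "\<lambda>c. lincomb n (P c) b"]
      by (intro ext sum.cong) (simp_all add: span)
    also have "\<dots> = lincomb n (\<lambda>j. if i = j then 1 else 0) b"
      unfolding lincomb_lincomb unfolding lincomb_def by (intro ext sum.cong) (simp_all add: 2 that)
    also have "\<dots> = b i" using that by (simp add: lincomb_def sum_if_eq_mult)
    finally show ?thesis by simp
  qed
  show "det (mat n n (\<lambda>(i, c). ip N (b i) (e c))) \<noteq> 0"
    using det_nonzero_if_left_inverse[OF 1] by auto
qed

lemma Gram_determinant_frame:
  assumes e: "orthonormal N n e" and span: "\<And>a. a < n \<Longrightarrow> e a = lincomb n (P a) b"
  shows "det (mat n n (\<lambda>(i, j). ip N (b i) (b j))) = (det (mat n n (\<lambda>(i, j). ip N (b i) (e j))))\<^sup>2"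
proof -
  note fc = frame_change[OF e span]
  have "mat n n (\<lambda>(i, j). ip N (b i) (b j)) = mat n n (\<lambda>(i, j). \<Sum>c<n. ip N (b i) (e c) * ip N (b j) (e c))"
  proof (rule mat_cong)
    fix i j assume ij: "i < n" "j < n"
    have "ip N (b i) (b j) = ip N (lincomb n (\<lambda>c. ip N (b i) (e c)) e) (b j)"
      using fc(3)[OF _ ij(1)] by simp
    then show "ip N (b i) (b j) = (\<Sum>c<n. ip N (b i) (e c) * ip N (b j) (e c))"
      by (simp add: ip_lincomb_left ip_commute[of N "e _"])
  qed
  also have "det \<dots> = det (mat n n (\<lambda>(i, j). ip N (b i) (e j))) * det (mat n n (\<lambda>(i, j). ip N (b j) (e i)))"
    by (rule det_mult_entries)
  also have "det (mat n n (\<lambda>(i, j). ip N (b j) (e i))) = det (mat n n (\<lambda>(i, j). ip N (b i) (e j)))"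
    by (rule det_transpose_entries)
  finally show ?thesis by (simp add: power2_eq_square)
qed

lemma det_change_of_frame:
  assumes e: "orthonormal N n e" and span: "\<And>a. a < n \<Longrightarrow> e a = lincomb n (P a) b"
  shows "det (mat n n (\<lambda>(i, j). ip N (b i) (f j)))
    = det (mat n n (\<lambda>(i, j). ip N (b i) (e j))) * det (mat n n (\<lambda>(i, j). ip N (e i) (f j)))"
proof -
  note fc = frame_change[OF e span]
  have "mat n n (\<lambda>(i, j). ip N (b i) (f j)) = mat n n (\<lambda>(i, j). \<Sum>c<n. ip N (b i) (e c) * ip N (e c) (f j))"
  proof (rule mat_cong)
    fix i j assume ij: "i < n" "j < n"
    have "ip N (b i) (f j) = ip N (lincomb n (\<lambda>c. ip N (b i) (e c)) e) (f j)"
      using fc(3)[OF _ ij(1)] by simp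
    then show "ip N (b i) (f j) = (\<Sum>c<n. ip N (b i) (e c) * ip N (e c) (f j))"
      by (simp add: ip_lincomb_left)
  qed
  then show ?thesis by (simp only: det_mult_entries)
qed

lemma Gram_determinant_pos:
  assumes b: "\<And>i. i < n \<Longrightarrow> b i \<in> topspace (Euclidean_space N)" and indep: "lin_indep n b"
  shows "0 < det (mat n n (\<lambda>(i, j). ip N (b i) (b j)))"
proof -
  obtain e where e: "orthonormal N n e" "\<And>i. i < n \<Longrightarrow> \<exists>c. e i = lincomb n c b"
    using Gram_Schmidt[OF b indep] by blast
  then obtain P where P: "\<And>i. i < n \<Longrightarrow> e i = lincomb n (P i) b" by metis
  show ?thesis using Gram_determinant_frame[OF e(1) P] frame_change(4)[OF e(1) P] by simp
qed

lemma sum_lessThan_add: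
  fixes f :: "nat \<Rightarrow> real"
  shows "(\<Sum>i<n + k. f i) = (\<Sum>i<n. f i) + (\<Sum>i<k. f (n + i))"
  by (induction k) (simp_all add: add.assoc)

lemma Parseval_split:
  assumes e: "orthonormal N n e" and \<nu>: "orthonormal N (N - n) \<nu>" and n: "n \<le> N"
    and orth: "\<And>i \<alpha>. i < n \<Longrightarrow> \<alpha> < N - n \<Longrightarrow> ip N (e i) (\<nu> \<alpha>) = 0"
  shows "ip N x y = (\<Sum>i<n. ip N x (e i) * ip N (e i) y) + (\<Sum>\<alpha><N - n. ip N x (\<nu> \<alpha>) * ip N (\<nu> \<alpha>) y)"
proof -
  define b where "b i = (if i < n then e i else \<nu> (i - n))" for i
  \<comment> \<open>\<open>ip N\<close> sees only the coordinates below N, so x may be replaced by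
    its truncation, which lies in the space.\<close>
  define x' where "x' k = (if k < N then x k else 0)" for k
  have ipx: "ip N x z = ip N x' z" for z by (intro ip_cong) (simp_all add: x'_def)
  have b: "orthonormal N N b"
    unfolding orthonormal_def
  proof (intro conjI allI impI)
    fix i assume "i < N"
    then show "b i \<in> topspace (Euclidean_space N)"
      using orthonormal_space[OF e, of i] orthonormal_space[OF \<nu>, of "i - n"] by (auto simp: b_def)
  next
    fix i j assume ij: "i < N" "j < N"
    have o2: "ip N (\<nu> \<alpha>) (e i) = 0" if "i < n" "\<alpha> < N - n" for i \<alpha>
      using orth[OF that] by (simp add: ip_commute)
    show "ip N (b i) (b j) = (if i = j then 1 else 0)"
      by (cases "i < n"; cases "j < n")
        (use ij orthonormal_ip[OF e, of i j] orthonormal_ip[OF \<nu>, of "i - n" "j - n"] orth[of i "j - n"]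
           o2[of j "i - n"] in \<open>auto simp: b_def\<close>)
  qed
  have "ip N x y = (\<Sum>i<N. ip N x (b i) * ip N (b i) y)"
    unfolding ipx by (rule Parseval[OF b]) (simp add: x'_def topspace_Euclidean_space)
  also have "\<dots> = (\<Sum>i<n + (N - n). ip N x (b i) * ip N (b i) y)" using n by simp
  finally show ?thesis unfolding sum_lessThan_add by (simp add: b_def)
qed

lemma rotated_frame_orthonormal:
  assumes e: "orthonormal N n e" and V: "V \<in> orthogonal_matrices n"
  shows "orthonormal N n (\<lambda>a. lincomb n (V a) e)"
  unfolding orthonormal_def
proof (intro conjI allI impI)
  fix i j assume ij: "i < n" "j < n"
  have "ip N (lincomb n (V i) e) (lincomb n (V j) e) = (\<Sum>a<n. V j a * V i a)"
    by (simp add: ip_lincomb_left ip_lincomb_right orthonormal_ip[OF e] sum_if_eq_mult cong: sum.cong_simp)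
  then show "ip N (lincomb n (V i) e) (lincomb n (V j) e) = (if i = j then 1 else 0)"
    using V ij by (simp add: orthogonal_matrices_def eq_commute[of i j])
qed (intro lincomb_space orthonormal_space[OF e])

lemma oriented_span_nonempty:
  assumes b: "\<And>i. i < n \<Longrightarrow> b i \<in> topspace (Euclidean_space N)" and indep: "lin_indep n b" and n: "0 < n"
  shows "\<exists>e. e \<in> oriented_span N n b"
proof -
  obtain e where e: "orthonormal N n e" "\<And>i. i < n \<Longrightarrow> \<exists>c. e i = lincomb n c b"
    using Gram_Schmidt[OF b indep] by blast
  then obtain P where P: "\<And>i. i < n \<Longrightarrow> e i = lincomb n (P i) b" by metis
  \<comment> \<open>If the orthonormal basis is negatively oriented, its vector 0 is reversed; n > 0
    provides this vector.\<close>
  define s where "s i = (if i = 0 \<and> det (ip_matrix N n e b) < 0 then - 1 else 1 :: real)" for i :: nat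
  define e' where "e' i = (\<lambda>k. s i * e i k)" for i
  have ip': "ip N (e' i) y = s i * ip N (e i) y" for i y
    by (simp add: e'_def ip_scale_right ip_commute[of N _ y])
  have ss: "s i * s i = 1" for i by (simp add: s_def)
  have "orthonormal N n e'"
    unfolding orthonormal_def
  proof (intro conjI allI impI)
    fix i assume "i < n"
    then show "e' i \<in> topspace (Euclidean_space N)"
      using orthonormal_space[OF e(1)] by (simp add: e'_def topspace_Euclidean_space)
  next
    fix i j assume ij: "i < n" "j < n"
    have "ip N (e' i) (e' j) = s i * (s j * ip N (e j) (e i))"
      by (simp only: ip' ip_commute[of N "e i" "e' j"])
    then show "ip N (e' i) (e' j) = (if i = j then 1 else 0)"
      using orthonormal_ip[OF e(1) ij(2,1)] ss[of i] by auto
  qed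
  moreover have "\<exists>c. e' i = lincomb n c b" if "i < n" for i
    using P[OF that]
    by (intro exI[of _ "\<lambda>j. s i * P i j"]) (simp add: e'_def lincomb_def sum_distrib_left mult.assoc fun_eq_iff)
  moreover have "0 < det (ip_matrix N n e' b)"
  proof -
    have "det (ip_matrix N n e b) \<noteq> 0"
      using frame_change(4)[OF e(1) P] det_transpose_entries[of n "\<lambda>i j. ip N (b i) (e j)"]
      by (simp add: ip_matrix_def ip_commute)
    moreover have "ip_matrix N n e' b = mat n n (\<lambda>(i, j). \<Sum>l<n. (if i = l then s i else 0) * ip N (e l) (b j))"
      unfolding ip_matrix_def
    proof (rule mat_cong)
      fix i j assume "i < n"
      have "(\<Sum>l<n. (if i = l then s i else 0) * ip N (e l) (b j)) = (\<Sum>l<n. if l = i then s i * ip N (e l) (b j) else 0)"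
        by (intro sum.cong) auto
      then show "ip N (e' i) (b j) = (\<Sum>l<n. (if i = l then s i else 0) * ip N (e l) (b j))"
        using \<open>i < n\<close> by (simp add: ip')
    qed
    then have "det (ip_matrix N n e' b) = (\<Prod>i<n. s i) * det (ip_matrix N n e b)"
      by (simp only: det_mult_entries det_diagonal_entries ip_matrix_def)
    moreover have "(\<Prod>i<n. s i) = s 0"
      using n by (subst prod.remove[of _ 0]) (auto simp: s_def intro!: prod.neutral)
    ultimately show ?thesis by (auto simp: s_def not_less)
  qed
  ultimately show ?thesis unfolding oriented_span_def by blast
qed


subsection \<open>Derivatives of determinants and inverse matrices\<close>

text \<open>A permutation other than the identity moves at least two points. Its product of entries
  of the identity matrix therefore still contains a zero after any one factor has been replaced by
  its derivative.\<close>

lemma permutes_moves_two: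
  assumes p: "p permutes {0..<n}" "p \<noteq> id" and i: "i \<in> {0..<n}"
  obtains j where "j \<in> {0..<n} - {i}" "p j \<noteq> j"
proof -
  obtain k where k: "p k \<noteq> k" using p(2) by (auto simp: fun_eq_iff)
  have kn: "k \<in> {0..<n}" using p(1) k by (auto simp: permutes_def)
  have pk: "p k \<in> {0..<n}" "p (p k) \<noteq> p k"
    using permutes_in_image[OF p(1)] kn k permutes_inj[OF p(1)] by (auto simp: inj_eq)
  show thesis
    by (cases "k = i") (use that[of k] that[of "p k"] k kn pk in auto)
qed

lemma det_mat_eq_sum:
  fixes a :: "nat \<Rightarrow> nat \<Rightarrow> real"
  shows "det (mat n n (\<lambda>(i, j). a i j)) =
     (\<Sum>p\<in>{p. p permutes {0..<n}}. signof p * (\<Prod>i\<in>{0..<n}. a i (p i)))"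
  by (subst det_def'[of _ n]) (auto intro!: sum.cong prod.cong simp: permutes_in_image)

lemma det_has_derivative:
  fixes a :: "real \<Rightarrow> nat \<Rightarrow> nat \<Rightarrow> real"
  assumes "\<And>i j. i < n \<Longrightarrow> j < n \<Longrightarrow> ((\<lambda>t. a t i j) has_real_derivative a' i j) (at t0)"
  shows "((\<lambda>t. det (mat n n (\<lambda>(i, j). a t i j))) has_real_derivative
     (\<Sum>p\<in>{p. p permutes {0..<n}}. signof p *
        (\<Sum>i\<in>{0..<n}. a' i (p i) * (\<Prod>j\<in>{0..<n} - {i}. a t0 j (p j))))) (at t0)"
  unfolding det_mat_eq_sum
proof (intro DERIV_sum DERIV_cmult has_field_derivative_prod)
  fix p i assume "p \<in> {p. p permutes {0..<n}}" "i \<in> {0..<n}"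
  then have "i < n" "p i < n" using permutes_in_image[of p "{0..<n}" i] by auto
  then show "((\<lambda>t. a t i (p i)) has_real_derivative a' i (p i)) (at t0)" by (rule assms)
qed

lemma det_has_derivative_at_identity:
  fixes a :: "real \<Rightarrow> nat \<Rightarrow> nat \<Rightarrow> real"
  assumes deriv: "\<And>i j. i < n \<Longrightarrow> j < n \<Longrightarrow> ((\<lambda>t. a t i j) has_real_derivative a' i j) (at t0)"
    and id: "\<And>i j. i < n \<Longrightarrow> j < n \<Longrightarrow> a t0 i j = (if i = j then 1 else 0)"
  shows "((\<lambda>t. det (mat n n (\<lambda>(i, j). a t i j))) has_real_derivative (\<Sum>i<n. a' i i)) (at t0)"
proof -
  let ?s = "\<lambda>p. signof p * (\<Sum>i\<in>{0..<n}. a' i (p i) * (\<Prod>j\<in>{0..<n} - {i}. a t0 j (p j)))"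
  have "?s p = 0" if p: "p permutes {0..<n}" "p \<noteq> id" for p
  proof -
    have z: "(\<Prod>j\<in>{0..<n} - {i}. a t0 j (p j)) = 0" if i: "i \<in> {0..<n}" for i
    proof -
      obtain j where j: "j \<in> {0..<n} - {i}" "p j \<noteq> j" using permutes_moves_two[OF p i] .
      then have "p j < n" using permutes_in_image[OF p(1), of j] by auto
      then have "a t0 j (p j) = 0" using j id[of j "p j"] by auto
      then show ?thesis using j(1) by (intro prod_zero) auto
    qed
    have "(\<Sum>i\<in>{0..<n}. a' i (p i) * (\<Prod>j\<in>{0..<n} - {i}. a t0 j (p j))) = 0"
      by (intro sum.neutral ballI) (simp only: z mult_zero_right)
    then show ?thesis by simp
  qed
  then have "sum ?s {p. p permutes {0..<n}} = sum ?s {id}"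
    by (intro sum.mono_neutral_right) (auto simp: finite_permutations permutes_id)
  also have "\<dots> = (\<Sum>i<n. a' i i)"
  proof -
    have one: "(\<Prod>j\<in>{0..<n} - {i}. a t0 j j) = 1" for i
      by (intro prod.neutral) (auto simp: id)
    have "sum ?s {id} = (\<Sum>i\<in>{0..<n}. a' i i * (\<Prod>j\<in>{0..<n} - {i}. a t0 j j))"
      by (simp add: signof_id)
    also have "\<dots> = (\<Sum>i<n. a' i i)" unfolding one by (simp add: atLeast0LessThan)
    finally show ?thesis .
  qed
  finally show ?thesis using det_has_derivative[of n a a' t0, OF deriv] by simp
qed

theorem Jacobi_formula:
  fixes a :: "real \<Rightarrow> nat \<Rightarrow> nat \<Rightarrow> real"
  assumes deriv: "\<And>i j. i < n \<Longrightarrow> j < n \<Longrightarrow> ((\<lambda>t. a t i j) has_real_derivative a' i j) (at t0)"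
    and det: "det (mat n n (\<lambda>(i, j). a t0 i j)) \<noteq> 0"
  shows "((\<lambda>t. det (mat n n (\<lambda>(i, j). a t i j))) has_real_derivative
     det (mat n n (\<lambda>(i, j). a t0 i j)) * (\<Sum>i<n. \<Sum>j<n. minv n (a t0) j i * a' i j)) (at t0)"
proof -
  \<comment> \<open>Multiplication by the fixed inverse of \<open>a t0\<close> moves the base point
    to the identity, where the derivative of the determinant is the trace.\<close>
  define c where "c = minv n (a t0)"
  define M where "M t i j = (\<Sum>l<n. a t i l * c l j)" for t i j
  have c: "det (mat n n (\<lambda>(i, j). a t0 i j)) * det (mat n n (\<lambda>(i, j). c i j)) = 1"
    unfolding c_def by (rule det_nonzero_if_left_inverse[OF minv_right[OF det]])
  have "((\<lambda>t. M t i j) has_real_derivative (\<Sum>l<n. a' i l * c l j)) (at t0)" if "i < n" for i j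
    unfolding M_def using deriv that by (auto intro!: DERIV_sum derivative_eq_intros)
  moreover have "M t0 i j = (if i = j then 1 else 0)" if "i < n" "j < n" for i j
    unfolding M_def c_def by (rule minv_right[OF det that])
  ultimately have "((\<lambda>t. det (mat n n (\<lambda>(i, j). M t i j))) has_real_derivative
      (\<Sum>i<n. \<Sum>l<n. a' i l * c l i)) (at t0)"
    by (intro det_has_derivative_at_identity)
  then have "((\<lambda>t. det (mat n n (\<lambda>(i, j). a t0 i j)) * det (mat n n (\<lambda>(i, j). M t i j))) has_real_derivative
      det (mat n n (\<lambda>(i, j). a t0 i j)) * (\<Sum>i<n. \<Sum>l<n. a' i l * c l i)) (at t0)"
    by (rule DERIV_cmult)
  moreover have "det (mat n n (\<lambda>(i, j). a t0 i j)) * det (mat n n (\<lambda>(i, j). M t i j))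
      = det (mat n n (\<lambda>(i, j). a t i j))" for t
    unfolding M_def det_mult_entries using c by (simp add: ac_simps)
  ultimately show ?thesis by (simp add: c_def mult.commute)
qed

text \<open>The minor is written as a determinant of the same entries with one row and one column
  skipped, so that \<open>det_has_derivative\<close> applies to it.\<close>

lemma minv_entry:
  fixes a :: "nat \<Rightarrow> nat \<Rightarrow> real"
  assumes "i < n" "j < n"
  shows "minv n a i j = (-1) ^ (j + i) * det (mat (n - 1) (n - 1) (\<lambda>(k, l).
      a (if k < j then k else Suc k) (if l < i then l else Suc l))) / det (mat n n (\<lambda>(i, j). a i j))"
proof -
  have "mat_delete (mat n n (\<lambda>(i, j). a i j)) j i = mat (n - 1) (n - 1) (\<lambda>(k, l).
      a (if k < j then k else Suc k) (if l < i then l else Suc l))"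
    unfolding mat_delete_def by (rule eq_matI) auto
  then show ?thesis using assms by (simp add: minv_def adj_mat_def cofactor_def)
qed

lemma DERIV_imp_eventually_ne:
  fixes f :: "real \<Rightarrow> real"
  assumes "(f has_real_derivative d) (at x)" "f x \<noteq> c"
  shows "\<forall>\<^sub>F t in nhds x. f t \<noteq> c"
  using DERIV_isCont[OF assms(1)] assms(2)
  by (intro tendsto_imp_eventually_ne[of f "f x"]) (simp_all add: isCont_def tendsto_at_iff_tendsto_nhds)

text \<open>Differentiability comes first, from the cofactor formula. The value of the derivative
  then follows by differentiating the left inverse relation, which holds in a neighbourhood of
  \<open>t0\<close>.\<close>

theorem minv_has_derivative:
  fixes a :: "real \<Rightarrow> nat \<Rightarrow> nat \<Rightarrow> real"
  assumes deriv: "\<And>i j. i < n \<Longrightarrow> j < n \<Longrightarrow> ((\<lambda>t. a t i j) has_real_derivative a' i j) (at t0)"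
    and det: "det (mat n n (\<lambda>(i, j). a t0 i j)) \<noteq> 0" and ij: "i < n" "j < n"
  shows "((\<lambda>t. minv n (a t) i j) has_real_derivative
     - (\<Sum>k<n. \<Sum>l<n. minv n (a t0) i k * a' k l * minv n (a t0) l j)) (at t0)"
proof -
  have "\<exists>d. ((\<lambda>t. minv n (a t) i k) has_real_derivative d) (at t0)" if "k < n" for k
  proof -
    obtain d where d: "((\<lambda>t. det (mat (n - 1) (n - 1) (\<lambda>(p, q).
        a t (if p < k then p else Suc p) (if q < i then q else Suc q)))) has_real_derivative d) (at t0)"
      using det_has_derivative[of "n - 1" "\<lambda>t p q. a t (if p < k then p else Suc p) (if q < i then q else Suc q)"
          "\<lambda>p q. a' (if p < k then p else Suc p) (if q < i then q else Suc q)" t0] deriv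
      by (auto simp: less_diff_conv)
    from DERIV_cmult[OF DERIV_divide[OF d Jacobi_formula[OF deriv det] det], of "(-1) ^ (k + i)"]
    show ?thesis
      unfolding minv_entry[OF ij(1) that] times_divide_eq_right[symmetric] by (rule exI)
  qed
  then obtain b' where b': "\<And>k. k < n \<Longrightarrow> ((\<lambda>t. minv n (a t) i k) has_real_derivative b' k) (at t0)"
    by metis
  have ev: "\<forall>\<^sub>F t in nhds t0. det (mat n n (\<lambda>(i, j). a t i j)) \<noteq> 0"
    by (rule DERIV_imp_eventually_ne[OF Jacobi_formula[OF deriv det] det])
  have eq: "(\<Sum>k<n. b' k * a t0 k l) + (\<Sum>k<n. minv n (a t0) i k * a' k l) = 0" if "l < n" for l
  proof -
    have D: "((\<lambda>t. \<Sum>k<n. minv n (a t) i k * a t k l) has_real_derivative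
        (\<Sum>k<n. b' k * a t0 k l + minv n (a t0) i k * a' k l)) (at t0)"
    proof (rule DERIV_sum)
      fix k assume "k \<in> {..<n}"
      then have "k < n" by simp
      from DERIV_mult[OF b'[OF this] deriv[OF this that]]
      show "((\<lambda>t. minv n (a t) i k * a t k l) has_real_derivative
          b' k * a t0 k l + minv n (a t0) i k * a' k l) (at t0)" by (simp add: ac_simps)
    qed
    have "((\<lambda>t. \<Sum>k<n. minv n (a t) i k * a t k l) has_real_derivative 0) (at t0)"
    proof -
      have "\<forall>\<^sub>F t in nhds t0. (\<Sum>k<n. minv n (a t) i k * a t k l) = (if i = l then 1 else 0)"
        using ev by eventually_elim (rule minv_left[OF _ ij(1) that])
      then show ?thesis by (subst DERIV_cong_ev[OF refl _ refl]) auto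
    qed
    from DERIV_unique[OF D this] show ?thesis by (simp add: sum.distrib)
  qed
  have "b' j = (\<Sum>k<n. b' k * (\<Sum>l<n. a t0 k l * minv n (a t0) l j))"
    using ij by (simp add: minv_right[OF det] sum_if_eq_mult)
  also have "\<dots> = (\<Sum>l<n. (\<Sum>k<n. b' k * a t0 k l) * minv n (a t0) l j)"
    unfolding sum_distrib_left sum_distrib_right by (subst sum.swap) (simp add: mult.assoc)
  also have "\<dots> = (\<Sum>l<n. - (\<Sum>k<n. minv n (a t0) i k * a' k l) * minv n (a t0) l j)"
  proof (rule sum.cong[OF refl])
    fix l assume "l \<in> {..<n}"
    then have "(\<Sum>k<n. b' k * a t0 k l) = - (\<Sum>k<n. minv n (a t0) i k * a' k l)"
      using eq[of l] by simp
    then show "(\<Sum>k<n. b' k * a t0 k l) * minv n (a t0) l j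
        = - (\<Sum>k<n. minv n (a t0) i k * a' k l) * minv n (a t0) l j" by simp
  qed
  also have "\<dots> = - (\<Sum>k<n. \<Sum>l<n. minv n (a t0) i k * a' k l * minv n (a t0) l j)"
    by (subst sum.swap) (simp add: sum_distrib_right sum_negf)
  finally show ?thesis using b'[OF ij(2)] by simp
qed


subsection \<open>Partial derivatives\<close>

text \<open>\<open>pd\<close> has a value even where no derivative exists; the rules of calculus
  need a predicate that also asserts existence.\<close>

definition has_pd :: "nat \<Rightarrow> (vect \<Rightarrow> real) \<Rightarrow> real \<Rightarrow> vect \<Rightarrow> bool" where
  "has_pd i f d u \<longleftrightarrow> ((\<lambda>t. f (u(i := t))) has_real_derivative d) (at (u i))"

lemma has_pd_imp_pd: "has_pd i f d u \<Longrightarrow> pd i f u = d"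
  by (simp add: has_pd_def pd_def DERIV_imp_deriv)

lemma has_pd_const: "has_pd i (\<lambda>x. c) 0 u"
  by (simp add: has_pd_def)

lemma has_pd_diff: "has_pd i f d u \<Longrightarrow> has_pd i g e u \<Longrightarrow> has_pd i (\<lambda>x. f x - g x) (d - e) u"
  unfolding has_pd_def by (rule DERIV_diff)

lemma has_pd_mult:
  "has_pd i f d u \<Longrightarrow> has_pd i g e u \<Longrightarrow> has_pd i (\<lambda>x. f x * g x) (d * g u + f u * e) u"
  unfolding has_pd_def by (drule (1) DERIV_mult) (simp add: ac_simps)

lemma has_pd_cdivide: "has_pd i f d u \<Longrightarrow> has_pd i (\<lambda>x. f x / c) (d / c) u"
  unfolding has_pd_def by (rule DERIV_cdivide)

lemma has_pd_divide:
  "has_pd i f d u \<Longrightarrow> has_pd i g e u \<Longrightarrow> g u \<noteq> 0 \<Longrightarrow>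
     has_pd i (\<lambda>x. f x / g x) ((d * g u - f u * e) / (g u * g u)) u"
  unfolding has_pd_def by (drule (1) DERIV_divide) auto

lemma has_pd_sqrt:
  "has_pd i f d u \<Longrightarrow> 0 < f u \<Longrightarrow> has_pd i (\<lambda>x. sqrt (f x)) (d / (2 * sqrt (f u))) u"
  unfolding has_pd_def by (auto intro!: derivative_eq_intros simp: field_simps)

lemma has_pd_sum:
  "(\<And>k. k \<in> A \<Longrightarrow> has_pd i (f k) (d k) u) \<Longrightarrow> has_pd i (\<lambda>x. \<Sum>k\<in>A. f k x) (\<Sum>k\<in>A. d k) u"
  unfolding has_pd_def by (rule DERIV_sum)

lemma has_pd_ip:
  assumes "\<And>k. k < N \<Longrightarrow> has_pd i (\<lambda>x. Y x k) (Y' k) u"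
    and "\<And>k. k < N \<Longrightarrow> has_pd i (\<lambda>x. Z x k) (Z' k) u"
  shows "has_pd i (\<lambda>x. ip N (Y x) (Z x)) (ip N Y' (Z u) + ip N (Y u) Z') u"
  unfolding ip_def sum.distrib[symmetric] using assms by (intro has_pd_sum has_pd_mult) auto

lemma has_pd_det:
  assumes "\<And>k l. k < n \<Longrightarrow> l < n \<Longrightarrow> has_pd i (\<lambda>x. a x k l) (a' k l) u"
    and "det (mat n n (\<lambda>(k, l). a u k l)) \<noteq> 0"
  shows "has_pd i (\<lambda>x. det (mat n n (\<lambda>(k, l). a x k l)))
      (det (mat n n (\<lambda>(k, l). a u k l)) * (\<Sum>k<n. \<Sum>l<n. minv n (a u) l k * a' k l)) u"
  using Jacobi_formula[of n "\<lambda>t. a (u(i := t))" a' "u i"] assms unfolding has_pd_def by simp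

lemma has_pd_minv:
  assumes "\<And>k l. k < n \<Longrightarrow> l < n \<Longrightarrow> has_pd i (\<lambda>x. a x k l) (a' k l) u"
    and "det (mat n n (\<lambda>(k, l). a u k l)) \<noteq> 0" and "p < n" "q < n"
  shows "has_pd i (\<lambda>x. minv n (a x) p q)
      (- (\<Sum>k<n. \<Sum>l<n. minv n (a u) p k * a' k l * minv n (a u) l q)) u"
  using minv_has_derivative[of n "\<lambda>t. a (u(i := t))" a' "u i"] assms unfolding has_pd_def by simp

lemma has_pd_cong_ev:
  assumes "\<forall>\<^sub>F t in nhds (u i). f (u(i := t)) = g (u(i := t))"
  shows "has_pd i f d u \<longleftrightarrow> has_pd i g d u"
  unfolding has_pd_def using assms by (intro DERIV_cong_ev) auto

lemma openin_Euclidean_space_iff: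
  "openin (Euclidean_space n) U \<longleftrightarrow> (\<exists>T. open T \<and> U = T \<inter> {x. \<forall>i\<ge>n. x i = 0})"
  unfolding Euclidean_space_def by (simp add: euclidean_product_topology openin_subtopology)

lemma subtopology_Euclidean_space:
  "openin (Euclidean_space n) U \<Longrightarrow> subtopology (Euclidean_space n) U = top_of_set U"
proof -
  assume "openin (Euclidean_space n) U"
  then have "{x. \<forall>i\<ge>n. x i = 0} \<inter> U = U" unfolding openin_Euclidean_space_iff by blast
  then show ?thesis
    by (simp add: Euclidean_space_def subtopology_subtopology euclidean_product_topology)
qed

lemma continuous_on_fun_upd2:
  "continuous_on S (\<lambda>p :: real \<times> real. (u(i := fst p, j := snd p)) :: vect)"
proof (rule continuous_on_coordinatewise_then_product)
  fix k
  show "continuous_on S (\<lambda>p. (u(i := fst p, j := snd p)) k)"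
    by (cases "k = j"; cases "k = i") (auto intro!: continuous_intros)
qed

lemma openin_Euclidean_space_box:
  assumes U: "openin (Euclidean_space n) U" "u \<in> U" and ij: "i < n" "j < n"
  shows "open {p. u(i := fst p, j := snd p) \<in> U}"
proof -
  obtain T where T: "open T" "U = T \<inter> {x. \<forall>i\<ge>n. x i = 0}"
    using U(1) unfolding openin_Euclidean_space_iff by blast
  have "{p. u(i := fst p, j := snd p) \<in> U} = (\<lambda>p. u(i := fst p, j := snd p)) -` T"
    using U(2) ij unfolding T(2) by auto
  then show ?thesis
    using continuous_on_fun_upd2[of UNIV u i j] T(1) by (simp add: continuous_on_open_vimage)
qed

lemma eventually_fun_upd_mem:
  assumes U: "openin (Euclidean_space n) U" "u \<in> U" and i: "i < n"
  shows "\<forall>\<^sub>F t in nhds (u i). u(i := t) \<in> U"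
proof -
  have "open ((\<lambda>t. (t, t)) -` {p. u(i := fst p, i := snd p) \<in> U})"
    by (intro open_vimage openin_Euclidean_space_box[OF U i i] continuous_intros)
  then have "open {t. u(i := t) \<in> U}" by (simp add: vimage_def)
  then show ?thesis using U(2) unfolding eventually_nhds by (intro exI[of _ "{t. u(i := t) \<in> U}"]) simp
qed

lemma pd_cong_on:
  assumes "openin (Euclidean_space n) U" "u \<in> U" "i < n" "\<And>x. x \<in> U \<Longrightarrow> f x = g x"
  shows "pd i f u = pd i g u"
  unfolding pd_def
proof (rule deriv_cong_ev[OF _ refl])
  show "\<forall>\<^sub>F t in nhds (u i). f (u(i := t)) = g (u(i := t))"
    using eventually_fun_upd_mem[OF assms(1-3)] by eventually_elim (rule assms(4))
qed

section \<open>Symmetry of mixed partial derivatives\<close>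

lemma second_difference_mean_value:
  fixes F Fs Fst :: "real \<Rightarrow> real \<Rightarrow> real"
  assumes Fs: "\<And>s t. \<bar>s - a\<bar> < d \<Longrightarrow> \<bar>t - b\<bar> < d \<Longrightarrow> ((\<lambda>s. F s t) has_real_derivative Fs s t) (at s)"
    and Fst: "\<And>s t. \<bar>s - a\<bar> < d \<Longrightarrow> \<bar>t - b\<bar> < d \<Longrightarrow> ((\<lambda>t. Fs s t) has_real_derivative Fst s t) (at t)"
    and h: "0 < h" "h < d"
  obtains s t where "a < s" "s < a + h" "b < t" "t < b + h"
    "F (a + h) (b + h) - F (a + h) b - F a (b + h) + F a b = h * h * Fst s t"
proof -
  have "\<exists>s>a. s < a + h \<and> (F (a + h) (b + h) - F (a + h) b) - (F a (b + h) - F a b)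
      = (a + h - a) * (Fs s (b + h) - Fs s b)"
    using h by (intro MVT2[of a "a + h" "\<lambda>s. F s (b + h) - F s b"] DERIV_diff Fs) auto
  then obtain s where s: "a < s" "s < a + h"
      "(F (a + h) (b + h) - F (a + h) b) - (F a (b + h) - F a b) = h * (Fs s (b + h) - Fs s b)"
    by auto
  have "\<exists>t>b. t < b + h \<and> Fs s (b + h) - Fs s b = (b + h - b) * Fst s t"
    using h s by (intro MVT2[of b "b + h" "\<lambda>t. Fs s t"] Fst) auto
  then obtain t where t: "b < t" "t < b + h" "Fs s (b + h) - Fs s b = h * Fst s t"
    by auto
  show thesis using that[OF s(1,2) t(1,2)] s(3) t(3) by (simp add: algebra_simps)
qed

text \<open>Schwarz's theorem. The second difference over a square of side h is symmetric in the two
  variables, so by \<open>second_difference_mean_value\<close> it is \<open>h * h\<close> times a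
  value of either mixed derivative inside the square; continuity takes both values to (a,
  b).\<close>

lemma mixed_derivatives_commute:
  fixes F Fs Ft Fst Fts :: "real \<Rightarrow> real \<Rightarrow> real"
  assumes d: "0 < d"
    and Fs: "\<And>s t. \<bar>s - a\<bar> < d \<Longrightarrow> \<bar>t - b\<bar> < d \<Longrightarrow> ((\<lambda>s. F s t) has_real_derivative Fs s t) (at s)"
    and Ft: "\<And>s t. \<bar>s - a\<bar> < d \<Longrightarrow> \<bar>t - b\<bar> < d \<Longrightarrow> ((\<lambda>t. F s t) has_real_derivative Ft s t) (at t)"
    and Fst: "\<And>s t. \<bar>s - a\<bar> < d \<Longrightarrow> \<bar>t - b\<bar> < d \<Longrightarrow> ((\<lambda>t. Fs s t) has_real_derivative Fst s t) (at t)"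
    and Fts: "\<And>s t. \<bar>s - a\<bar> < d \<Longrightarrow> \<bar>t - b\<bar> < d \<Longrightarrow> ((\<lambda>s. Ft s t) has_real_derivative Fts s t) (at s)"
    and cont: "isCont (\<lambda>p. Fst (fst p) (snd p)) (a, b)" "isCont (\<lambda>p. Fts (fst p) (snd p)) (a, b)"
  shows "Fst a b = Fts a b"
proof -
  have "dist (Fst a b) (Fts a b) \<le> e" if e: "0 < e" for e
  proof -
    have "0 < e / 2" using e by simp
    obtain d1 where d1: "0 < d1" "\<And>p. dist p (a, b) < d1 \<Longrightarrow> dist (Fst (fst p) (snd p)) (Fst a b) < e / 2"
      using cont(1) \<open>0 < e / 2\<close> unfolding continuous_at_eps_delta by (metis fst_conv snd_conv)
    obtain d2 where d2: "0 < d2" "\<And>p. dist p (a, b) < d2 \<Longrightarrow> dist (Fts (fst p) (snd p)) (Fts a b) < e / 2"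
      using cont(2) \<open>0 < e / 2\<close> unfolding continuous_at_eps_delta by (metis fst_conv snd_conv)
    define h where "h = min d (min d1 d2) / 2"
    have h: "0 < h" "h < d" "2 * h \<le> d1" "2 * h \<le> d2" using d d1(1) d2(1) by (auto simp: h_def)
    obtain s t where st: "a < s" "s < a + h" "b < t" "t < b + h"
        "F (a + h) (b + h) - F (a + h) b - F a (b + h) + F a b = h * h * Fst s t"
      using second_difference_mean_value[OF Fs Fst h(1,2)] .
    obtain s' t' where st': "b < s'" "s' < b + h" "a < t'" "t' < a + h"
        "F (a + h) (b + h) - F a (b + h) - F (a + h) b + F a b = h * h * Fts t' s'"
      using second_difference_mean_value[of b d a "\<lambda>s t. F t s" "\<lambda>s t. Ft t s" "\<lambda>s t. Fts t s" h] Ft Fts h(1,2)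
      by blast
    have "F (a + h) (b + h) - F (a + h) b - F a (b + h) + F a b
        = F (a + h) (b + h) - F a (b + h) - F (a + h) b + F a b" by simp
    then have "h * h * Fst s t = h * h * Fts t' s'" unfolding st(5) st'(5) .
    then have eq: "Fst s t = Fts t' s'" using h(1) by simp
    have near: "dist (x, y) (a, b) < 2 * h" if "a < x" "x < a + h" "b < y" "y < b + h" for x y
    proof -
      have "dist (x, y) (a, b) \<le> dist x a + dist y b"
        unfolding dist_Pair_Pair by (rule sqrt_sum_squares_le_sum) auto
      also have "\<dots> < 2 * h" using that by (simp add: dist_real_def)
      finally show ?thesis .
    qed
    have "dist (Fst s t) (Fst a b) < e / 2" using d1(2)[of "(s, t)"] near[of s t] st h by simp
    moreover have "dist (Fts t' s') (Fts a b) < e / 2" using d2(2)[of "(t', s')"] near[of t' s'] st' h by simp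
    ultimately show ?thesis using dist_triangle2[of "Fst a b" "Fts a b" "Fst s t"] eq by (simp add: dist_commute)
  qed
  then have "dist (Fst a b) (Fts a b) \<le> 0" by (rule field_le_epsilon) simp
  then show ?thesis by simp
qed

lemma C_infinity_has_pd:
  assumes "C_infinity n U f" "set js \<subseteq> {..<n}" "x \<in> U" "i < n"
  shows "has_pd i (foldr pd js f) (foldr pd (i # js) f x) x"
proof -
  have "(\<lambda>t. foldr pd js f (x(i := t))) differentiable (at (x i))"
    using assms by (auto simp: C_infinity_def)
  then show ?thesis
    by (simp add: has_pd_def pd_def DERIV_deriv_iff_real_differentiable)
qed

lemma C_infinity_continuous_on:
  assumes "openin (Euclidean_space n) U" "C_infinity n U f" "set js \<subseteq> {..<n}"
  shows "continuous_on U (foldr pd js f)"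
  using assms by (auto simp: C_infinity_def subtopology_Euclidean_space)

lemma isCont_fun_upd2:
  assumes U: "openin (Euclidean_space n) U" "u \<in> U" and ij: "i < n" "j < n"
    and g: "continuous_on U g"
  shows "isCont (\<lambda>p. g (u(i := fst p, j := snd p))) (u i, u j)"
proof -
  let ?V = "{p. u(i := fst p, j := snd p) \<in> U}"
  have "continuous_on ?V (\<lambda>p. g (u(i := fst p, j := snd p)))"
    by (rule continuous_on_compose2[OF g continuous_on_fun_upd2]) auto
  then show ?thesis
    using U(2) by (simp add: continuous_on_eq_continuous_at[OF openin_Euclidean_space_box[OF U ij]])
qed

theorem C_infinity_pd_commute:
  assumes U: "openin (Euclidean_space n) U" "u \<in> U" and f: "C_infinity n U f"
    and js: "set js \<subseteq> {..<n}" and ij: "i < n" "j < n"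
  shows "foldr pd (i # j # js) f u = foldr pd (j # i # js) f u"
proof (cases "i = j")
  case False
  let ?V = "{p. u(i := fst p, j := snd p) \<in> U}"
  have "open ?V" by (rule openin_Euclidean_space_box[OF U ij])
  moreover have "(u i, u j) \<in> ?V" using U(2) by simp
  ultimately obtain e where e: "0 < e" "ball (u i, u j) e \<subseteq> ?V" by (rule openE)
  have mem: "u(i := s, j := t) \<in> U" if "\<bar>s - u i\<bar> < e / 2" "\<bar>t - u j\<bar> < e / 2" for s t
  proof -
    have "dist (u i, u j) (s, t) \<le> dist (u i) s + dist (u j) t"
      unfolding dist_Pair_Pair by (rule sqrt_sum_squares_le_sum) auto
    also have "\<dots> < e" using that by (simp add: dist_real_def abs_minus_commute)
    finally have "(s, t) \<in> ball (u i, u j) e" by simp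
    then have "(s, t) \<in> ?V" using e(2) by blast
    then show ?thesis by simp
  qed
  have d1: "((\<lambda>s. foldr pd ks f (u(i := s, j := t))) has_real_derivative
        foldr pd (i # ks) f (u(i := s, j := t))) (at s)"
    if "\<bar>s - u i\<bar> < e / 2" "\<bar>t - u j\<bar> < e / 2" "set ks \<subseteq> {..<n}" for s t ks
    using C_infinity_has_pd[OF f that(3) mem[OF that(1,2)] ij(1)] False
    by (simp add: has_pd_def fun_upd_twist)
  have d2: "((\<lambda>t. foldr pd ks f (u(i := s, j := t))) has_real_derivative
        foldr pd (j # ks) f (u(i := s, j := t))) (at t)"
    if "\<bar>s - u i\<bar> < e / 2" "\<bar>t - u j\<bar> < e / 2" "set ks \<subseteq> {..<n}" for s t ks
    using C_infinity_has_pd[OF f that(3) mem[OF that(1,2)] ij(2)] by (simp add: has_pd_def)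
  have "foldr pd (j # i # js) f (u(i := u i, j := u j)) = foldr pd (i # j # js) f (u(i := u i, j := u j))"
  proof (rule mixed_derivatives_commute[where d = "e / 2"
        and F = "\<lambda>s t. foldr pd js f (u(i := s, j := t))"
        and Fs = "\<lambda>s t. foldr pd (i # js) f (u(i := s, j := t))"
        and Ft = "\<lambda>s t. foldr pd (j # js) f (u(i := s, j := t))"
        and Fst = "\<lambda>s t. foldr pd (j # i # js) f (u(i := s, j := t))"
        and Fts = "\<lambda>s t. foldr pd (i # j # js) f (u(i := s, j := t))"])
    show "0 < e / 2" using e(1) by simp
    show "isCont (\<lambda>p. foldr pd (j # i # js) f (u(i := fst p, j := snd p))) (u i, u j)"
      using js ij by (intro isCont_fun_upd2[OF U ij] C_infinity_continuous_on[OF U(1) f]) simp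
    show "isCont (\<lambda>p. foldr pd (i # j # js) f (u(i := fst p, j := snd p))) (u i, u j)"
      using js ij by (intro isCont_fun_upd2[OF U ij] C_infinity_continuous_on[OF U(1) f]) simp
  next
    fix s t assume st: "\<bar>s - u i\<bar> < e / 2" "\<bar>t - u j\<bar> < e / 2"
    show "((\<lambda>s. foldr pd js f (u(i := s, j := t))) has_real_derivative
        foldr pd (i # js) f (u(i := s, j := t))) (at s)" by (rule d1[OF st js])
    show "((\<lambda>t. foldr pd js f (u(i := s, j := t))) has_real_derivative
        foldr pd (j # js) f (u(i := s, j := t))) (at t)" by (rule d2[OF st js])
    show "((\<lambda>t. foldr pd (i # js) f (u(i := s, j := t))) has_real_derivative
        foldr pd (j # i # js) f (u(i := s, j := t))) (at t)" by (rule d2[OF st]) (use js ij in simp)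
    show "((\<lambda>s. foldr pd (j # js) f (u(i := s, j := t))) has_real_derivative
        foldr pd (i # j # js) f (u(i := s, j := t))) (at s)" by (rule d1[OF st]) (use js ij in simp)
  qed
  then show ?thesis by simp
qed simp


subsection \<open>Contraction of tensors\<close>

text \<open>As one sum over quadruples, an iterated sum can be rearranged by a single explicit
  bijection.\<close>

lemma sum4_cartesian:
  fixes f :: "nat \<Rightarrow> nat \<Rightarrow> nat \<Rightarrow> nat \<Rightarrow> real"
  shows "(\<Sum>a<n. \<Sum>b<n. \<Sum>c<n. \<Sum>d<n. f a b c d)
    = (\<Sum>(a, b, c, d)\<in>{..<n} \<times> {..<n} \<times> {..<n} \<times> {..<n}. f a b c d)"
  by (simp add: sum.cartesian_product)

text \<open>In the applications G is the inverse metric, \<open>R i c\<close> the component of the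
  i-th coordinate vector along the c-th vector of an orthonormal frame, and P the inverse of R. A
  contraction with G in coordinates thus becomes a plain sum over the frame.\<close>

lemma frame_contract:
  fixes G R P :: "nat \<Rightarrow> nat \<Rightarrow> real"
  assumes GR: "\<And>i c. i < n \<Longrightarrow> c < n \<Longrightarrow> (\<Sum>j<n. G i j * R j c) = P c i"
    and PR: "\<And>a c. a < n \<Longrightarrow> c < n \<Longrightarrow> (\<Sum>i<n. P a i * R i c) = (if a = c then 1 else 0)"
  shows "(\<Sum>i<n. \<Sum>j<n. G i j * ((\<Sum>c<n. R i c * p c) * (\<Sum>d<n. R j d * q d))) = (\<Sum>c<n. p c * q c)"
proof -
  have "(\<Sum>j<n. G i j * ((\<Sum>c<n. R i c * p c) * (\<Sum>d<n. R j d * q d)))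
      = (\<Sum>c<n. R i c * p c) * (\<Sum>d<n. P d i * q d)" if "i < n" for i
  proof -
    have "(\<Sum>j<n. G i j * (\<Sum>d<n. R j d * q d)) = (\<Sum>d<n. (\<Sum>j<n. G i j * R j d) * q d)"
      unfolding sum_distrib_left sum_distrib_right by (subst sum.swap) (simp add: mult.assoc)
    also have "\<dots> = (\<Sum>d<n. P d i * q d)" using that by (intro sum.cong refl) (simp add: GR)
    finally have "(\<Sum>j<n. G i j * (\<Sum>d<n. R j d * q d)) = (\<Sum>d<n. P d i * q d)" .
    moreover have "(\<Sum>j<n. G i j * (A * B j)) = A * (\<Sum>j<n. G i j * B j)" for A B
      by (simp add: sum_distrib_left mult.left_commute)
    ultimately show ?thesis by simp
  qed
  then have "(\<Sum>i<n. \<Sum>j<n. G i j * ((\<Sum>c<n. R i c * p c) * (\<Sum>d<n. R j d * q d)))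
      = (\<Sum>i<n. \<Sum>c<n. \<Sum>d<n. (P d i * R i c) * (p c * q d))"
    by (simp add: sum_product ac_simps)
  also have "\<dots> = (\<Sum>c<n. \<Sum>d<n. (\<Sum>i<n. P d i * R i c) * (p c * q d))"
    unfolding sum_distrib_right by (subst sum.swap, rule sum.cong[OF refl], rule sum.swap)
  also have "\<dots> = (\<Sum>c<n. \<Sum>d<n. (if d = c then 1 else 0) * (p c * q d))"
    by (intro sum.cong refl) (simp add: PR)
  also have "\<dots> = (\<Sum>c<n. p c * q c)"
    by (intro sum.cong refl) (simp add: sum_if_eq_mult)
  finally show ?thesis .
qed

lemma frame_contract_twice:
  fixes G R P b :: "nat \<Rightarrow> nat \<Rightarrow> real"
  assumes GR: "\<And>i c. i < n \<Longrightarrow> c < n \<Longrightarrow> (\<Sum>j<n. G i j * R j c) = P c i"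
    and PR: "\<And>a c. a < n \<Longrightarrow> c < n \<Longrightarrow> (\<Sum>i<n. P a i * R i c) = (if a = c then 1 else 0)"
    and \<eta>: "\<And>i j. i < n \<Longrightarrow> j < n \<Longrightarrow> \<eta> i j = (\<Sum>c<n. \<Sum>d<n. R i c * R j d * b c d)"
  shows "(\<Sum>i<n. \<Sum>j<n. G i j * (\<Sum>a<n. \<Sum>c<n. G a c * (\<eta> j a * \<eta> i c))) = (\<Sum>c<n. \<Sum>d<n. (b c d)\<^sup>2)"
proof -
  define s where "s d i = (\<Sum>e<n. R i e * b e d)" for d i
  have \<eta>': "\<eta> i c = (\<Sum>d<n. R c d * s d i)" if "i < n" "c < n" for i c
    unfolding \<eta>[OF that] s_def sum_distrib_left by (subst sum.swap) (simp add: ac_simps)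
  have "(\<Sum>i<n. \<Sum>j<n. G i j * (\<Sum>a<n. \<Sum>c<n. G a c * (\<eta> j a * \<eta> i c)))
      = (\<Sum>i<n. \<Sum>j<n. G i j * (\<Sum>d<n. s d j * s d i))"
  proof (intro sum.cong refl)
    fix i j assume ij: "i \<in> {..<n}" "j \<in> {..<n}"
    have "(\<Sum>a<n. \<Sum>c<n. G a c * (\<eta> j a * \<eta> i c))
        = (\<Sum>a<n. \<Sum>c<n. G a c * ((\<Sum>d<n. R a d * s d j) * (\<Sum>d<n. R c d * s d i)))"
      using ij by (intro sum.cong refl) (simp add: \<eta>')
    also have "\<dots> = (\<Sum>d<n. s d j * s d i)" by (rule frame_contract[OF GR PR])
    finally show "G i j * (\<Sum>a<n. \<Sum>c<n. G a c * (\<eta> j a * \<eta> i c)) = G i j * (\<Sum>d<n. s d j * s d i)"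
      by simp
  qed
  also have "\<dots> = (\<Sum>d<n. \<Sum>i<n. \<Sum>j<n. G i j * (s d i * s d j))"
  proof -
    have "(\<Sum>i<n. \<Sum>j<n. G i j * (\<Sum>d<n. s d j * s d i)) = (\<Sum>i<n. \<Sum>d<n. \<Sum>j<n. G i j * (s d i * s d j))"
      unfolding sum_distrib_left by (rule sum.cong[OF refl], subst sum.swap) (simp add: ac_simps)
    also have "\<dots> = (\<Sum>d<n. \<Sum>i<n. \<Sum>j<n. G i j * (s d i * s d j))" by (rule sum.swap)
    finally show ?thesis .
  qed
  also have "\<dots> = (\<Sum>d<n. \<Sum>c<n. b c d * b c d)"
    unfolding s_def by (intro sum.cong refl frame_contract[OF GR PR])
  also have "\<dots> = (\<Sum>c<n. \<Sum>d<n. (b c d)\<^sup>2)" by (subst sum.swap) (simp add: power2_eq_square)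
  finally show ?thesis .
qed

text \<open>The last index of y belongs to a dual basis: it is traced against a lower index without
  G, and \<open>Q\<close> converts it to the frame by summing over the coordinate index of
  R.\<close>

lemma frame_contract_trace:
  fixes G R P :: "nat \<Rightarrow> nat \<Rightarrow> real" and q y :: "nat \<Rightarrow> nat \<Rightarrow> nat \<Rightarrow> real"
  assumes GR: "\<And>i c. i < n \<Longrightarrow> c < n \<Longrightarrow> (\<Sum>j<n. G i j * R j c) = P c i"
    and PR: "\<And>a c. a < n \<Longrightarrow> c < n \<Longrightarrow> (\<Sum>i<n. P a i * R i c) = (if a = c then 1 else 0)"
    and y: "\<And>i j a. i < n \<Longrightarrow> j < n \<Longrightarrow> a < n \<Longrightarrow> y i j a = (\<Sum>c<n. \<Sum>d<n. R i c * R j d * q c d a)"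
  defines "Q \<equiv> \<lambda>c d e. \<Sum>a<n. R a e * q c d a"
  shows "(\<Sum>i<n. \<Sum>j<n. G i j * ((\<Sum>a<n. y i a a) * (\<Sum>a<n. y j a a))) = (\<Sum>c<n. (\<Sum>d<n. Q c d d)\<^sup>2)"
    and "(\<Sum>i<n. \<Sum>j<n. G i j * (\<Sum>a<n. \<Sum>c<n. y i c a * y j a c)) = (\<Sum>c<n. \<Sum>d<n. \<Sum>e<n. Q c d e * Q c e d)"
proof -
  have tr: "(\<Sum>a<n. y i a a) = (\<Sum>c<n. R i c * (\<Sum>d<n. Q c d d))" if "i < n" for i
  proof -
    have "(\<Sum>a<n. y i a a) = (\<Sum>a<n. \<Sum>c<n. \<Sum>d<n. R i c * (R a d * q c d a))"
      using that by (intro sum.cong refl) (simp add: y mult.assoc)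
    also have "\<dots> = (\<Sum>c<n. \<Sum>d<n. \<Sum>a<n. R i c * (R a d * q c d a))"
      by (subst sum.swap, rule sum.cong[OF refl], rule sum.swap)
    finally show ?thesis by (simp add: Q_def sum_distrib_left)
  qed
  have "(\<Sum>i<n. \<Sum>j<n. G i j * ((\<Sum>a<n. y i a a) * (\<Sum>a<n. y j a a)))
      = (\<Sum>i<n. \<Sum>j<n. G i j * ((\<Sum>c<n. R i c * (\<Sum>d<n. Q c d d)) * (\<Sum>c<n. R j c * (\<Sum>d<n. Q c d d))))"
    by (intro sum.cong refl) (simp add: tr)
  also have "\<dots> = (\<Sum>c<n. (\<Sum>d<n. Q c d d) * (\<Sum>d<n. Q c d d))" by (rule frame_contract[OF GR PR])
  finally show "(\<Sum>i<n. \<Sum>j<n. G i j * ((\<Sum>a<n. y i a a) * (\<Sum>a<n. y j a a))) = (\<Sum>c<n. (\<Sum>d<n. Q c d d)\<^sup>2)"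
    by (simp add: power2_eq_square)
  define s where "s c a e = (\<Sum>d<n. R c d * q e d a)" for c a e
  have y': "y i c a = (\<Sum>e<n. R i e * s c a e)" if "i < n" "c < n" "a < n" for i c a
    unfolding y[OF that] s_def sum_distrib_left by (simp add: mult.assoc)
  have "(\<Sum>i<n. \<Sum>j<n. G i j * (\<Sum>a<n. \<Sum>c<n. y i c a * y j a c))
      = (\<Sum>i<n. \<Sum>j<n. \<Sum>a<n. \<Sum>c<n. G i j * ((\<Sum>e<n. R i e * s c a e) * (\<Sum>e<n. R j e * s a c e)))"
  proof -
    have "(\<Sum>i<n. \<Sum>j<n. G i j * (\<Sum>a<n. \<Sum>c<n. y i c a * y j a c))
        = (\<Sum>i<n. \<Sum>j<n. \<Sum>a<n. \<Sum>c<n. G i j * (y i c a * y j a c))"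
      by (simp add: sum_distrib_left)
    also have "\<dots> = (\<Sum>i<n. \<Sum>j<n. \<Sum>a<n. \<Sum>c<n. G i j * ((\<Sum>e<n. R i e * s c a e) * (\<Sum>e<n. R j e * s a c e)))"
      by (intro sum.cong refl) (simp add: y')
    finally show ?thesis .
  qed
  also have "\<dots> = (\<Sum>a<n. \<Sum>c<n. \<Sum>i<n. \<Sum>j<n. G i j * ((\<Sum>e<n. R i e * s c a e) * (\<Sum>e<n. R j e * s a c e)))"
    unfolding sum4_cartesian
    by (rule sum.reindex_bij_witness[of _ "\<lambda>(a, c, i, j). (i, j, a, c)" "\<lambda>(i, j, a, c). (a, c, i, j)"]) auto
  also have "\<dots> = (\<Sum>a<n. \<Sum>c<n. \<Sum>e<n. s c a e * s a c e)"
    by (intro sum.cong refl frame_contract[OF GR PR])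
  also have "\<dots> = (\<Sum>e<n. \<Sum>a<n. \<Sum>c<n. s c a e * s a c e)"
  proof -
    have "(\<Sum>a<n. \<Sum>c<n. \<Sum>e<n. s c a e * s a c e) = (\<Sum>a<n. \<Sum>e<n. \<Sum>c<n. s c a e * s a c e)"
      by (rule sum.cong[OF refl], rule sum.swap)
    also have "\<dots> = (\<Sum>e<n. \<Sum>a<n. \<Sum>c<n. s c a e * s a c e)" by (rule sum.swap)
    finally show ?thesis .
  qed
  also have "\<dots> = (\<Sum>e<n. \<Sum>c<n. \<Sum>d<n. Q e c d * Q e d c)"
  proof (rule sum.cong[OF refl])
    fix e
    have "(\<Sum>a<n. \<Sum>c<n. s c a e * s a c e)
        = (\<Sum>a<n. \<Sum>c<n. \<Sum>d<n. \<Sum>d'<n. (R a d' * q e d a) * (R c d * q e d' c))"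
      unfolding s_def sum_product by (simp add: ac_simps)
    also have "\<dots> = (\<Sum>d<n. \<Sum>d'<n. \<Sum>a<n. \<Sum>c<n. (R a d' * q e d a) * (R c d * q e d' c))"
      unfolding sum4_cartesian
      by (rule sum.reindex_bij_witness[of _ "\<lambda>(d, d', a, c). (a, c, d, d')" "\<lambda>(a, c, d, d'). (d, d', a, c)"]) auto
    also have "\<dots> = (\<Sum>c<n. \<Sum>d<n. Q e c d * Q e d c)" by (simp add: Q_def sum_product)
    finally show "(\<Sum>a<n. \<Sum>c<n. s c a e * s a c e) = (\<Sum>c<n. \<Sum>d<n. Q e c d * Q e d c)" .
  qed
  finally show "(\<Sum>i<n. \<Sum>j<n. G i j * (\<Sum>a<n. \<Sum>c<n. y i c a * y j a c)) = (\<Sum>c<n. \<Sum>d<n. \<Sum>e<n. Q c d e * Q c e d)" .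
qed

text \<open>
  In the Laplacian of the angle function the terms that are linear in the Christoffel symbols
  \<open>\<Gamma>\<close> come from differentiating the inverse metric, both explicitly and in the dual frames.
\<close>

lemma Christoffel_terms_cancel:
  fixes G :: "nat \<Rightarrow> nat \<Rightarrow> real" and \<Gamma> y :: "nat \<Rightarrow> nat \<Rightarrow> nat \<Rightarrow> real"
  assumes G: "\<And>i j. i < n \<Longrightarrow> j < n \<Longrightarrow> G i j = G j i"
    and \<Gamma>: "\<And>i j a. i < n \<Longrightarrow> j < n \<Longrightarrow> \<Gamma> i j a = \<Gamma> j i a"
    and y: "\<And>i j a. i < n \<Longrightarrow> j < n \<Longrightarrow> y i j a = y j i a"
  shows "(\<Sum>a<n. \<Sum>i<n. \<Sum>j<n. ((\<Sum>c<n. G i c * \<Gamma> a c j) + (\<Sum>c<n. \<Gamma> a c i * G c j)) * y i j a)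
     = (\<Sum>i<n. \<Sum>j<n. G i j * (\<Sum>a<n. \<Sum>c<n. \<Gamma> i c a * y j a c + y i c a * \<Gamma> j a c))"
proof -
  let ?S = "{..<n} \<times> {..<n} \<times> {..<n} \<times> {..<n}"
  \<comment> \<open>By the symmetries of G, \<Gamma> and y, the two terms on the left and the two on
    the right all reindex to this one contraction.\<close>
  define T where "T = (\<Sum>(i, j, a, c)\<in>?S. G i j * (\<Gamma> i c a * y j a c))"
  have 1: "(\<Sum>(a, i, j, c)\<in>?S. G i c * \<Gamma> a c j * y i j a) = T"
    unfolding T_def
    by (rule sum.reindex_bij_witness[of _ "\<lambda>(c, i, j, a). (a, i, j, c)" "\<lambda>(a, i, j, c). (c, i, j, a)"])
      (auto simp: G \<Gamma> ac_simps)
  have 2: "(\<Sum>(a, i, j, c)\<in>?S. \<Gamma> a c i * G c j * y i j a) = T"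
    unfolding T_def
  proof (rule sum.reindex_bij_witness[of _ "\<lambda>(c, j, i, a). (a, i, j, c)" "\<lambda>(a, i, j, c). (c, j, i, a)"])
    fix p assume "p \<in> ?S"
    then obtain a i j c where p: "p = (a, i, j, c)" "a < n" "i < n" "j < n" "c < n" by auto
    then show "(case (case p of (a, i, j, c) \<Rightarrow> (c, j, i, a)) of (i, j, a, c) \<Rightarrow> G i j * (\<Gamma> i c a * y j a c))
        = (case p of (a, i, j, c) \<Rightarrow> \<Gamma> a c i * G c j * y i j a)"
      using \<Gamma>[of c a i] y[of j i a] by simp
  qed auto
  have 3: "(\<Sum>(i, j, a, c)\<in>?S. G i j * (y i c a * \<Gamma> j a c)) = T"
    unfolding T_def
    by (rule sum.reindex_bij_witness[of _ "\<lambda>(j, i, c, a). (i, j, a, c)" "\<lambda>(i, j, a, c). (j, i, c, a)"])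
      (auto simp: G ac_simps)
  have "(\<Sum>a<n. \<Sum>i<n. \<Sum>j<n. ((\<Sum>c<n. G i c * \<Gamma> a c j) + (\<Sum>c<n. \<Gamma> a c i * G c j)) * y i j a)
      = (\<Sum>a<n. \<Sum>i<n. \<Sum>j<n. \<Sum>c<n. G i c * \<Gamma> a c j * y i j a)
        + (\<Sum>a<n. \<Sum>i<n. \<Sum>j<n. \<Sum>c<n. \<Gamma> a c i * G c j * y i j a)"
    by (simp add: distrib_right sum_distrib_right sum.distrib)
  also have "\<dots> = T + T" unfolding sum4_cartesian 1 2 ..
  also have "\<dots> = (\<Sum>i<n. \<Sum>j<n. \<Sum>a<n. \<Sum>c<n. G i j * (\<Gamma> i c a * y j a c))
      + (\<Sum>i<n. \<Sum>j<n. \<Sum>a<n. \<Sum>c<n. G i j * (y i c a * \<Gamma> j a c))"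
    unfolding sum4_cartesian 3 by (simp add: T_def)
  also have "\<dots> = (\<Sum>i<n. \<Sum>j<n. G i j * (\<Sum>a<n. \<Sum>c<n. \<Gamma> i c a * y j a c + y i c a * \<Gamma> j a c))"
    by (simp add: distrib_left sum_distrib_left sum.distrib)
  finally show ?thesis .
qed


subsection \<open>Immersed charts\<close>

locale immersed_chart =
  fixes n N :: nat and U :: "vect set" and X :: "vect \<Rightarrow> vect"
  assumes openU: "openin (Euclidean_space n) U"
    and X_space: "\<And>x. x \<in> U \<Longrightarrow> X x \<in> topspace (Euclidean_space N)"
    and smooth: "\<And>k. k < N \<Longrightarrow> C_infinity n U (\<lambda>u. X u k)"
    and indep: "\<And>x. x \<in> U \<Longrightarrow> lin_indep n (coord_frame X x)"
begin

abbreviation E :: "vect \<Rightarrow> nat \<Rightarrow> vect" where "E x i \<equiv> coord_frame X x i"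

abbreviation G :: "vect \<Rightarrow> nat \<Rightarrow> nat \<Rightarrow> real" where "G x i j \<equiv> metric_inv N n X x i j"

definition X2 :: "nat \<Rightarrow> nat \<Rightarrow> vect \<Rightarrow> vect" where "X2 i j x = pdv i (pdv j X) x"

definition X3 :: "nat \<Rightarrow> nat \<Rightarrow> nat \<Rightarrow> vect \<Rightarrow> vect" where
  "X3 i j l x = (\<lambda>k. pd i (pd j (pd l (\<lambda>x. X x k))) x)"

text \<open>The basis of the tangent space that is dual to the coordinate frame.\<close>

definition Xup :: "vect \<Rightarrow> nat \<Rightarrow> vect" where
  "Xup x a = lincomb n (G x a) (coord_frame X x)"

lemma E_eq: "E x i k = pd i (\<lambda>x. X x k) x"
  by (simp add: coord_frame_def pdv_def)

lemma X2_eq: "X2 i j x k = pd i (pd j (\<lambda>x. X x k)) x"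
  by (simp add: X2_def pdv_def)

lemma E_space: assumes "x \<in> U" "i < n" shows "E x i \<in> topspace (Euclidean_space N)"
proof -
  have "E x i k = 0" if "N \<le> k" for k
  proof -
    have "pd i (\<lambda>x. X x k) x = pd i (\<lambda>x. 0) x"
      using X_space that by (intro pd_cong_on[OF openU assms]) (auto simp: topspace_Euclidean_space)
    then show ?thesis using has_pd_imp_pd[OF has_pd_const] by (simp add: E_eq)
  qed
  then show ?thesis by (simp add: topspace_Euclidean_space)
qed

lemma has_pd_E:
  assumes "x \<in> U" "l < n" "i < n" "k < N"
  shows "has_pd l (\<lambda>x. E x i k) (X2 l i x k) x"
proof -
  have "has_pd l (foldr pd [i] (\<lambda>x. X x k)) (foldr pd (l # [i]) (\<lambda>x. X x k) x) x"
    using assms by (intro C_infinity_has_pd[OF smooth]) auto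
  moreover have "foldr pd [i] (\<lambda>x. X x k) = (\<lambda>x. E x i k)" by (simp add: E_eq fun_eq_iff)
  ultimately show ?thesis by (simp add: X2_eq)
qed

lemma has_pd_X2:
  assumes "x \<in> U" "l < n" "i < n" "j < n" "k < N"
  shows "has_pd l (\<lambda>x. X2 i j x k) (X3 l i j x k) x"
proof -
  have "has_pd l (foldr pd [i, j] (\<lambda>x. X x k)) (foldr pd (l # [i, j]) (\<lambda>x. X x k) x) x"
    using assms by (intro C_infinity_has_pd[OF smooth]) auto
  moreover have "foldr pd [i, j] (\<lambda>x. X x k) = (\<lambda>x. X2 i j x k)" by (simp add: X2_eq fun_eq_iff)
  ultimately show ?thesis by (simp add: X3_def)
qed

lemma X2_sym:
  assumes "x \<in> U" "i < n" "j < n" "k < N"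
  shows "X2 i j x k = X2 j i x k"
  using C_infinity_pd_commute[OF openU assms(1) smooth[OF assms(4)], of "[]" i j] assms by (simp add: X2_eq)

text \<open>Two transpositions move the outermost derivative to the innermost place. This identifies
  the third derivatives in the Laplacian with those in the derivative of the mean curvature.\<close>

lemma X3_sym:
  assumes "x \<in> U" "i < n" "j < n" "l < n" "k < N"
  shows "X3 l i j x k = X3 i j l x k"
proof -
  have "X3 i j l x k = pd i (\<lambda>x. X2 j l x k) x" by (simp add: X3_def X2_eq)
  also have "\<dots> = pd i (\<lambda>x. X2 l j x k) x"
    using assms by (intro pd_cong_on[OF openU] X2_sym) auto
  also have "\<dots> = X3 i l j x k" by (simp add: X3_def X2_eq)
  also have "\<dots> = X3 l i j x k"
    using C_infinity_pd_commute[OF openU assms(1) smooth[OF assms(5)], of "[j]" i l] assms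
    by (simp add: X3_def)
  finally show ?thesis by simp
qed

lemma metric_eq: "metric N n X x = mat n n (\<lambda>(i, j). ip N (E x i) (E x j))"
  by (simp add: metric_def ip_matrix_def)

lemma metric_inv_eq: "metric_inv N n X x = minv n (\<lambda>i j. ip N (E x i) (E x j))"
  by (simp add: fun_eq_iff metric_inv_def minv_def metric_eq)

lemma det_metric_pos: "x \<in> U \<Longrightarrow> 0 < det (metric N n X x)"
  unfolding metric_eq by (intro Gram_determinant_pos E_space indep)

lemma metric_inv_left:
  assumes "x \<in> U" "i < n" "j < n"
  shows "(\<Sum>l<n. G x i l * ip N (E x l) (E x j)) = (if i = j then 1 else 0)"
  unfolding metric_inv_eq using det_metric_pos[OF assms(1)] assms(2,3)
  by (intro minv_left) (auto simp: metric_eq)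

lemma metric_inv_sym:
  assumes "x \<in> U" "i < n" "j < n"
  shows "G x i j = G x j i"
proof (rule inverse_unique[where n = n and a = "\<lambda>i j. ip N (E x i) (E x j)" and b = "\<lambda>i j. G x j i" and c = "G x"])
  fix i j assume "i < n" "j < n"
  then show "(\<Sum>l<n. ip N (E x i) (E x l) * G x j l) = (if i = j then 1 else 0)"
    using metric_inv_left[OF assms(1), of j i] by (simp add: mult.commute ip_commute[of N "E x i"] eq_commute[of i j])
  show "(\<Sum>l<n. G x i l * ip N (E x l) (E x j)) = (if i = j then 1 else 0)"
    by (rule metric_inv_left[OF assms(1) \<open>i < n\<close> \<open>j < n\<close>])
qed (use assms in auto)

lemma ip_Xup_E:
  assumes "x \<in> U" "a < n" "j < n"
  shows "ip N (Xup x a) (E x j) = (if a = j then 1 else 0)"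
  unfolding Xup_def ip_lincomb_left by (rule metric_inv_left[OF assms])

lemma ip_Xup_right: "ip N y (Xup x a) = (\<Sum>b<n. G x a b * ip N y (E x b))"
  by (simp add: Xup_def ip_lincomb_right)

lemma tangent_coord_eq: "tangent_coord N n X x y l = ip N y (Xup x l)"
  by (simp add: tangent_coord_def ip_Xup_right)

text \<open>The partial derivative of the inverse metric in direction l. The pairings
  \<open>ip N (X2 l c x) (Xup x a)\<close> are the Christoffel symbols, so this is the classical
  formula for it.\<close>

definition dG :: "nat \<Rightarrow> vect \<Rightarrow> nat \<Rightarrow> nat \<Rightarrow> real" where
  "dG l x i j = - ((\<Sum>c<n. G x i c * ip N (X2 l c x) (Xup x j)) + (\<Sum>c<n. ip N (X2 l c x) (Xup x i) * G x c j))"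

lemma has_pd_metric:
  assumes "x \<in> U" "l < n" "i < n" "j < n"
  shows "has_pd l (\<lambda>x. ip N (E x i) (E x j)) (ip N (X2 l i x) (E x j) + ip N (E x i) (X2 l j x)) x"
  using assms by (intro has_pd_ip has_pd_E)

lemma has_pd_metric_inv:
  assumes "x \<in> U" "l < n" "i < n" "j < n"
  shows "has_pd l (\<lambda>x. G x i j) (dG l x i j) x"
proof -
  have "has_pd l (\<lambda>x. minv n (\<lambda>i j. ip N (E x i) (E x j)) i j)
      (- (\<Sum>k<n. \<Sum>m<n. minv n (\<lambda>i j. ip N (E x i) (E x j)) i k
            * (ip N (X2 l k x) (E x m) + ip N (E x k) (X2 l m x))
            * minv n (\<lambda>i j. ip N (E x i) (E x j)) m j)) x"
    using assms det_metric_pos[OF assms(1)]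
    by (intro has_pd_minv has_pd_metric) (auto simp: metric_eq)
  moreover have "(\<Sum>k<n. \<Sum>m<n. G x i k * (ip N (X2 l k x) (E x m) + ip N (E x k) (X2 l m x)) * G x m j)
      = - dG l x i j"
  proof -
    have "(\<Sum>k<n. \<Sum>m<n. G x i k * (ip N (X2 l k x) (E x m) + ip N (E x k) (X2 l m x)) * G x m j)
      = (\<Sum>k<n. \<Sum>m<n. G x i k * (G x m j * ip N (X2 l k x) (E x m)))
        + (\<Sum>k<n. \<Sum>m<n. G x i k * ip N (X2 l m x) (E x k) * G x m j)"
      by (simp add: algebra_simps sum.distrib ip_commute[of N "E x k" for k])
    also have "(\<Sum>k<n. \<Sum>m<n. G x i k * (G x m j * ip N (X2 l k x) (E x m)))
        = (\<Sum>k<n. G x i k * ip N (X2 l k x) (Xup x j))"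
      unfolding ip_Xup_right sum_distrib_left using assms by (intro sum.cong) (auto simp: metric_inv_sym)
    also have "(\<Sum>k<n. \<Sum>m<n. G x i k * ip N (X2 l m x) (E x k) * G x m j)
        = (\<Sum>m<n. ip N (X2 l m x) (Xup x i) * G x m j)"
      unfolding ip_Xup_right sum_distrib_right by (rule sum.swap)
    finally show ?thesis by (simp add: dG_def)
  qed
  ultimately show ?thesis by (simp add: metric_inv_eq)
qed

lemma has_pd_Xup:
  assumes "x \<in> U" "l < n" "a < n" "k < N"
  shows "has_pd l (\<lambda>x. Xup x a k) (\<Sum>b<n. dG l x a b * E x b k + G x a b * X2 l b x k) x"
  unfolding Xup_def lincomb_def using assms
  by (intro has_pd_sum has_pd_mult has_pd_metric_inv has_pd_E) auto

lemma sff_coord_eq: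
  "sff_coord N n X x i j = (\<lambda>k. X2 i j x k - (\<Sum>l<n. ip N (X2 i j x) (Xup x l) * E x l k))"
  by (simp add: sff_coord_def normal_part_def X2_def[symmetric] lincomb_def tangent_coord_eq)

lemma ip_sff_coord_E:
  assumes "x \<in> U" "b < n"
  shows "ip N (sff_coord N n X x i j) (E x b) = 0"
proof -
  have "(\<Sum>l<n. ip N (X2 i j x) (Xup x l) * ip N (E x l) (E x b)) = ip N (X2 i j x) (E x b)"
  proof -
    have "(\<Sum>l<n. ip N (X2 i j x) (Xup x l) * ip N (E x l) (E x b))
        = (\<Sum>c<n. ip N (X2 i j x) (E x c) * (\<Sum>l<n. G x c l * ip N (E x l) (E x b)))"
      unfolding ip_Xup_right sum_distrib_left sum_distrib_right
      by (subst sum.swap) (intro sum.cong refl, simp add: metric_inv_sym assms)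
    also have "\<dots> = (\<Sum>c<n. ip N (X2 i j x) (E x c) * (if c = b then 1 else 0))"
      using assms by (intro sum.cong refl) (simp add: metric_inv_left)
    also have "\<dots> = ip N (X2 i j x) (E x b)" by (rule sum_if_eq_mult(1)[OF assms(2)])
    finally show ?thesis .
  qed
  then show ?thesis
    unfolding sff_coord_eq by (simp add: ip_commute[of N _ "E x b"] ip_linear_right)
qed

text \<open>
  The first order coefficients of the Laplacian, which acts on functions as
  \<open>\<Sum>i j. G i j * \<partial>\<^sub>i \<partial>\<^sub>j + \<Sum>j. Lap_coeff j * \<partial>\<^sub>j\<close>.
\<close>

definition Lap_coeff :: "vect \<Rightarrow> nat \<Rightarrow> real" where
  "Lap_coeff x j = - (\<Sum>i<n. \<Sum>a<n. G x i a * ip N (X2 i a x) (Xup x j))"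

text \<open>
  Up to tangent vectors the mean curvature vector is a multiple of the Laplacian of X, so that the
  hypothesis on it determines the normal part of the contracted third derivatives.
\<close>

lemma parallel_mean_curvature_third_derivatives:
  assumes u: "u \<in> U" and a: "a < n" and n: "0 < n"
    and parallel: "\<And>k. k < N \<Longrightarrow> normal_deriv_H N n X u a k = 0"
    and \<zeta>: "\<And>i. i < n \<Longrightarrow> ip N \<zeta> (E u i) = 0"
  shows "(\<Sum>i<n. \<Sum>j<n. dG a u i j * ip N \<zeta> (X2 i j u)) + (\<Sum>i<n. \<Sum>j<n. G u i j * ip N \<zeta> (X3 a i j u))
     + (\<Sum>l<n. Lap_coeff u l * ip N \<zeta> (X2 a l u)) = 0"
proof -
  \<comment> \<open>The derivative of a Christoffel symbol. In \<open>K\<close> it multiplies the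
    tangent vector \<open>E u l\<close> and so disappears in the pairing with \<zeta>.\<close>
  define S where "S i j l = ip N (X3 a i j u) (Xup u l)
      + ip N (X2 i j u) (\<lambda>k. \<Sum>b<n. dG a u l b * E u b k + G u l b * X2 a b u k)" for i j l
  have T: "has_pd a (\<lambda>x. ip N (X2 i j x) (Xup x l)) (S i j l) u" if "i < n" "j < n" "l < n" for i j l
    unfolding S_def using u a that by (intro has_pd_ip has_pd_X2 has_pd_Xup)
  have H: "mean_curvature N n X x k
      = (\<Sum>i<n. \<Sum>j<n. G x i j * (X2 i j x k - (\<Sum>l<n. ip N (X2 i j x) (Xup x l) * E x l k))) / real n" for x k
    by (simp add: mean_curvature_def sff_coord_eq)
  define K where "K k = (\<Sum>i<n. \<Sum>j<n. dG a u i j * sff_coord N n X u i j k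
      + G u i j * (X3 a i j u k - (\<Sum>l<n. S i j l * E u l k + ip N (X2 i j u) (Xup u l) * X2 a l u k)))" for k
  have "pd a (\<lambda>x. mean_curvature N n X x k) u = K k / real n" if "k < N" for k
    unfolding H K_def sff_coord_eq
    by (intro has_pd_imp_pd has_pd_cdivide has_pd_sum has_pd_mult has_pd_diff)
      (use u a that in \<open>auto intro!: has_pd_metric_inv has_pd_X2 has_pd_E T\<close>)
  then have "ip N \<zeta> (pdv a (mean_curvature N n X) u) = ip N \<zeta> (\<lambda>k. K k / real n)"
    by (intro ip_cong) (simp_all add: pdv_def)
  moreover have "ip N \<zeta> (pdv a (mean_curvature N n X) u)
      = ip N \<zeta> (lincomb n (tangent_coord N n X u (pdv a (mean_curvature N n X) u)) (coord_frame X u))"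
    using parallel by (intro ip_cong) (simp_all add: normal_deriv_H_def normal_part_def)
  moreover have "ip N \<zeta> (lincomb n c (coord_frame X u)) = 0" for c
    by (simp add: ip_lincomb_right \<zeta>)
  ultimately have "ip N \<zeta> K = 0" using n by (simp add: ip_divide_right)
  moreover have "ip N \<zeta> K = (\<Sum>i<n. \<Sum>j<n. dG a u i j * ip N \<zeta> (X2 i j u) + G u i j * (ip N \<zeta> (X3 a i j u)
      - (\<Sum>l<n. ip N (X2 i j u) (Xup u l) * ip N \<zeta> (X2 a l u))))"
    unfolding K_def sff_coord_eq by (simp add: ip_linear_right \<zeta>)
  moreover have "(\<Sum>i<n. \<Sum>j<n. G u i j * (\<Sum>l<n. ip N (X2 i j u) (Xup u l) * ip N \<zeta> (X2 a l u)))
      = - (\<Sum>l<n. Lap_coeff u l * ip N \<zeta> (X2 a l u))"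
  proof -
    have "(\<Sum>i<n. \<Sum>j<n. G u i j * (\<Sum>l<n. ip N (X2 i j u) (Xup u l) * ip N \<zeta> (X2 a l u)))
        = (\<Sum>i<n. \<Sum>l<n. \<Sum>j<n. G u i j * ip N (X2 i j u) (Xup u l) * ip N \<zeta> (X2 a l u))"
      unfolding sum_distrib_left mult.assoc by (rule sum.cong[OF refl], rule sum.swap)
    also have "\<dots> = (\<Sum>l<n. \<Sum>i<n. \<Sum>j<n. G u i j * ip N (X2 i j u) (Xup u l) * ip N \<zeta> (X2 a l u))"
      by (rule sum.swap)
    finally show ?thesis by (simp add: Lap_coeff_def sum_distrib_right sum_negf)
  qed
  ultimately show ?thesis
    by (simp add: right_diff_distrib sum.distrib sum_subtractf)
qed

text \<open>The left-hand side is what the divergence form of the Laplacian produces: the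
  logarithmic derivative of the volume density times G, plus the derivative of G. The trace of the
  Christoffel symbols cancels one of the two sums in \<open>dG\<close>, by their symmetry.\<close>

lemma Lap_coeff_eq:
  assumes x: "x \<in> U" and j: "j < n"
  shows "(\<Sum>i<n. (\<Sum>a<n. ip N (X2 i a x) (Xup x a)) * G x i j + dG i x i j) = Lap_coeff x j"
proof -
  have "(\<Sum>i<n. \<Sum>c<n. ip N (X2 i c x) (Xup x i) * G x c j) = (\<Sum>i<n. (\<Sum>a<n. ip N (X2 i a x) (Xup x a)) * G x i j)"
  proof -
    have "(\<Sum>i<n. \<Sum>c<n. ip N (X2 i c x) (Xup x i) * G x c j) = (\<Sum>i<n. \<Sum>c<n. ip N (X2 c i x) (Xup x i) * G x c j)"
    proof (intro sum.cong refl)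
      fix i c assume "i \<in> {..<n}" "c \<in> {..<n}"
      then have "ip N (X2 i c x) (Xup x i) = ip N (X2 c i x) (Xup x i)"
        using x by (intro ip_cong X2_sym) auto
      then show "ip N (X2 i c x) (Xup x i) * G x c j = ip N (X2 c i x) (Xup x i) * G x c j" by simp
    qed
    also have "\<dots> = (\<Sum>c<n. (\<Sum>i<n. ip N (X2 c i x) (Xup x i)) * G x c j)"
      unfolding sum_distrib_right by (rule sum.swap)
    finally show ?thesis .
  qed
  then show ?thesis by (simp add: dG_def Lap_coeff_def sum.distrib sum_negf sum_subtractf)
qed

text \<open>Jacobi's formula yields the trace of the Christoffel symbols twice, once for each vector
  in \<open>ip N (E x i) (E x j)\<close>, and the square root halves it.\<close>

lemma has_pd_volume:
  assumes x: "x \<in> U" and l: "l < n"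
  shows "has_pd l (\<lambda>x. sqrt (det (metric N n X x)))
     (sqrt (det (metric N n X x)) * (\<Sum>a<n. ip N (X2 l a x) (Xup x a))) x"
proof -
  define g where "g = det (metric N n X x)"
  have g: "0 < g" unfolding g_def by (rule det_metric_pos[OF x])
  have "has_pd l (\<lambda>x. det (mat n n (\<lambda>(i, j). ip N (E x i) (E x j))))
     (det (mat n n (\<lambda>(i, j). ip N (E x i) (E x j))) *
       (\<Sum>k<n. \<Sum>m<n. minv n (\<lambda>i j. ip N (E x i) (E x j)) m k *
         (ip N (X2 l k x) (E x m) + ip N (E x k) (X2 l m x)))) x"
    using l det_metric_pos[OF x] by (intro has_pd_det has_pd_metric[OF x]) (auto simp: metric_eq)
  then have "has_pd l (\<lambda>x. det (metric N n X x))
     (g * (\<Sum>k<n. \<Sum>m<n. G x m k * (ip N (X2 l k x) (E x m) + ip N (E x k) (X2 l m x)))) x"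
    by (simp add: g_def metric_eq metric_inv_eq)
  moreover have "(\<Sum>k<n. \<Sum>m<n. G x m k * (ip N (X2 l k x) (E x m) + ip N (E x k) (X2 l m x)))
      = 2 * (\<Sum>a<n. ip N (X2 l a x) (Xup x a))"
  proof -
    have "(\<Sum>k<n. \<Sum>m<n. G x m k * ip N (X2 l k x) (E x m)) = (\<Sum>a<n. ip N (X2 l a x) (Xup x a))"
      unfolding ip_Xup_right by (intro sum.cong refl) (simp add: metric_inv_sym[OF x])
    moreover have "(\<Sum>k<n. \<Sum>m<n. G x m k * ip N (E x k) (X2 l m x)) = (\<Sum>a<n. ip N (X2 l a x) (Xup x a))"
      unfolding ip_Xup_right by (subst sum.swap) (simp add: ip_commute[of N "E x k" for k])
    ultimately show ?thesis by (simp add: distrib_left sum.distrib)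
  qed
  ultimately have "has_pd l (\<lambda>x. det (metric N n X x)) (g * (2 * (\<Sum>a<n. ip N (X2 l a x) (Xup x a)))) x"
    by simp
  from has_pd_sqrt[OF this] g
  have "has_pd l (\<lambda>x. sqrt (det (metric N n X x)))
      (g * (2 * (\<Sum>a<n. ip N (X2 l a x) (Xup x a))) / (2 * sqrt g)) x"
    by (simp add: g_def)
  also have "g * (2 * (\<Sum>a<n. ip N (X2 l a x) (Xup x a))) / (2 * sqrt g)
      = sqrt g * (\<Sum>a<n. ip N (X2 l a x) (Xup x a))"
    using g real_div_sqrt[of g] by (simp add: field_simps)
  finally show ?thesis by (simp add: g_def)
qed

section \<open>Orthonormal tangent and normal frames at a point\<close>

lemma tangent_frame_expansion:
  assumes u: "u \<in> U" and e: "tangent_frame N n X u e" and c: "c < n"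
  shows "e c = lincomb n (\<lambda>i. ip N (e c) (Xup u i)) (coord_frame X u)"
proof -
  obtain p where p: "e c = lincomb n p (coord_frame X u)"
    using e c by (auto simp: tangent_frame_def)
  have "ip N (e c) (Xup u i) = p i" if "i < n" for i
  proof -
    have "ip N (e c) (Xup u i) = (\<Sum>j<n. p j * (if i = j then 1 else 0))"
      unfolding p ip_lincomb_left using u that
      by (intro sum.cong refl) (simp add: ip_commute[of N "E u _"] ip_Xup_E)
    then show ?thesis using that by (simp add: sum_if_eq_mult)
  qed
  then show ?thesis by (simp add: p lincomb_def)
qed

lemma tangent_frame_orthonormal: "tangent_frame N n X u e \<Longrightarrow> orthonormal N n e"
  by (simp add: tangent_frame_def)

lemma tangent_frame_change:
  assumes u: "u \<in> U" and e: "tangent_frame N n X u e"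
  shows "\<And>a c. a < n \<Longrightarrow> c < n \<Longrightarrow>
      (\<Sum>i<n. ip N (e a) (Xup u i) * ip N (E u i) (e c)) = (if a = c then 1 else 0)"
    and "\<And>i j. i < n \<Longrightarrow> j < n \<Longrightarrow>
      (\<Sum>c<n. ip N (E u i) (e c) * ip N (e c) (Xup u j)) = (if i = j then 1 else 0)"
    and "\<And>i. i < n \<Longrightarrow> E u i = lincomb n (\<lambda>c. ip N (E u i) (e c)) e"
  using frame_change[where e = e and b = "coord_frame X u" and P = "\<lambda>a i. ip N (e a) (Xup u i)",
      OF tangent_frame_orthonormal[OF e] tangent_frame_expansion[OF u e]] by blast+

lemma metric_inv_frame:
  "(\<Sum>j<n. G u i j * ip N (E u j) (e c)) = ip N (e c) (Xup u i)"
  by (simp add: ip_Xup_right ip_commute[of N "E u _"])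

lemma tangent_normal_orthogonal:
  assumes "u \<in> U" "tangent_frame N n X u e" "normal_frame N n X u \<nu>" "i < n" "\<alpha> < N - n"
  shows "ip N (e i) (\<nu> \<alpha>) = 0"
proof -
  have "ip N (E u j) (\<nu> \<alpha>) = 0" if "j < n" for j
    using assms(3,5) that by (simp add: normal_frame_def ip_commute)
  then show ?thesis
    by (subst tangent_frame_expansion[OF assms(1,2,4)]) (simp add: ip_lincomb_left)
qed

lemma normal_pairing:
  assumes u: "u \<in> U" and n: "n \<le> N" and e: "tangent_frame N n X u e" and \<nu>: "normal_frame N n X u \<nu>"
    and z: "\<And>i. i < n \<Longrightarrow> ip N z (E u i) = 0"
  shows "ip N x z = (\<Sum>\<alpha><N - n. ip N x (\<nu> \<alpha>) * ip N (\<nu> \<alpha>) z)"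
proof -
  have "ip N (e i) z = 0" if "i < n" for i
    by (subst tangent_frame_expansion[OF u e that]) (simp add: ip_lincomb_left z ip_commute[of N "E u _"])
  moreover have "ip N x z = (\<Sum>i<n. ip N x (e i) * ip N (e i) z) + (\<Sum>\<alpha><N - n. ip N x (\<nu> \<alpha>) * ip N (\<nu> \<alpha>) z)"
    using \<nu> by (intro Parseval_split n tangent_frame_orthonormal[OF e] tangent_normal_orthogonal[OF u e \<nu>])
      (auto simp: normal_frame_def)
  ultimately show ?thesis by simp
qed

definition sff_frame :: "vect \<Rightarrow> (nat \<Rightarrow> vect) \<Rightarrow> vect \<Rightarrow> nat \<Rightarrow> nat \<Rightarrow> real" where
  "sff_frame u e z c d = ip N (sff N n X u (e c) (e d)) z"

lemma ip_sff_coord_normal: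
  assumes "\<And>i. i < n \<Longrightarrow> ip N z (E u i) = 0"
  shows "ip N (sff_coord N n X u i j) z = ip N (X2 i j u) z"
  unfolding sff_coord_eq using assms
  by (simp add: ip_commute[of N _ z] ip_linear_right)

lemma sff_frame_eq:
  assumes "\<And>i. i < n \<Longrightarrow> ip N z (E u i) = 0"
  shows "sff_frame u e z c d
    = (\<Sum>i<n. \<Sum>j<n. ip N (e c) (Xup u i) * ip N (e d) (Xup u j) * ip N (X2 i j u) z)"
proof -
  have "ip N z (sff_coord N n X u i j) = ip N z (X2 i j u)" for i j
    using ip_sff_coord_normal[of z u i j] assms by (simp add: ip_commute[of N _ z])
  then show ?thesis
    unfolding sff_frame_def sff_def tangent_coord_eq
    by (simp add: ip_commute[of N _ z] ip_linear_right)
qed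

lemma sff_frame_sym:
  assumes u: "u \<in> U" and z: "\<And>i. i < n \<Longrightarrow> ip N z (E u i) = 0"
  shows "sff_frame u e z c d = sff_frame u e z d c"
proof -
  have "sff_frame u e z c d
      = (\<Sum>i<n. \<Sum>j<n. ip N (e d) (Xup u j) * ip N (e c) (Xup u i) * ip N (X2 j i u) z)"
    unfolding sff_frame_eq[of z u, OF z, simplified]
  proof (intro sum.cong refl)
    fix i j assume "i \<in> {..<n}" "j \<in> {..<n}"
    then have "ip N (X2 i j u) z = ip N (X2 j i u) z" using X2_sym[OF u] by (intro ip_cong) auto
    then show "ip N (e c) (Xup u i) * ip N (e d) (Xup u j) * ip N (X2 i j u) z
        = ip N (e d) (Xup u j) * ip N (e c) (Xup u i) * ip N (X2 j i u) z" by simp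
  qed
  also have "\<dots> = sff_frame u e z d c"
    unfolding sff_frame_eq[of z u, OF z, simplified] by (rule sum.swap)
  finally show ?thesis .
qed

lemma X2_in_frame:
  assumes u: "u \<in> U" and e: "tangent_frame N n X u e" and z: "\<And>i. i < n \<Longrightarrow> ip N z (E u i) = 0"
    and ij: "i < n" "j < n"
  shows "ip N (X2 i j u) z
    = (\<Sum>c<n. \<Sum>d<n. ip N (E u i) (e c) * ip N (E u j) (e d) * sff_frame u e z c d)"
proof -
  note fc = tangent_frame_change(2)[OF u e]
  have "(\<Sum>c<n. \<Sum>d<n. ip N (E u i) (e c) * ip N (E u j) (e d) * sff_frame u e z c d)
     = (\<Sum>c<n. \<Sum>d<n. \<Sum>k<n. \<Sum>l<n. (ip N (E u i) (e c) * ip N (e c) (Xup u k))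
          * (ip N (E u j) (e d) * ip N (e d) (Xup u l)) * ip N (X2 k l u) z)"
    unfolding sff_frame_eq[of z u, OF z, simplified] sum_distrib_left by (simp add: ac_simps)
  also have "\<dots> = (\<Sum>k<n. \<Sum>l<n. \<Sum>c<n. \<Sum>d<n. (ip N (E u i) (e c) * ip N (e c) (Xup u k))
          * (ip N (E u j) (e d) * ip N (e d) (Xup u l)) * ip N (X2 k l u) z)"
    unfolding sum4_cartesian
    by (rule sum.reindex_bij_witness[of _ "\<lambda>(k, l, c, d). (c, d, k, l)" "\<lambda>(c, d, k, l). (k, l, c, d)"]) auto
  also have "\<dots> = (\<Sum>k<n. \<Sum>l<n. ((\<Sum>c<n. ip N (E u i) (e c) * ip N (e c) (Xup u k))
          * (\<Sum>d<n. ip N (E u j) (e d) * ip N (e d) (Xup u l))) * ip N (X2 k l u) z)"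
    by (simp only: sum_product) (simp only: sum_distrib_right)
  also have "\<dots> = (\<Sum>k<n. \<Sum>l<n. ((if i = k then 1 else 0) * (if j = l then 1 else 0)) * ip N (X2 k l u) z)"
    using ij by (intro sum.cong refl) (simp add: fc)
  also have "\<dots> = (\<Sum>k<n. (if i = k then 1 else 0) * (\<Sum>l<n. (if j = l then 1 else 0) * ip N (X2 k l u) z))"
    by (simp add: sum_distrib_left mult.assoc)
  also have "\<dots> = ip N (X2 i j u) z" using ij by (simp add: sum_if_eq_mult)
  finally show ?thesis by simp
qed

text \<open>The right-hand side mentions no frame, so the squared norm is the same in all
  orthonormal frames. This allows \<open>sff_norm_sq\<close>, which is defined by an arbitrary
  choice, to be evaluated in frames adapted to the slopes.\<close>

lemma sff_norm_in_frame:
  assumes u: "u \<in> U" and n: "n \<le> N" and e: "tangent_frame N n X u e" and \<nu>: "normal_frame N n X u \<nu>"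
  shows "(\<Sum>\<alpha><N - n. \<Sum>c<n. \<Sum>d<n. (sff_frame u e (\<nu> \<alpha>) c d)\<^sup>2)
    = (\<Sum>i<n. \<Sum>j<n. G u i j * (\<Sum>a<n. \<Sum>c<n. G u a c * ip N (X2 j a u) (sff_coord N n X u i c)))"
proof -
  have \<nu>0: "ip N (\<nu> \<alpha>) (E u i) = 0" if "\<alpha> < N - n" "i < n" for \<alpha> i
    using \<nu> that by (simp add: normal_frame_def)
  define \<eta> where "\<eta> \<alpha> i j = ip N (X2 i j u) (\<nu> \<alpha>)" for \<alpha> i j
  have pair: "ip N (X2 j a u) (sff_coord N n X u i c) = (\<Sum>\<alpha><N - n. \<eta> \<alpha> j a * \<eta> \<alpha> i c)" for i j a c
  proof -
    have "ip N (X2 j a u) (sff_coord N n X u i c)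
        = (\<Sum>\<alpha><N - n. ip N (X2 j a u) (\<nu> \<alpha>) * ip N (\<nu> \<alpha>) (sff_coord N n X u i c))"
      by (rule normal_pairing[OF u n e \<nu> ip_sff_coord_E[OF u]])
    then show ?thesis
      by (simp add: \<eta>_def ip_commute[of N "\<nu> _"] ip_sff_coord_normal[OF \<nu>0])
  qed
  have "(\<Sum>i<n. \<Sum>j<n. G u i j * (\<Sum>a<n. \<Sum>c<n. G u a c * ip N (X2 j a u) (sff_coord N n X u i c)))
      = (\<Sum>i<n. \<Sum>j<n. \<Sum>\<alpha><N - n. G u i j * (\<Sum>a<n. \<Sum>c<n. G u a c * (\<eta> \<alpha> j a * \<eta> \<alpha> i c)))"
  proof (intro sum.cong refl)
    fix i j
    have "(\<Sum>a<n. \<Sum>c<n. G u a c * ip N (X2 j a u) (sff_coord N n X u i c))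
        = (\<Sum>a<n. \<Sum>\<alpha><N - n. \<Sum>c<n. G u a c * (\<eta> \<alpha> j a * \<eta> \<alpha> i c))"
      unfolding pair sum_distrib_left by (rule sum.cong[OF refl], rule sum.swap)
    also have "\<dots> = (\<Sum>\<alpha><N - n. \<Sum>a<n. \<Sum>c<n. G u a c * (\<eta> \<alpha> j a * \<eta> \<alpha> i c))" by (rule sum.swap)
    finally show "G u i j * (\<Sum>a<n. \<Sum>c<n. G u a c * ip N (X2 j a u) (sff_coord N n X u i c))
        = (\<Sum>\<alpha><N - n. G u i j * (\<Sum>a<n. \<Sum>c<n. G u a c * (\<eta> \<alpha> j a * \<eta> \<alpha> i c)))"
      by (simp only: sum_distrib_left)
  qed
  also have "\<dots> = (\<Sum>i<n. \<Sum>\<alpha><N - n. \<Sum>j<n. G u i j * (\<Sum>a<n. \<Sum>c<n. G u a c * (\<eta> \<alpha> j a * \<eta> \<alpha> i c)))"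
    by (rule sum.cong[OF refl], rule sum.swap)
  also have "\<dots> = (\<Sum>\<alpha><N - n. \<Sum>i<n. \<Sum>j<n. G u i j * (\<Sum>a<n. \<Sum>c<n. G u a c * (\<eta> \<alpha> j a * \<eta> \<alpha> i c)))"
    by (rule sum.swap)
  also have "\<dots> = (\<Sum>\<alpha><N - n. \<Sum>c<n. \<Sum>d<n. (sff_frame u e (\<nu> \<alpha>) c d)\<^sup>2)"
  proof (rule sum.cong[OF refl])
    fix \<alpha> assume "\<alpha> \<in> {..<N - n}"
    then have \<alpha>: "\<alpha> < N - n" by simp
    show "(\<Sum>i<n. \<Sum>j<n. G u i j * (\<Sum>a<n. \<Sum>c<n. G u a c * (\<eta> \<alpha> j a * \<eta> \<alpha> i c)))
        = (\<Sum>c<n. \<Sum>d<n. (sff_frame u e (\<nu> \<alpha>) c d)\<^sup>2)"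
      by (rule frame_contract_twice[where R = "\<lambda>i c. ip N (E u i) (e c)" and P = "\<lambda>c i. ip N (e c) (Xup u i)"])
        (simp_all add: metric_inv_frame tangent_frame_change(1)[OF u e] \<eta>_def X2_in_frame[OF u e \<nu>0[OF \<alpha>]])
  qed
  finally show ?thesis by simp
qed

lemma exists_frames:
  assumes u: "u \<in> U" and n: "n \<le> N"
  obtains e \<nu> where "tangent_frame N n X u e" "normal_frame N n X u \<nu>"
proof -
  obtain e where e: "orthonormal N n e" "\<And>i. i < n \<Longrightarrow> \<exists>c. e i = lincomb n c (coord_frame X u)"
    using Gram_Schmidt[OF E_space[OF u] indep[OF u]] by blast
  then have t: "tangent_frame N n X u e" by (simp add: tangent_frame_def)
  obtain b where b: "orthonormal N N b" "\<And>i. i < n \<Longrightarrow> b i = e i"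
    using orthonormal_completion[OF e(1) n] by blast
  have "normal_frame N n X u (\<lambda>\<alpha>. b (n + \<alpha>))"
    unfolding normal_frame_def
  proof (intro conjI allI impI)
    show "orthonormal N (N - n) (\<lambda>\<alpha>. b (n + \<alpha>))" using b(1) by (auto simp: orthonormal_def)
    fix \<alpha> i assume \<alpha>: "\<alpha> < N - n" and i: "i < n"
    have "ip N (b (n + \<alpha>)) (e c) = 0" if "c < n" for c
      using orthonormal_ip[OF b(1), of "n + \<alpha>" c] \<alpha> that n by (simp add: b(2))
    then show "ip N (b (n + \<alpha>)) (E u i) = 0"
      by (subst tangent_frame_change(3)[OF u t i]) (simp add: ip_lincomb_right)
  qed
  then show thesis using that t by blast
qed

lemma sff_norm_sq_eq:
  assumes u: "u \<in> U" and n: "n \<le> N"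
  shows "sff_norm_sq N n X u
    = (\<Sum>i<n. \<Sum>j<n. G u i j * (\<Sum>a<n. \<Sum>c<n. G u a c * ip N (X2 j a u) (sff_coord N n X u i c)))"
proof -
  obtain e \<nu> where "tangent_frame N n X u e" "normal_frame N n X u \<nu>" using exists_frames[OF u n] .
  then have frames: "tangent_frame N n X u (SOME e. tangent_frame N n X u e)"
    "normal_frame N n X u (SOME \<nu>. normal_frame N n X u \<nu>)"
    by (auto intro: someI[of "tangent_frame N n X u"] someI[of "normal_frame N n X u"])
  from sff_norm_in_frame[OF u n frames] show ?thesis
    unfolding sff_norm_sq_def Let_def sff_frame_def by simp
qed

end


subsection \<open>The angle function\<close>

locale chart_angle = immersed_chart +
  fixes f :: "nat \<Rightarrow> vect"
begin

definition wdet :: "vect \<Rightarrow> real" where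
  "wdet x = det (mat n n (\<lambda>(i, j). ip N (E x i) (f j)))"

definition C :: "vect \<Rightarrow> nat \<Rightarrow> nat \<Rightarrow> real" where
  "C x = minv n (\<lambda>i j. ip N (E x i) (f j))"

text \<open>The basis of the span of f that is dual to the coordinate frame, meaningful only if \<open>wdet x \<noteq> 0\<close>.\<close>

definition Fd :: "vect \<Rightarrow> nat \<Rightarrow> vect" where
  "Fd x a = lincomb n (\<lambda>b. C x b a) f"

definition xi :: "vect \<Rightarrow> nat \<Rightarrow> vect" where
  "xi x a = (\<lambda>k. Xup x a k - Fd x a k)"

text \<open>Not an angle: for the orthonormal basis f chosen from \<open>P0\<close> it is
  \<open>v\<close> composed with the Gauss map in the chart, and where positive the reciprocal of
  the product of the cosines of the Jordan angles.\<close>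

definition angle :: "vect \<Rightarrow> real" where
  "angle x = sqrt (det (metric N n X x)) / wdet x"

lemma ip_Fd_right: "ip N y (Fd x a) = (\<Sum>b<n. C x b a * ip N y (f b))"
  by (simp add: Fd_def ip_lincomb_right)

lemma ip_E_Fd:
  assumes "wdet x \<noteq> 0" "a < n" "j < n"
  shows "ip N (E x j) (Fd x a) = (if j = a then 1 else 0)"
  unfolding ip_Fd_right C_def
  using minv_right[of n "\<lambda>i j. ip N (E x i) (f j)" j a] assms by (simp add: wdet_def mult.commute)

lemma ip_xi_E:
  assumes "x \<in> U" "wdet x \<noteq> 0" "a < n" "j < n"
  shows "ip N (xi x a) (E x j) = 0"
  unfolding xi_def ip_diff_left using assms
  by (simp add: ip_Xup_E ip_commute[of N "Fd x a"] ip_E_Fd)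

lemma has_pd_ip_E_const:
  assumes "x \<in> U" "l < n" "i < n"
  shows "has_pd l (\<lambda>x. ip N (E x i) z) (ip N (X2 l i x) z) x"
proof -
  have "has_pd l (\<lambda>x. ip N (E x i) z) (ip N (X2 l i x) z + ip N (E x i) (\<lambda>k. 0)) x"
    using assms by (intro has_pd_ip has_pd_E has_pd_const)
  then show ?thesis by (simp add: ip_def)
qed

text \<open>The vectors f are constant, so only the coefficients \<open>C\<close> vary. The rule for
  inverse matrices keeps the derivative in the span of f and expresses it through the vectors
  \<open>Fd x c\<close> again.\<close>

lemma has_pd_Fd:
  assumes x: "x \<in> U" and w: "wdet x \<noteq> 0" and l: "l < n" and a: "a < n"
  shows "has_pd l (\<lambda>x. Fd x a k) (- (\<Sum>c<n. ip N (X2 l c x) (Fd x a) * Fd x c k)) x"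
proof -
  have C: "has_pd l (\<lambda>x. C x b a) (- (\<Sum>c<n. C x b c * ip N (X2 l c x) (Fd x a))) x" if "b < n" for b
  proof -
    have "has_pd l (\<lambda>x. C x b a) (- (\<Sum>c<n. \<Sum>m<n. C x b c * ip N (X2 l c x) (f m) * C x m a)) x"
      unfolding C_def using a l that w by (intro has_pd_minv has_pd_ip_E_const[OF x]) (auto simp: wdet_def)
    then show ?thesis by (simp add: ip_Fd_right sum_distrib_left ac_simps)
  qed
  have "has_pd l (\<lambda>x. Fd x a k) (\<Sum>b<n. (- (\<Sum>c<n. C x b c * ip N (X2 l c x) (Fd x a))) * f b k + C x b a * 0) x"
    unfolding Fd_def[of _ a] lincomb_def
    by (intro has_pd_sum has_pd_mult has_pd_const) (use C in \<open>auto simp: Fd_def lincomb_def\<close>)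
  also have "(\<Sum>b<n. (- (\<Sum>c<n. C x b c * ip N (X2 l c x) (Fd x a))) * f b k + C x b a * 0)
      = - (\<Sum>b<n. \<Sum>c<n. ip N (X2 l c x) (Fd x a) * (C x b c * f b k))"
    by (simp add: sum_negf sum_distrib_left sum_distrib_right ac_simps)
  also have "\<dots> = - (\<Sum>c<n. ip N (X2 l c x) (Fd x a) * Fd x c k)"
    unfolding Fd_def[of x "_ :: nat"] lincomb_def sum_distrib_left by (subst sum.swap) simp
  finally show ?thesis .
qed

definition dxi :: "nat \<Rightarrow> vect \<Rightarrow> nat \<Rightarrow> vect" where
  "dxi l x a = (\<lambda>k. (\<Sum>b<n. dG l x a b * E x b k + G x a b * X2 l b x k)
                    - - (\<Sum>c<n. ip N (X2 l c x) (Fd x a) * Fd x c k))"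

lemma has_pd_xi:
  assumes "x \<in> U" "wdet x \<noteq> 0" "l < n" "a < n" "k < N"
  shows "has_pd l (\<lambda>x. xi x a k) (dxi l x a k) x"
  unfolding xi_def dxi_def using assms by (intro has_pd_diff has_pd_Xup has_pd_Fd)

definition phi :: "nat \<Rightarrow> vect \<Rightarrow> real" where
  "phi j x = (\<Sum>a<n. ip N (X2 j a x) (xi x a))"

definition dphi :: "nat \<Rightarrow> nat \<Rightarrow> vect \<Rightarrow> real" where
  "dphi i j x = (\<Sum>a<n. ip N (X3 i j a x) (xi x a) + ip N (X2 j a x) (dxi i x a))"

lemma has_pd_phi:
  assumes "x \<in> U" "wdet x \<noteq> 0" "i < n" "j < n"
  shows "has_pd i (phi j) (dphi i j x) x"
  unfolding phi_def[abs_def] dphi_def using assms by (intro has_pd_sum has_pd_ip has_pd_X2 has_pd_xi) auto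

lemma has_pd_wdet:
  assumes x: "x \<in> U" and w: "wdet x \<noteq> 0" and l: "l < n"
  shows "has_pd l wdet (wdet x * (\<Sum>a<n. ip N (X2 l a x) (Fd x a))) x"
proof -
  have "has_pd l wdet (wdet x * (\<Sum>k<n. \<Sum>m<n. C x m k * ip N (X2 l k x) (f m))) x"
    unfolding wdet_def[abs_def] C_def
    using l w by (intro has_pd_det has_pd_ip_E_const[OF x]) (auto simp: wdet_def)
  then show ?thesis by (simp add: ip_Fd_right)
qed

lemma has_pd_angle:
  assumes x: "x \<in> U" and w: "wdet x \<noteq> 0" and l: "l < n"
  shows "has_pd l angle (angle x * phi l x) x"
proof -
  have "has_pd l angle ((sqrt (det (metric N n X x)) * (\<Sum>a<n. ip N (X2 l a x) (Xup x a)) * wdet x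
      - sqrt (det (metric N n X x)) * (wdet x * (\<Sum>a<n. ip N (X2 l a x) (Fd x a)))) / (wdet x * wdet x)) x"
    unfolding angle_def[abs_def]
    by (intro has_pd_divide has_pd_volume[OF x l] has_pd_wdet[OF x w l] w)
  also have "(sqrt (det (metric N n X x)) * (\<Sum>a<n. ip N (X2 l a x) (Xup x a)) * wdet x
      - sqrt (det (metric N n X x)) * (wdet x * (\<Sum>a<n. ip N (X2 l a x) (Fd x a)))) / (wdet x * wdet x)
      = angle x * phi l x"
    using w by (simp add: angle_def phi_def xi_def ip_diff_right sum_subtractf field_simps)
  finally show ?thesis .
qed

section \<open>The Laplacian of the angle function in coordinates\<close>

lemma eventually_regular:
  assumes u: "u \<in> U" and w: "wdet u \<noteq> 0" and i: "i < n"
  shows "\<forall>\<^sub>F t in nhds (u i). u(i := t) \<in> U \<and> wdet (u(i := t)) \<noteq> 0"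
proof (rule eventually_conj[OF eventually_fun_upd_mem[OF openU u i]])
  show "\<forall>\<^sub>F t in nhds (u i). wdet (u(i := t)) \<noteq> 0"
    using has_pd_wdet[OF u w i] w by (intro DERIV_imp_eventually_ne) (auto simp: has_pd_def)
qed

text \<open>The first derivatives of \<open>angle\<close> are \<open>angle * phi\<close>, so its
  second derivatives are \<open>angle\<close> times \<open>phi i * phi j + dphi i j\<close>. The
  formula for the derivatives of h is available where \<open>wdet\<close> is nonzero, hence the flux
  is compared with it only near u.\<close>

lemma laplacian_expansion:
  assumes u: "u \<in> U" and w: "wdet u \<noteq> 0"
    and h: "\<And>x. x \<in> U \<Longrightarrow> h x = angle x"
  shows "laplacian_coord N n X h u = angle u * ((\<Sum>i<n. \<Sum>j<n. G u i j * (phi i u * phi j u))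
     + (\<Sum>j<n. Lap_coeff u j * phi j u) + (\<Sum>i<n. \<Sum>j<n. G u i j * dphi i j u))"
proof -
  define V where "V x = sqrt (det (metric N n X x))" for x
  define \<gamma> where "\<gamma> i = (\<Sum>a<n. ip N (X2 i a u) (Xup u a))" for i
  have V: "V u \<noteq> 0" using det_metric_pos[OF u] by (simp add: V_def)
  have pdh: "pd j h x = angle x * phi j x" if "x \<in> U" "wdet x \<noteq> 0" "j < n" for j x
  proof -
    have "pd j h x = pd j angle x" by (rule pd_cong_on[OF openU that(1,3) h])
    then show ?thesis using has_pd_imp_pd[OF has_pd_angle[OF that]] by simp
  qed
  have flux: "pd i (\<lambda>x. V x * (\<Sum>j<n. G x i j * pd j h x)) u
      = V u * angle u * (\<Sum>j<n. (\<gamma> i * G u i j + dG i u i j) * phi j u + G u i j * (phi i u * phi j u)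
          + G u i j * dphi i j u)" (is "_ = ?d") if i: "i < n" for i
  proof (rule has_pd_imp_pd)
    have "has_pd i (\<lambda>x. V x * (\<Sum>j<n. G x i j * (angle x * phi j x)))
        (V u * \<gamma> i * (\<Sum>j<n. G u i j * (angle u * phi j u)) + V u *
          (\<Sum>j<n. dG i u i j * (angle u * phi j u)
             + G u i j * (angle u * phi i u * phi j u + angle u * dphi i j u))) u"
      unfolding V_def \<gamma>_def using i
      by (intro has_pd_mult has_pd_sum has_pd_volume[OF u] has_pd_metric_inv[OF u] has_pd_angle[OF u w]
          has_pd_phi[OF u w]) auto
    moreover have "V u * \<gamma> i * (\<Sum>j<n. G u i j * (angle u * phi j u)) + V u *
          (\<Sum>j<n. dG i u i j * (angle u * phi j u)
             + G u i j * (angle u * phi i u * phi j u + angle u * dphi i j u)) = ?d"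
      by (simp add: sum_distrib_left sum.distrib[symmetric] algebra_simps)
    moreover have "\<forall>\<^sub>F t in nhds (u i). V (u(i := t)) * (\<Sum>j<n. G (u(i := t)) i j * pd j h (u(i := t)))
        = V (u(i := t)) * (\<Sum>j<n. G (u(i := t)) i j * (angle (u(i := t)) * phi j (u(i := t))))"
      using eventually_regular[OF u w i] by eventually_elim (simp add: pdh)
    ultimately show "has_pd i (\<lambda>x. V x * (\<Sum>j<n. G x i j * pd j h x)) ?d u"
      by (subst has_pd_cong_ev) auto
  qed
  have "laplacian_coord N n X h u = (\<Sum>i<n. pd i (\<lambda>x. V x * (\<Sum>j<n. G x i j * pd j h x)) u) / V u"
    by (simp add: laplacian_coord_def V_def)
  also have "\<dots> = angle u * (\<Sum>i<n. \<Sum>j<n. (\<gamma> i * G u i j + dG i u i j) * phi j u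
      + G u i j * (phi i u * phi j u) + G u i j * dphi i j u)"
    using V by (simp add: flux sum_distrib_left[symmetric])
  also have "(\<Sum>i<n. \<Sum>j<n. (\<gamma> i * G u i j + dG i u i j) * phi j u
      + G u i j * (phi i u * phi j u) + G u i j * dphi i j u)
      = (\<Sum>i<n. \<Sum>j<n. G u i j * (phi i u * phi j u))
        + (\<Sum>i<n. \<Sum>j<n. (\<gamma> i * G u i j + dG i u i j) * phi j u) + (\<Sum>i<n. \<Sum>j<n. G u i j * dphi i j u)"
    by (simp add: sum.distrib)
  also have "(\<Sum>i<n. \<Sum>j<n. (\<gamma> i * G u i j + dG i u i j) * phi j u) = (\<Sum>j<n. Lap_coeff u j * phi j u)"
  proof -
    have "(\<Sum>i<n. \<Sum>j<n. (\<gamma> i * G u i j + dG i u i j) * phi j u)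
        = (\<Sum>j<n. (\<Sum>i<n. \<gamma> i * G u i j + dG i u i j) * phi j u)"
      unfolding sum_distrib_right by (rule sum.swap)
    also have "\<dots> = (\<Sum>j<n. Lap_coeff u j * phi j u)"
      unfolding \<gamma>_def by (intro sum.cong refl) (simp add: Lap_coeff_eq[OF u])
    finally show ?thesis .
  qed
  finally show ?thesis .
qed

text \<open>The basis dual inside the span of f is written as \<open>Xup - xi\<close>. The products
  of two Christoffel symbols then cancel between the derivatives of the two dual bases. There remain
  the normal part of the second derivatives, a term quadratic in \<open>xi\<close>, and mixed terms
  linear in the Christoffel symbols.\<close>

lemma sum_dxi:
  assumes u: "u \<in> U" and w: "wdet u \<noteq> 0" and ij: "i < n" "j < n"
  shows "(\<Sum>a<n. ip N (X2 j a u) (dxi i u a))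
    = (\<Sum>a<n. \<Sum>c<n. G u a c * ip N (X2 j a u) (sff_coord N n X u i c))
      + (\<Sum>a<n. \<Sum>c<n. ip N (X2 i c u) (xi u a) * ip N (X2 j a u) (xi u c))
      - (\<Sum>a<n. \<Sum>c<n. ip N (X2 i c u) (Xup u a) * ip N (X2 j a u) (xi u c)
            + ip N (X2 i c u) (xi u a) * ip N (X2 j a u) (Xup u c))"
proof -
  have Fd: "ip N y (Fd u c) = ip N y (Xup u c) - ip N y (xi u c)" for y c
    by (simp add: xi_def ip_diff_right)
  have "ip N (X2 j a u) (dxi i u a)
    = (\<Sum>c<n. G u a c * ip N (X2 j a u) (sff_coord N n X u i c))
      + (\<Sum>c<n. ip N (X2 i c u) (xi u a) * ip N (X2 j a u) (xi u c))
      - (\<Sum>c<n. ip N (X2 i c u) (Xup u a) * ip N (X2 j a u) (xi u c)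
            + ip N (X2 i c u) (xi u a) * ip N (X2 j a u) (Xup u c))" if a: "a < n" for a
  proof -
    let ?Y = "X2 j a u"
    have "(\<Sum>b<n. dG i u a b * ip N ?Y (E u b))
        = - (\<Sum>b<n. \<Sum>c<n. G u a c * ip N (X2 i c u) (Xup u b) * ip N ?Y (E u b))
          - (\<Sum>b<n. \<Sum>c<n. ip N (X2 i c u) (Xup u a) * G u c b * ip N ?Y (E u b))"
      by (simp add: dG_def algebra_simps sum_distrib_right sum_distrib_left sum_negf sum_subtractf sum.distrib)
    also have "(\<Sum>b<n. \<Sum>c<n. G u a c * ip N (X2 i c u) (Xup u b) * ip N ?Y (E u b))
        = (\<Sum>c<n. G u a c * (\<Sum>b<n. ip N (X2 i c u) (Xup u b) * ip N ?Y (E u b)))"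
      unfolding sum_distrib_left mult.assoc by (rule sum.swap)
    also have "(\<Sum>b<n. \<Sum>c<n. ip N (X2 i c u) (Xup u a) * G u c b * ip N ?Y (E u b))
        = (\<Sum>c<n. ip N (X2 i c u) (Xup u a) * ip N ?Y (Xup u c))"
      unfolding ip_Xup_right[of ?Y] sum_distrib_left mult.assoc by (rule sum.swap)
    finally have 1: "(\<Sum>b<n. dG i u a b * ip N ?Y (E u b))
        = - (\<Sum>c<n. G u a c * (\<Sum>b<n. ip N (X2 i c u) (Xup u b) * ip N ?Y (E u b)))
          - (\<Sum>c<n. ip N (X2 i c u) (Xup u a) * ip N ?Y (Xup u c))" .
    have 2: "ip N ?Y (sff_coord N n X u i c)
        = ip N ?Y (X2 i c u) - (\<Sum>b<n. ip N (X2 i c u) (Xup u b) * ip N ?Y (E u b))" for c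
      by (simp add: sff_coord_eq ip_linear_right)
    have "ip N ?Y (dxi i u a) = (\<Sum>b<n. dG i u a b * ip N ?Y (E u b)) + (\<Sum>c<n. G u a c * ip N ?Y (X2 i c u))
        + (\<Sum>c<n. ip N (X2 i c u) (Fd u a) * ip N ?Y (Fd u c))"
      by (simp add: dxi_def ip_linear_right sum.distrib)
    also have "\<dots> = (\<Sum>c<n. G u a c * ip N ?Y (sff_coord N n X u i c))
        + (\<Sum>c<n. ip N (X2 i c u) (Fd u a) * ip N ?Y (Fd u c) - ip N (X2 i c u) (Xup u a) * ip N ?Y (Xup u c))"
      unfolding 1 2 by (simp add: right_diff_distrib sum_subtractf)
    also have "\<dots> = (\<Sum>c<n. G u a c * ip N ?Y (sff_coord N n X u i c))
        + (\<Sum>c<n. ip N (X2 i c u) (xi u a) * ip N ?Y (xi u c)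
            - (ip N (X2 i c u) (Xup u a) * ip N ?Y (xi u c) + ip N (X2 i c u) (xi u a) * ip N ?Y (Xup u c)))"
      unfolding Fd by (simp add: algebra_simps)
    finally show ?thesis by (simp add: sum_subtractf)
  qed
  then show ?thesis by (simp add: sum.distrib sum_subtractf)
qed

text \<open>Parallel mean curvature exchanges the third derivatives and the first order part of the
  Laplacian for terms linear in the Christoffel symbols, and these cancel the mixed terms of
  \<open>sum_dxi\<close>. The first remaining sum is the squared gradient of the logarithm of
  \<open>angle\<close>, the second the squared norm of the second fundamental form.\<close>

lemma laplacian_angle:
  assumes u: "u \<in> U" and w: "wdet u \<noteq> 0" and n: "0 < n"
    and h: "\<And>x. x \<in> U \<Longrightarrow> h x = angle x"
    and parallel: "\<And>a k. a < n \<Longrightarrow> k < N \<Longrightarrow> normal_deriv_H N n X u a k = 0"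
  shows "laplacian_coord N n X h u = angle u * ((\<Sum>i<n. \<Sum>j<n. G u i j * (phi i u * phi j u))
     + (\<Sum>i<n. \<Sum>j<n. G u i j * (\<Sum>a<n. \<Sum>c<n. G u a c * ip N (X2 j a u) (sff_coord N n X u i c)))
     + (\<Sum>i<n. \<Sum>j<n. G u i j * (\<Sum>a<n. \<Sum>c<n. ip N (X2 i c u) (xi u a) * ip N (X2 j a u) (xi u c))))"
proof -
  define y where "y i j a = ip N (X2 i j u) (xi u a)" for i j a
  define \<Gamma> where "\<Gamma> i j a = ip N (X2 i j u) (Xup u a)" for i j a
  have sym: "ip N (X2 i j u) z = ip N (X2 j i u) z" if "i < n" "j < n" for i j z
    using X2_sym[OF u that] by (intro ip_cong) auto
  \<comment> \<open>The condition on the mean curvature is tested against the normal vector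
    \<open>xi u a\<close> for each a, and the results are added up afterwards.\<close>
  have "(\<Sum>i<n. \<Sum>j<n. dG a u i j * y i j a) + (\<Sum>i<n. \<Sum>j<n. G u i j * ip N (X3 i j a u) (xi u a))
     + (\<Sum>l<n. Lap_coeff u l * y l a a) = 0" if a: "a < n" for a
  proof -
    have "ip N (X3 i j a u) (xi u a) = ip N (xi u a) (X3 a i j u)" if "i < n" "j < n" for i j
      unfolding ip_commute[of N "X3 i j a u"] using X3_sym[OF u that a] by (intro ip_cong) auto
    then have 3: "(\<Sum>i<n. \<Sum>j<n. G u i j * ip N (X3 i j a u) (xi u a))
        = (\<Sum>i<n. \<Sum>j<n. G u i j * ip N (xi u a) (X3 a i j u))" by simp
    have 2: "(\<Sum>l<n. Lap_coeff u l * y l a a) = (\<Sum>l<n. Lap_coeff u l * ip N (xi u a) (X2 a l u))"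
      unfolding y_def using sym a by (intro sum.cong refl) (simp add: ip_commute[of N "xi u a"])
    have 1: "(\<Sum>i<n. \<Sum>j<n. dG a u i j * y i j a) = (\<Sum>i<n. \<Sum>j<n. dG a u i j * ip N (xi u a) (X2 i j u))"
      by (simp add: y_def ip_commute[of N "xi u a"])
    show ?thesis unfolding 1 2 3
      using a by (intro parallel_mean_curvature_third_derivatives u n parallel ip_xi_E w)
  qed
  then have "(\<Sum>a<n. (\<Sum>i<n. \<Sum>j<n. dG a u i j * y i j a) + (\<Sum>i<n. \<Sum>j<n. G u i j * ip N (X3 i j a u) (xi u a))
     + (\<Sum>l<n. Lap_coeff u l * y l a a)) = 0" by simp
  moreover have "(\<Sum>a<n. \<Sum>l<n. Lap_coeff u l * y l a a) = (\<Sum>l<n. Lap_coeff u l * phi l u)"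
    unfolding phi_def y_def sum_distrib_left by (rule sum.swap)
  moreover have "(\<Sum>a<n. \<Sum>i<n. \<Sum>j<n. G u i j * ip N (X3 i j a u) (xi u a))
      = (\<Sum>i<n. \<Sum>j<n. G u i j * (\<Sum>a<n. ip N (X3 i j a u) (xi u a)))"
    unfolding sum_distrib_left by (subst sum.swap, rule sum.cong[OF refl], rule sum.swap)
  moreover have "(\<Sum>a<n. \<Sum>i<n. \<Sum>j<n. dG a u i j * y i j a)
      = - (\<Sum>i<n. \<Sum>j<n. G u i j * (\<Sum>a<n. \<Sum>c<n. \<Gamma> i c a * y j a c + y i c a * \<Gamma> j a c))"
  proof -
    have "(\<Sum>a<n. \<Sum>i<n. \<Sum>j<n. dG a u i j * y i j a)
        = - (\<Sum>a<n. \<Sum>i<n. \<Sum>j<n. ((\<Sum>c<n. G u i c * \<Gamma> a c j) + (\<Sum>c<n. \<Gamma> a c i * G u c j)) * y i j a)"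
      by (simp only: dG_def \<Gamma>_def minus_mult_left[symmetric] sum_negf)
    also have "(\<Sum>a<n. \<Sum>i<n. \<Sum>j<n. ((\<Sum>c<n. G u i c * \<Gamma> a c j) + (\<Sum>c<n. \<Gamma> a c i * G u c j)) * y i j a)
        = (\<Sum>i<n. \<Sum>j<n. G u i j * (\<Sum>a<n. \<Sum>c<n. \<Gamma> i c a * y j a c + y i c a * \<Gamma> j a c))"
      by (rule Christoffel_terms_cancel) (auto simp: \<Gamma>_def y_def sym metric_inv_sym[OF u])
    finally show ?thesis .
  qed
  ultimately have third: "(\<Sum>l<n. Lap_coeff u l * phi l u) + (\<Sum>i<n. \<Sum>j<n. G u i j * (\<Sum>a<n. ip N (X3 i j a u) (xi u a)))
      = (\<Sum>i<n. \<Sum>j<n. G u i j * (\<Sum>a<n. \<Sum>c<n. \<Gamma> i c a * y j a c + y i c a * \<Gamma> j a c))"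
    by (simp add: sum.distrib)
  have "(\<Sum>i<n. \<Sum>j<n. G u i j * dphi i j u)
      = (\<Sum>i<n. \<Sum>j<n. G u i j * (\<Sum>a<n. ip N (X3 i j a u) (xi u a)))
        + ((\<Sum>i<n. \<Sum>j<n. G u i j * (\<Sum>a<n. \<Sum>c<n. G u a c * ip N (X2 j a u) (sff_coord N n X u i c)))
        + (\<Sum>i<n. \<Sum>j<n. G u i j * (\<Sum>a<n. \<Sum>c<n. y i c a * y j a c))
        - (\<Sum>i<n. \<Sum>j<n. G u i j * (\<Sum>a<n. \<Sum>c<n. \<Gamma> i c a * y j a c + y i c a * \<Gamma> j a c)))"
  proof -
    have "(\<Sum>i<n. \<Sum>j<n. G u i j * dphi i j u)
      = (\<Sum>i<n. \<Sum>j<n. G u i j * (\<Sum>a<n. ip N (X3 i j a u) (xi u a))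
        + (G u i j * (\<Sum>a<n. \<Sum>c<n. G u a c * ip N (X2 j a u) (sff_coord N n X u i c))
        + G u i j * (\<Sum>a<n. \<Sum>c<n. y i c a * y j a c)
        - G u i j * (\<Sum>a<n. \<Sum>c<n. \<Gamma> i c a * y j a c + y i c a * \<Gamma> j a c)))"
    proof (intro sum.cong refl)
      fix i j assume "i \<in> {..<n}" "j \<in> {..<n}"
      then have "dphi i j u = (\<Sum>a<n. ip N (X3 i j a u) (xi u a))
        + ((\<Sum>a<n. \<Sum>c<n. G u a c * ip N (X2 j a u) (sff_coord N n X u i c))
        + (\<Sum>a<n. \<Sum>c<n. y i c a * y j a c)
        - (\<Sum>a<n. \<Sum>c<n. \<Gamma> i c a * y j a c + y i c a * \<Gamma> j a c))"
        unfolding dphi_def sum.distrib[of "\<lambda>a. ip N (X3 i j a u) (xi u a)"] y_def \<Gamma>_def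
        using sum_dxi[OF u w, of i j] by simp
      then show "G u i j * dphi i j u = G u i j * (\<Sum>a<n. ip N (X3 i j a u) (xi u a))
        + (G u i j * (\<Sum>a<n. \<Sum>c<n. G u a c * ip N (X2 j a u) (sff_coord N n X u i c))
        + G u i j * (\<Sum>a<n. \<Sum>c<n. y i c a * y j a c)
        - G u i j * (\<Sum>a<n. \<Sum>c<n. \<Gamma> i c a * y j a c + y i c a * \<Gamma> j a c))"
        by (simp only: distrib_left right_diff_distrib)
    qed
    then show ?thesis by (simp only: sum.distrib sum_subtractf)
  qed
  then have contracted: "(\<Sum>l<n. Lap_coeff u l * phi l u) + (\<Sum>i<n. \<Sum>j<n. G u i j * dphi i j u)
      = (\<Sum>i<n. \<Sum>j<n. G u i j * (\<Sum>a<n. \<Sum>c<n. G u a c * ip N (X2 j a u) (sff_coord N n X u i c)))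
        + (\<Sum>i<n. \<Sum>j<n. G u i j * (\<Sum>a<n. \<Sum>c<n. y i c a * y j a c))"
    using third by linarith
  have "laplacian_coord N n X h u = angle u * ((\<Sum>i<n. \<Sum>j<n. G u i j * (phi i u * phi j u))
     + ((\<Sum>j<n. Lap_coeff u j * phi j u) + (\<Sum>i<n. \<Sum>j<n. G u i j * dphi i j u)))"
    using laplacian_expansion[OF u w, of h] h by (simp only: add.assoc)
  then show ?thesis unfolding contracted y_def by (simp only: add.assoc)
qed

text \<open>
  For orthonormal frames e and \<open>\<nu>\<close> these are, up to sign, the entries of the matrix of the linear map
  from the tangent space to the normal space whose graph is the span of f.
\<close>

definition slope :: "vect \<Rightarrow> (nat \<Rightarrow> vect) \<Rightarrow> vect \<Rightarrow> nat \<Rightarrow> real" where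
  "slope u e z d = (\<Sum>i<n. ip N (E u i) (e d) * ip N (xi u i) z)"

text \<open>\<open>Q\<close> collects the pairings of the second derivatives with \<open>xi\<close>,
  all indices moved to the frames: \<open>normal_pairing\<close> resolves \<open>xi\<close> along
  \<nu>, and \<open>slope\<close> turns its dual index into a frame index.\<close>

lemma laplacian_in_frame:
  assumes u: "u \<in> U" and w: "wdet u \<noteq> 0" and n: "0 < n" "n \<le> N"
    and h: "\<And>x. x \<in> U \<Longrightarrow> h x = angle x"
    and parallel: "\<And>a k. a < n \<Longrightarrow> k < N \<Longrightarrow> normal_deriv_H N n X u a k = 0"
    and e: "tangent_frame N n X u e" and \<nu>: "normal_frame N n X u \<nu>"
  defines "b \<equiv> \<lambda>\<alpha>. sff_frame u e (\<nu> \<alpha>)"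
    and "Q \<equiv> \<lambda>c d e'. \<Sum>\<alpha><N - n. sff_frame u e (\<nu> \<alpha>) c d * slope u e (\<nu> \<alpha>) e'"
  shows "laplacian_coord N n X h u = angle u * ((\<Sum>\<alpha><N - n. \<Sum>c<n. \<Sum>d<n. (b \<alpha> c d)\<^sup>2)
     + (\<Sum>c<n. (\<Sum>d<n. Q c d d)\<^sup>2) + (\<Sum>c<n. \<Sum>d<n. \<Sum>e<n. Q c d e * Q c e d))"
proof -
  define R where "R i c = ip N (E u i) (e c)" for i c
  define q where "q c d a = (\<Sum>\<alpha><N - n. b \<alpha> c d * ip N (\<nu> \<alpha>) (xi u a))" for c d a
  define y where "y i j a = ip N (X2 i j u) (xi u a)" for i j a
  have \<nu>0: "ip N (\<nu> \<alpha>) (E u i) = 0" if "\<alpha> < N - n" "i < n" for \<alpha> i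
    using \<nu> that by (simp add: normal_frame_def)
  have y: "y i j a = (\<Sum>c<n. \<Sum>d<n. R i c * R j d * q c d a)" if ij: "i < n" "j < n" and a: "a < n" for i j a
  proof -
    have "y i j a = (\<Sum>\<alpha><N - n. ip N (X2 i j u) (\<nu> \<alpha>) * ip N (\<nu> \<alpha>) (xi u a))"
      unfolding y_def using a by (intro normal_pairing[OF u n(2) e \<nu>] ip_xi_E[OF u w])
    also have "\<dots> = (\<Sum>\<alpha><N - n. \<Sum>c<n. \<Sum>d<n. R i c * R j d * (b \<alpha> c d * ip N (\<nu> \<alpha>) (xi u a)))"
    proof (rule sum.cong[OF refl])
      fix \<alpha> assume "\<alpha> \<in> {..<N - n}"
      then have "ip N (X2 i j u) (\<nu> \<alpha>) = (\<Sum>c<n. \<Sum>d<n. R i c * R j d * b \<alpha> c d)"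
        unfolding R_def b_def using \<nu>0 ij by (intro X2_in_frame[OF u e]) auto
      then show "ip N (X2 i j u) (\<nu> \<alpha>) * ip N (\<nu> \<alpha>) (xi u a)
          = (\<Sum>c<n. \<Sum>d<n. R i c * R j d * (b \<alpha> c d * ip N (\<nu> \<alpha>) (xi u a)))"
        by (simp add: sum_distrib_right mult.assoc)
    qed
    also have "\<dots> = (\<Sum>c<n. \<Sum>d<n. \<Sum>\<alpha><N - n. R i c * R j d * (b \<alpha> c d * ip N (\<nu> \<alpha>) (xi u a)))"
      by (subst sum.swap, rule sum.cong[OF refl], rule sum.swap)
    finally show ?thesis by (simp add: q_def sum_distrib_left)
  qed
  have Q: "(\<Sum>a<n. R a e' * q c d a) = Q c d e'" for c d e'
  proof -
    have "(\<Sum>a<n. R a e' * q c d a) = (\<Sum>\<alpha><N - n. \<Sum>a<n. R a e' * (b \<alpha> c d * ip N (\<nu> \<alpha>) (xi u a)))"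
      unfolding q_def sum_distrib_left by (rule sum.swap)
    then show ?thesis
      by (simp add: Q_def slope_def b_def R_def sum_distrib_left mult.left_commute ip_commute[of N "\<nu> _"])
  qed
  have PR: "(\<Sum>i<n. ip N (e a) (Xup u i) * R i c) = (if a = c then 1 else 0)" if "a < n" "c < n" for a c
    unfolding R_def by (rule tangent_frame_change(1)[OF u e that])
  have GR: "(\<Sum>j<n. G u i j * R j c) = ip N (e c) (Xup u i)" for i c
    unfolding R_def by (rule metric_inv_frame)
  note tr = frame_contract_trace[where G = "G u" and R = R and P = "\<lambda>c i. ip N (e c) (Xup u i)" and q = q and y = y
      and n = n, unfolded Q, OF GR PR y]
  have phi: "phi i u = (\<Sum>a<n. y i a a)" for i by (simp add: phi_def y_def)
  have "(\<Sum>i<n. \<Sum>j<n. G u i j * (phi i u * phi j u)) = (\<Sum>c<n. (\<Sum>d<n. Q c d d)\<^sup>2)"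
    unfolding phi by (rule tr(1))
  moreover have "(\<Sum>i<n. \<Sum>j<n. G u i j * (\<Sum>a<n. \<Sum>c<n. ip N (X2 i c u) (xi u a) * ip N (X2 j a u) (xi u c)))
      = (\<Sum>c<n. \<Sum>d<n. \<Sum>e<n. Q c d e * Q c e d)"
    unfolding y_def[symmetric] by (rule tr(2))
  moreover note sff_norm_in_frame[OF u n(2) e \<nu>, folded b_def]
  ultimately show ?thesis
    using laplacian_angle[OF u w n(1) h parallel] by (simp add: b_def)
qed

section \<open>Jordan angles\<close>

lemma slope_rotated:
  "slope u (\<lambda>a. lincomb n (V a) e) (lincomb m (W \<alpha>) \<nu>) d
    = (\<Sum>k<m. \<Sum>l<n. W \<alpha> k * slope u e (\<nu> k) l * V d l)"
proof -
  have "slope u (\<lambda>a. lincomb n (V a) e) (lincomb m (W \<alpha>) \<nu>) d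
     = (\<Sum>i<n. \<Sum>l<n. \<Sum>k<m. W \<alpha> k * (ip N (E u i) (e l) * ip N (xi u i) (\<nu> k)) * V d l)"
    by (simp add: slope_def ip_lincomb_right sum_product ac_simps)
  also have "\<dots> = (\<Sum>l<n. \<Sum>k<m. \<Sum>i<n. W \<alpha> k * (ip N (E u i) (e l) * ip N (xi u i) (\<nu> k)) * V d l)"
    by (subst sum.swap, rule sum.cong[OF refl], rule sum.swap)
  also have "\<dots> = (\<Sum>k<m. \<Sum>l<n. \<Sum>i<n. W \<alpha> k * (ip N (E u i) (e l) * ip N (xi u i) (\<nu> k)) * V d l)"
    by (rule sum.swap)
  finally show ?thesis by (simp add: slope_def sum_distrib_left sum_distrib_right)
qed

text \<open>The frames that diagonalise the slopes realise the Jordan angles between the two subspaces.\<close>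

lemma exists_Jordan_frames:
  assumes u: "u \<in> U" and n: "n \<le> N"
  obtains e \<nu> where "tangent_frame N n X u e" "normal_frame N n X u \<nu>"
    "\<And>\<alpha> d. \<alpha> < N - n \<Longrightarrow> d < n \<Longrightarrow> \<alpha> \<noteq> d \<Longrightarrow> slope u e (\<nu> \<alpha>) d = 0"
proof -
  obtain e \<nu> where e: "tangent_frame N n X u e" and \<nu>: "normal_frame N n X u \<nu>"
    using exists_frames[OF u n] .
  obtain W V where W: "W \<in> orthogonal_matrices (N - n)" and V: "V \<in> orthogonal_matrices n"
    and diag: "\<And>i j. i < N - n \<Longrightarrow> j < n \<Longrightarrow> i \<noteq> j \<Longrightarrow>
      (\<Sum>k<N - n. \<Sum>l<n. W i k * slope u e (\<nu> k) l * V j l) = 0"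
    using singular_value_decomposition[where Z = "\<lambda>k l. slope u e (\<nu> k) l" and m = "N - n" and n = n] by blast
  show thesis
  proof (rule that)
    show "tangent_frame N n X u (\<lambda>a. lincomb n (V a) e)"
      unfolding tangent_frame_def
    proof (intro conjI allI impI)
      show "orthonormal N n (\<lambda>a. lincomb n (V a) e)"
        by (rule rotated_frame_orthonormal[OF tangent_frame_orthonormal[OF e] V])
      fix a assume "a < n"
      have "lincomb n (V a) e = lincomb n (V a) (\<lambda>c. lincomb n (\<lambda>i. ip N (e c) (Xup u i)) (coord_frame X u))"
        unfolding lincomb_def[of n "V a"]
        by (intro ext sum.cong refl arg_cong2[where f = "(*)"] fun_cong[OF tangent_frame_expansion[OF u e]]) simp
      then have "lincomb n (V a) e
          = lincomb n (\<lambda>j. \<Sum>i<n. V a i * ip N (e i) (Xup u j)) (coord_frame X u)"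
        by (simp only: lincomb_lincomb)
      then show "\<exists>c. lincomb n (V a) e = lincomb n c (coord_frame X u)"
        by (rule exI[of _ "\<lambda>j. \<Sum>i<n. V a i * ip N (e i) (Xup u j)"])
    qed
    show "normal_frame N n X u (\<lambda>\<alpha>. lincomb (N - n) (W \<alpha>) \<nu>)"
      using \<nu> rotated_frame_orthonormal[OF _ W, of N \<nu>] by (simp add: normal_frame_def ip_lincomb_left)
    show "slope u (\<lambda>a. lincomb n (V a) e) (lincomb (N - n) (W \<alpha>) \<nu>) d = 0"
      if "\<alpha> < N - n" "d < n" "\<alpha> \<noteq> d" for \<alpha> d
      unfolding slope_rotated by (rule diag[OF that])
  qed
qed

text \<open>One Gram determinant is evaluated twice. The vectors \<open>F d\<close> in the span of f
  have tangential part \<open>e d\<close> and normal components minus the slopes, so their Gram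
  matrix is diagonal and its determinant is the product. In the orthonormal basis f the same
  determinant is the square of \<open>det K\<close>, and K is inverse to the matrix of the
  \<open>ip N (f b) (e c)\<close>, whose determinant is up to sign the reciprocal of
  \<open>angle u\<close>.\<close>

lemma angle_eq_prod:
  assumes u: "u \<in> U" and w: "wdet u \<noteq> 0" and n: "n \<le> N" and f: "orthonormal N n f"
    and e: "tangent_frame N n X u e" and \<nu>: "normal_frame N n X u \<nu>"
    and diag: "\<And>\<alpha> d. \<alpha> < N - n \<Longrightarrow> d < n \<Longrightarrow> \<alpha> \<noteq> d \<Longrightarrow> slope u e (\<nu> \<alpha>) d = 0"
  shows "(\<Prod>d<n. 1 + (if d < N - n then slope u e (\<nu> d) d else 0)\<^sup>2) = (angle u)\<^sup>2"
proof -
  define R where "R i c = ip N (E u i) (e c)" for i c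
  define F where "F d = lincomb n (\<lambda>i. R i d) (Fd u)" for d
  define K where "K d b = (\<Sum>i<n. R i d * C u b i)" for d b
  have oe: "orthonormal N n e" by (rule tangent_frame_orthonormal[OF e])
  have F_eq: "F d = lincomb n (K d) f" for d
    unfolding F_def Fd_def[abs_def] lincomb_lincomb K_def ..
  have Fe: "ip N (F d) (e c) = (if d = c then 1 else 0)" if "d < n" "c < n" for c d
  proof -
    have "ip N (Fd u i) (e c) = ip N (e c) (Xup u i)" if "i < n" for i
    proof -
      have "ip N (Fd u i) (e c) = (\<Sum>j<n. ip N (e c) (Xup u j) * (if j = i then 1 else 0))"
        by (subst tangent_frame_expansion[OF u e \<open>c < n\<close>])
          (use that in \<open>simp add: ip_lincomb_right ip_commute[of N "Fd u i"] ip_E_Fd[OF w] cong: sum.cong_simp\<close>)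
      then show ?thesis using that by (simp add: sum_if_eq_mult)
    qed
    then have "ip N (F d) (e c) = (\<Sum>i<n. ip N (e c) (Xup u i) * R i d)"
      by (simp add: F_def ip_lincomb_left mult.commute cong: sum.cong_simp)
    then show ?thesis
      using tangent_frame_change(1)[OF u e \<open>c < n\<close> \<open>d < n\<close>] by (simp add: R_def eq_commute[of c d])
  qed
  have F\<nu>: "ip N (F d) (\<nu> \<alpha>) = - slope u e (\<nu> \<alpha>) d" if "\<alpha> < N - n" for d \<alpha>
  proof -
    have "ip N (Xup u i) (\<nu> \<alpha>) = 0" for i
      using \<nu> that unfolding Xup_def
      by (simp add: ip_lincomb_left ip_commute[of N "E u _"] normal_frame_def)
    then have "ip N (Fd u i) (\<nu> \<alpha>) = - ip N (xi u i) (\<nu> \<alpha>)" for i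
      by (simp add: xi_def ip_diff_left)
    then show ?thesis by (simp add: F_def slope_def ip_lincomb_left R_def sum_negf)
  qed
  have gram: "ip N (F c) (F d) = (if c = d then 1 + (if d < N - n then slope u e (\<nu> d) d else 0)\<^sup>2 else 0)"
    if cd: "c < n" "d < n" for c d
  proof -
    have "ip N (F c) (F d) = (\<Sum>i<n. ip N (F c) (e i) * ip N (e i) (F d))
        + (\<Sum>\<alpha><N - n. ip N (F c) (\<nu> \<alpha>) * ip N (\<nu> \<alpha>) (F d))"
      using \<nu> by (intro Parseval_split n oe tangent_normal_orthogonal[OF u e \<nu>]) (auto simp: normal_frame_def)
    also have "(\<Sum>i<n. ip N (F c) (e i) * ip N (e i) (F d)) = (\<Sum>i<n. ip N (F c) (e i) * (if i = d then 1 else 0))"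
      using cd by (intro sum.cong refl) (simp add: ip_commute[of N "e _"] Fe eq_commute[of d])
    also have "\<dots> = (if c = d then 1 else 0)" using cd by (simp add: sum_if_eq_mult Fe)
    also have "(\<Sum>\<alpha><N - n. ip N (F c) (\<nu> \<alpha>) * ip N (\<nu> \<alpha>) (F d))
        = (\<Sum>\<alpha><N - n. slope u e (\<nu> \<alpha>) c * slope u e (\<nu> \<alpha>) d)"
      by (intro sum.cong refl) (simp add: ip_commute[of N "\<nu> _"] F\<nu>)
    also have "\<dots> = (\<Sum>\<alpha><N - n. if \<alpha> = d then slope u e (\<nu> \<alpha>) c * slope u e (\<nu> \<alpha>) d else 0)"
      using diag[OF _ cd(2)] by (intro sum.cong refl) auto
    also have "\<dots> = (if d < N - n then slope u e (\<nu> d) c * slope u e (\<nu> d) d else 0)"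
      by simp
    finally show ?thesis using diag[of d c] cd by (auto simp: power2_eq_square)
  qed
  have "(\<Prod>d<n. 1 + (if d < N - n then slope u e (\<nu> d) d else 0)\<^sup>2) = det (mat n n (\<lambda>(c, d). ip N (F c) (F d)))"
  proof -
    have "mat n n (\<lambda>(c, d). ip N (F c) (F d))
        = mat n n (\<lambda>(c, d). if c = d then 1 + (if c < N - n then slope u e (\<nu> c) c else 0)\<^sup>2 else 0)"
      by (rule mat_cong) (auto simp: gram)
    then show ?thesis by (simp only: det_diagonal_entries)
  qed
  also have "mat n n (\<lambda>(c, d). ip N (F c) (F d)) = mat n n (\<lambda>(c, d). \<Sum>b<n. K c b * K d b)"
  proof (rule mat_cong)
    fix c d
    have "ip N (F c) (F d) = (\<Sum>b<n. K c b * ip N (f b) (F d))"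
      unfolding F_eq[of c] by (rule ip_lincomb_left)
    also have "\<dots> = (\<Sum>b<n. K c b * K d b)"
      by (rule sum.cong[OF refl])
        (simp add: F_eq[of d] ip_lincomb_right orthonormal_ip[OF f] sum_if_eq_mult cong: sum.cong_simp)
    finally show "ip N (F c) (F d) = (\<Sum>b<n. K c b * K d b)" .
  qed
  also have "det \<dots> = (det (mat n n (\<lambda>(c, b). K c b)))\<^sup>2"
    unfolding det_mult_entries det_transpose_entries[of n K] by (simp add: power2_eq_square)
  also have "\<dots> = (angle u)\<^sup>2"
  proof -
    let ?K = "det (mat n n (\<lambda>(c, b). K c b))" and ?R = "det (mat n n (\<lambda>(i, c). ip N (E u i) (e c)))"
    let ?W = "det (mat n n (\<lambda>(c, b). ip N (e c) (f b)))"
    have "?K * det (mat n n (\<lambda>(b, c). ip N (f b) (e c))) = 1"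
    proof (rule det_nonzero_if_left_inverse)
      fix d c assume dc: "d < n" "c < n"
      have "(\<Sum>b<n. K d b * ip N (f b) (e c)) = ip N (F d) (e c)" unfolding F_eq by (simp add: ip_lincomb_left)
      then show "(\<Sum>b<n. K d b * ip N (f b) (e c)) = (if d = c then 1 else 0)" by (simp add: Fe[OF dc])
    qed
    then have KW: "?K * ?W = 1"
      using det_transpose_entries[of n "\<lambda>c b. ip N (e c) (f b)"] by (simp add: ip_commute)
    have "wdet u = ?R * ?W"
      unfolding wdet_def by (rule det_change_of_frame[OF oe tangent_frame_expansion[OF u e]])
    moreover have "det (metric N n X u) = ?R\<^sup>2"
      unfolding metric_eq by (rule Gram_determinant_frame[OF oe tangent_frame_expansion[OF u e]])
    ultimately have "(angle u)\<^sup>2 = ?R\<^sup>2 / (?R * ?W)\<^sup>2" "?R * ?W \<noteq> 0"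
      using w by (simp_all add: angle_def power_divide)
    then have "(angle u)\<^sup>2 = (1 / ?W)\<^sup>2" by (simp add: power_mult_distrib power_divide)
    also have "1 / ?W = ?K" using KW \<open>?R * ?W \<noteq> 0\<close> by (simp add: field_simps)
    finally show ?thesis by simp
  qed
  finally show ?thesis .
qed

lemma laplacian_lower_bound:
  assumes u: "u \<in> U" and w: "0 < wdet u" and n: "0 < n" "n \<le> N" and f: "orthonormal N n f"
    and h: "\<And>x. x \<in> U \<Longrightarrow> h x = angle x"
    and parallel: "\<And>a k. a < n \<Longrightarrow> k < N \<Longrightarrow> normal_deriv_H N n X u a k = 0"
    and s: "1 \<le> s" and le: "((angle u)\<^sup>2) powr s \<le> 9"
  shows "(1 - 1 / s) * sff_norm_sq N n X u \<le> laplacian_coord N n X h u"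
proof -
  have w0: "wdet u \<noteq> 0" using w by simp
  obtain e \<nu> where e: "tangent_frame N n X u e" and \<nu>: "normal_frame N n X u \<nu>"
    and diag: "\<And>\<alpha> d. \<alpha> < N - n \<Longrightarrow> d < n \<Longrightarrow> \<alpha> \<noteq> d \<Longrightarrow> slope u e (\<nu> \<alpha>) d = 0"
    using exists_Jordan_frames[OF u n(2)] by blast
  \<comment> \<open>If N - n is smaller than n, the large indices d have no normal vector; their
    tangent is set to 0, and \<open>k\<close> is padded in the same way.\<close>
  define \<theta> where "\<theta> d = (if d < N - n then slope u e (\<nu> d) d else 0)" for d
  define b where "b \<alpha> = sff_frame u e (\<nu> \<alpha>)" for \<alpha>
  define k where "k j c d = (if j < N - n then b j c d else 0)" for j c d
  define B where "B = (\<Sum>\<alpha><N - n. \<Sum>c<n. \<Sum>d<n. (b \<alpha> c d)\<^sup>2)"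
  define S where "S = (\<Sum>j<n. \<Sum>c<n. \<Sum>d<n. (k j c d)\<^sup>2)"
  define T where "T = (\<Sum>c<n. (\<Sum>d<n. \<theta> d * k d c d)\<^sup>2)
     + (\<Sum>c<n. \<Sum>d<n. \<Sum>e<n. \<theta> e * \<theta> d * (k e c d * k d c e))"
  have prod: "(\<Prod>d<n. 1 + (\<theta> d)\<^sup>2) = (angle u)\<^sup>2"
    unfolding \<theta>_def by (rule angle_eq_prod[OF u w0 n(2) f e \<nu> diag])
  have pos: "0 < angle u" using w det_metric_pos[OF u] by (simp add: angle_def)
  have "1 \<le> (angle u)\<^sup>2" unfolding prod[symmetric] by (intro prod_ge_1) simp
  then have ge1: "1 \<le> angle u" using pos by (metis one_power2 power2_le_imp_le less_imp_le)
  have B: "sff_norm_sq N n X u = B"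
    unfolding sff_norm_sq_eq[OF u n(2)] B_def b_def by (rule sff_norm_in_frame[OF u n(2) e \<nu>, symmetric])
  \<comment> \<open>If N - n is larger than n, the normal directions from n on are missing in
    \<open>S\<close>. Their slopes vanish, so they enter the Laplacian only through
    \<open>B\<close>, with coefficient 1, which is more than 1 - 1/s.\<close>
  have SB: "S \<le> B"
  proof -
    have "S = (\<Sum>j\<in>{..<n} \<inter> {..<N - n}. \<Sum>c<n. \<Sum>d<n. (b j c d)\<^sup>2)"
      unfolding S_def by (rule sum.mono_neutral_cong_right) (auto simp: k_def)
    also have "\<dots> \<le> B" unfolding B_def by (intro sum_mono2) (auto intro!: sum_nonneg)
    finally show ?thesis .
  qed
  have Q: "(\<Sum>\<alpha><N - n. b \<alpha> c d * slope u e (\<nu> \<alpha>) a) = \<theta> a * k a c d" if "a < n" for a c d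
  proof -
    have "(\<Sum>\<alpha><N - n. b \<alpha> c d * slope u e (\<nu> \<alpha>) a)
        = (\<Sum>\<alpha><N - n. if \<alpha> = a then b \<alpha> c d * slope u e (\<nu> \<alpha>) a else 0)"
      using diag[OF _ that] by (intro sum.cong refl) auto
    then show ?thesis by (simp add: \<theta>_def k_def)
  qed
  have lap: "laplacian_coord N n X h u = angle u * (B + T)"
  proof -
    have "(\<Sum>c<n. (\<Sum>d<n. (\<Sum>\<alpha><N - n. b \<alpha> c d * slope u e (\<nu> \<alpha>) d))\<^sup>2) = (\<Sum>c<n. (\<Sum>d<n. \<theta> d * k d c d)\<^sup>2)"
      by (simp add: Q cong: sum.cong_simp)
    moreover have "(\<Sum>c<n. \<Sum>d<n. \<Sum>a<n. (\<Sum>\<alpha><N - n. b \<alpha> c d * slope u e (\<nu> \<alpha>) a)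
          * (\<Sum>\<alpha><N - n. b \<alpha> c a * slope u e (\<nu> \<alpha>) d))
        = (\<Sum>c<n. \<Sum>d<n. \<Sum>a<n. \<theta> a * \<theta> d * (k a c d * k d c a))"
      by (intro sum.cong refl) (simp add: Q)
    ultimately show ?thesis
      using laplacian_in_frame[OF u w0 n h parallel e \<nu>]
      by (simp add: T_def B_def b_def add.assoc)
  qed
  have ST: "(1 - 1 / s) * S \<le> S + T"
  proof -
    have "k i j l = k i l j" for i j l
    proof (cases "i < N - n")
      case True
      then have "ip N (\<nu> i) (E u a) = 0" if "a < n" for a using \<nu> that by (simp add: normal_frame_def)
      then show ?thesis unfolding k_def b_def by (simp add: sff_frame_sym[OF u])
    qed (simp add: k_def)
    then show ?thesis
      unfolding S_def T_def add.assoc[symmetric]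
      by (rule curvature_form_lower_bound[OF _ s le[folded prod]])
  qed
  have BT: "(1 - 1 / s) * B \<le> B + T"
  proof -
    have "(1 - 1 / s) * B = (1 - 1 / s) * S + (1 - 1 / s) * (B - S)"
      by (simp only: distrib_left[symmetric]) simp
    also have "\<dots> \<le> (S + T) + 1 * (B - S)"
      using s SB by (intro add_mono ST mult_right_mono) auto
    finally show ?thesis by simp
  qed
  have "0 \<le> (1 - 1 / s) * B"
    unfolding B_def using s by (intro mult_nonneg_nonneg sum_nonneg) auto
  from order_trans[OF this BT] have "1 * (B + T) \<le> angle u * (B + T)"
    by (rule mult_right_mono[OF ge1])
  then have "B + T \<le> angle u * (B + T)" by simp
  with BT show ?thesis unfolding lap B by (rule order_trans)
qed

end

section \<open>From the chart to the submanifold\<close>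

lemma grassmannian_frame:
  assumes "P0 \<in> grassmannian n m" "0 < n"
  shows "orthonormal (n + m) n (SOME f. f \<in> P0)"
proof -
  obtain b where b: "P0 = oriented_span (n + m) n b" "\<And>i. i < n \<Longrightarrow> b i \<in> topspace (Euclidean_space (n + m))"
      "lin_indep n b"
    using assms(1) by (auto simp: grassmannian_def)
  then have "\<exists>f. f \<in> P0" using oriented_span_nonempty[OF b(2,3) assms(2)] by simp
  then have "(SOME f. f \<in> P0) \<in> P0" by (rule someI_ex)
  then show ?thesis unfolding b(1) by (simp add: oriented_span_def)
qed

text \<open>\<open>w\<close> is computed with a basis chosen from the oriented span. The change of
  basis to it contributes its determinant to the numerator and, since the chosen basis is positively
  oriented, exactly the same positive number as the root of the Gram determinant.\<close>

lemma w_oriented_span: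
  assumes b: "\<And>i. i < n \<Longrightarrow> b i \<in> topspace (Euclidean_space (n + m))" and indep: "lin_indep n b" and n: "0 < n"
  shows "w n m (oriented_span (n + m) n b) P0
     = det (mat n n (\<lambda>(i, j). ip (n + m) (b i) ((SOME f. f \<in> P0) j)))
        / sqrt (det (mat n n (\<lambda>(i, j). ip (n + m) (b i) (b j))))"
proof -
  let ?N = "n + m"
  define e where "e = (SOME e. e \<in> oriented_span ?N n b)"
  have "e \<in> oriented_span ?N n b"
    unfolding e_def by (rule someI_ex[OF oriented_span_nonempty[OF b indep n]])
  then have e: "orthonormal ?N n e" "\<And>i. i < n \<Longrightarrow> \<exists>c. e i = lincomb n c b" "0 < det (ip_matrix ?N n e b)"
    by (auto simp: oriented_span_def)
  then obtain P where P: "\<And>i. i < n \<Longrightarrow> e i = lincomb n (P i) b" by metis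
  let ?R = "det (mat n n (\<lambda>(i, j). ip ?N (b i) (e j)))"
  have R: "0 < ?R"
    using e(3) det_transpose_entries[of n "\<lambda>i j. ip ?N (b i) (e j)"] by (simp add: ip_matrix_def ip_commute)
  have "sqrt (det (mat n n (\<lambda>(i, j). ip ?N (b i) (b j)))) = ?R"
    using R by (simp add: Gram_determinant_frame[OF e(1) P])
  moreover note det_change_of_frame[OF e(1) P, of "SOME f. f \<in> P0"]
  moreover have "w n m (oriented_span ?N n b) P0 = det (mat n n (\<lambda>(i, j). ip ?N (e i) ((SOME f. f \<in> P0) j)))"
    by (simp add: w_def e_def ip_matrix_def)
  ultimately show ?thesis using R by simp
qed

lemma local_param_immersed_chart:
  assumes "oriented_submanifold n m M A" "(U, X) \<in> A"
  shows "immersed_chart n (n + m) U X"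
proof -
  have lp: "openin (Euclidean_space n) U" "embedding_map (subtopology (Euclidean_space n) U) M X"
      "\<And>k. k < n + m \<Longrightarrow> C_infinity n U (\<lambda>u. X u k)" "\<And>u. u \<in> U \<Longrightarrow> lin_indep n (coord_frame X u)"
    using assms by (auto simp: oriented_submanifold_def local_param_def)
  have "X x \<in> topspace (Euclidean_space (n + m))" if "x \<in> U" for x
  proof -
    have "continuous_map (subtopology (Euclidean_space n) U) M X"
      using lp(2) by (auto simp: embedding_map_def continuous_map_in_subtopology dest: homeomorphic_imp_continuous_map)
    moreover have "x \<in> topspace (subtopology (Euclidean_space n) U)"
      using openin_subset[OF lp(1)] that by auto
    ultimately have "X x \<in> topspace M" by (auto simp: continuous_map_def)
    then show ?thesis using assms(1) by (auto simp: oriented_submanifold_def)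
  qed
  then show ?thesis using lp by unfold_locales
qed

text \<open>\<open>gauss_map\<close> may select a different chart at every point, while the
  Laplacian differentiates along one chart. The orientation compatibility of the atlas makes the
  value independent of the selection.\<close>

lemma gauss_map_chart:
  assumes M: "oriented_submanifold n m M A" and UX: "(U, X) \<in> A" and x: "x \<in> U"
  shows "gauss_map n m A (X x) = oriented_span (n + m) n (coord_frame X x)"
proof -
  obtain V Y where c: "(SOME c. c \<in> A \<and> X x \<in> snd c ` fst c) = (V, Y)" by fastforce
  have "(U, X) \<in> A \<and> X x \<in> snd (U, X) ` fst (U, X)" using UX x by simp
  then have "\<exists>c. c \<in> A \<and> X x \<in> snd c ` fst c" by (rule exI)
  from someI_ex[OF this] have VY: "(V, Y) \<in> A" "X x \<in> Y ` V" unfolding c by simp_all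
  have inv: "inv_into V Y (X x) \<in> V" "Y (inv_into V Y (X x)) = X x"
    by (rule inv_into_into[OF VY(2)], rule f_inv_into_f[OF VY(2)])
  have "oriented_span (n + m) n (coord_frame X x) = oriented_span (n + m) n (coord_frame Y (inv_into V Y (X x)))"
  proof -
    have "\<forall>(U, X)\<in>A. \<forall>(V, Y)\<in>A. \<forall>u\<in>U. \<forall>u'\<in>V. X u = Y u' \<longrightarrow>
        oriented_span (n + m) n (coord_frame X u) = oriented_span (n + m) n (coord_frame Y u')"
      using M unfolding oriented_submanifold_def by (elim conjE)
    from bspec[OF this UX] have "\<forall>(V, Y)\<in>A. \<forall>u\<in>U. \<forall>u'\<in>V. X u = Y u' \<longrightarrow>
        oriented_span (n + m) n (coord_frame X u) = oriented_span (n + m) n (coord_frame Y u')"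
      by simp
    from bspec[OF this VY(1)] show ?thesis using x inv by simp
  qed
  then show ?thesis by (simp add: gauss_map_def in_chart_def c)
qed

text \<open>The chart that \<open>in_chart\<close> selects depends only on A and p, so both sides
  are evaluated in the same chart and at the same coordinate point.\<close>

lemma laplace_beltrami_lower_bound:
  assumes n: "0 < n" and M: "oriented_submanifold n m M A" and H: "parallel_mean_curvature n m A"
    and p: "p \<in> topspace M" and P0: "P0 \<in> grassmannian n m"
    and w: "0 < w n m (gauss_map n m A p) P0"
    and s: "1 \<le> s" and le: "((v n m (gauss_map n m A p) P0)\<^sup>2) powr s \<le> 9"
  shows "(1 - 1 / s) * B_norm_sq n m A p
     \<le> laplace_beltrami n m A ((\<lambda>P. v n m P P0) \<circ> gauss_map n m A) p"
proof -
  obtain U X where c: "(SOME c. c \<in> A \<and> p \<in> snd c ` fst c) = (U, X)" by fastforce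
  have "p \<in> (\<Union>(U, X)\<in>A. X ` U)" using M p by (simp add: oriented_submanifold_def)
  then have "\<exists>c. c \<in> A \<and> p \<in> snd c ` fst c" by force
  from someI_ex[OF this] have UX: "(U, X) \<in> A" "p \<in> X ` U" unfolding c by simp_all
  define u where "u = inv_into U X p"
  have u: "u \<in> U" "X u = p" 
    unfolding u_def by (rule inv_into_into[OF UX(2)], rule f_inv_into_f[OF UX(2)])
  define f where "f = (SOME f. f \<in> P0)"
  interpret chart_angle n "n + m" U X f
    using local_param_immersed_chart[OF M UX(1)] by (simp add: chart_angle_def)
  have wx: "w n m (gauss_map n m A (X x)) P0 = wdet x / sqrt (det (metric (n + m) n X x))" if "x \<in> U" for x
  proof -
    have "w n m (oriented_span (n + m) n (coord_frame X x)) P0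
        = det (mat n n (\<lambda>(i, j). ip (n + m) (E x i) (f j)))
          / sqrt (det (mat n n (\<lambda>(i, j). ip (n + m) (E x i) (E x j))))"
      unfolding f_def by (rule w_oriented_span) (use E_space[OF that] indep[OF that] n in auto)
    then show ?thesis by (simp only: gauss_map_chart[OF M UX(1) that] wdet_def metric_eq)
  qed
  have h: "((\<lambda>P. v n m P P0) \<circ> gauss_map n m A \<circ> X) x = angle x" if "x \<in> U" for x
    by (simp add: v_def wx[OF that] angle_def)
  have "0 < wdet u" using w wx[OF u(1)] det_metric_pos[OF u(1)] u(2) by (simp add: zero_less_divide_iff)
  moreover have "((angle u)\<^sup>2) powr s \<le> 9" using le h[OF u(1)] u(2) by simp
  moreover have "normal_deriv_H (n + m) n X u a k = 0" if "a < n" "k < n + m" for a k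
    using bspec[OF H[unfolded parallel_mean_curvature_def] UX(1)] u(1) that by simp
  moreover have "orthonormal (n + m) n f" unfolding f_def by (rule grassmannian_frame[OF P0 n])
  ultimately have "(1 - 1 / s) * sff_norm_sq (n + m) n X u
      \<le> laplacian_coord (n + m) n X ((\<lambda>P. v n m P P0) \<circ> gauss_map n m A \<circ> X) u"
    using u(1) n s h by (intro laplacian_lower_bound) auto
  then show ?thesis by (simp add: B_norm_sq_def laplace_beltrami_def in_chart_def c u_def)
qed

theorem theorem3p1:
  shows "(\<forall>n m M A p P0.
            3 \<le> n \<and> 2 \<le> m \<and> oriented_submanifold n m M A \<and> parallel_mean_curvature n m A \<and>
            p \<in> topspace M \<and> P0 \<in> grassmannian n m \<and>
            0 < w n m (gauss_map n m A p) P0 \<and> v n m (gauss_map n m A p) P0 \<le> 3 \<longrightarrow>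
            0 \<le> laplace_beltrami n m A ((\<lambda>P. v n m P P0) \<circ> gauss_map n m A) p) \<and>
         (\<forall>\<beta>0<3. \<exists>K0>0. \<forall>n m M A p P0.
            3 \<le> n \<and> 2 \<le> m \<and> oriented_submanifold n m M A \<and> parallel_mean_curvature n m A \<and>
            p \<in> topspace M \<and> P0 \<in> grassmannian n m \<and>
            0 < w n m (gauss_map n m A p) P0 \<and> v n m (gauss_map n m A p) P0 \<le> \<beta>0 \<longrightarrow>
            K0 * B_norm_sq n m A p
              \<le> laplace_beltrami n m A ((\<lambda>P. v n m P P0) \<circ> gauss_map n m A) p)"
proof (intro conjI allI impI)
  fix n m M A p P0
  assume *: "3 \<le> n \<and> 2 \<le> m \<and> oriented_submanifold n m M A \<and> parallel_mean_curvature n m A \<and>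
            p \<in> topspace M \<and> P0 \<in> grassmannian n m \<and>
            0 < w n m (gauss_map n m A p) P0 \<and> v n m (gauss_map n m A p) P0 \<le> 3"
  then have "0 < v n m (gauss_map n m A p) P0" by (simp add: v_def)
  then have "(v n m (gauss_map n m A p) P0)\<^sup>2 \<le> 3\<^sup>2" using * by (intro power_mono) auto
  \<comment> \<open>With s = 1 the factor \<open>1 - 1 / s\<close> is 0, and the general bound
    becomes the first claim.\<close>
  then have "((v n m (gauss_map n m A p) P0)\<^sup>2) powr 1 \<le> 9" by simp
  then have "(1 - 1 / 1) * B_norm_sq n m A p
     \<le> laplace_beltrami n m A ((\<lambda>P. v n m P P0) \<circ> gauss_map n m A) p"
    using * by (intro laplace_beltrami_lower_bound) auto
  then show "0 \<le> laplace_beltrami n m A ((\<lambda>P. v n m P P0) \<circ> gauss_map n m A) p" by simp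
next
  fix \<beta>0 :: real assume "\<beta>0 < 3"
  \<comment> \<open>\<open>\<beta>0\<close> may be small or even negative; raising it to at least 2
    makes \<open>ln \<beta>\<close> positive. The exponent s is the one with
    \<open>\<beta> powr s = 3\<close>.\<close>
  define \<beta> where "\<beta> = max \<beta>0 2"
  define s where "s = ln 3 / ln \<beta>"
  have \<beta>: "2 \<le> \<beta>" "\<beta> < 3" "\<beta>0 \<le> \<beta>" using \<open>\<beta>0 < 3\<close> by (auto simp: \<beta>_def)
  then have "0 < ln \<beta>" "ln \<beta> < ln 3" by simp_all
  then have s: "1 < s" by (simp add: s_def)
  have \<beta>s: "(\<beta>\<^sup>2) powr s = 9"
  proof -
    have "(\<beta>\<^sup>2) powr s = exp (s * (2 * ln \<beta>))" using \<beta> by (simp add: powr_def ln_realpow)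
    also have "s * (2 * ln \<beta>) = 2 * ln 3" using \<open>0 < ln \<beta>\<close> by (simp add: s_def)
    also have "exp (2 * ln 3) = (9 :: real)" by (simp add: exp_double)
    finally show ?thesis .
  qed
  show "\<exists>K0>0. \<forall>n m M A p P0.
            3 \<le> n \<and> 2 \<le> m \<and> oriented_submanifold n m M A \<and> parallel_mean_curvature n m A \<and>
            p \<in> topspace M \<and> P0 \<in> grassmannian n m \<and>
            0 < w n m (gauss_map n m A p) P0 \<and> v n m (gauss_map n m A p) P0 \<le> \<beta>0 \<longrightarrow>
            K0 * B_norm_sq n m A p
              \<le> laplace_beltrami n m A ((\<lambda>P. v n m P P0) \<circ> gauss_map n m A) p"
  proof (intro exI[of _ "1 - 1 / s"] conjI allI impI)
    show "0 < 1 - 1 / s" using s by simp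
    fix n m M A p P0
    assume *: "3 \<le> n \<and> 2 \<le> m \<and> oriented_submanifold n m M A \<and> parallel_mean_curvature n m A \<and>
            p \<in> topspace M \<and> P0 \<in> grassmannian n m \<and>
            0 < w n m (gauss_map n m A p) P0 \<and> v n m (gauss_map n m A p) P0 \<le> \<beta>0"
    then have "0 < v n m (gauss_map n m A p) P0" by (simp add: v_def)
    then have "(v n m (gauss_map n m A p) P0)\<^sup>2 \<le> \<beta>\<^sup>2" using * \<beta> by (intro power_mono) auto
    then have "((v n m (gauss_map n m A p) P0)\<^sup>2) powr s \<le> (\<beta>\<^sup>2) powr s"
      using s by (intro powr_mono2) auto
    then have "((v n m (gauss_map n m A p) P0)\<^sup>2) powr s \<le> 9" by (simp add: \<beta>s)
    then show "(1 - 1 / s) * B_norm_sq n m A p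
         \<le> laplace_beltrami n m A ((\<lambda>P. v n m P P0) \<circ> gauss_map n m A) p"
      using * s by (intro laplace_beltrami_lower_bound) auto
  qed
qed

end
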